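(* Let $\mathcal{C},\mathcal{D}$ be triangulated categories of finite type whose numerical Grothendieck groups have finite rank, and let $S : \mathcal{C} \to \mathcal{D}$ be a spherical functor with right adjoint functor $R:\mathcal{D}\to\mathcal{C}$, twist functor $T_S$ and cotwist functor $C_S$. Assume that the essential image of $R$ contains a split-generator of $\mathcal{C}$. Assume moreover that $$h_0(C_S) \leq \log\rho([C_S])$$ and that there exists an element $v \in \mathcal{N}(\mathcal{C}) \otimes_\mathbb{Z} \mathbb{C}$ such that $[S]v \neq 0$ and $[C_S]v = \lambda v$ for some $\lambda\in\mathbb{C}$ with $|\lambda| = \rho([C_S])$. Then $$h_0(T_S) \leq \log\rho([T_S]).$$
   Context: Standing assumptions: all triangulated categories are linear over a field $\mathbb{K}$, admit a dg enhancement (i.e. are equivalent, as triangulated categories, to $H^0(\mathcal{A})$ for a pretriangulated dg category $\mathcal{A}$), and all exact functors between them admit dg lifts; cones of natural transformations are formed functorially via these. A triangulated category is assumed to have a split-generator whenever the categorical entropy of one of its endofunctors is considered. Split-generator: an object $G$ of a triangulated category $\mathcal{D}$ such that the smallest full triangulated subcategory containing $G$ and closed under taking direct summands is $\mathcal{D}$. Categorical complexity: for objects $E,F$ of $\mathcal{D}$ and $t \in \mathbb{R}$, $\delta_t(E,F)=0$ if $F\cong 0$; otherwise $\delta_t(E,F) \in [0,\infty]$ is the infimum of $\sum_{i=1}^k e^{n_i t}$ over all sequences of integers $(n_1,\dots,n_k)$ for which there exist an object $F'$ and objects $0=A_0,A_1,\dots,A_k = F\oplus F'$ with exact triangles $A_{i-1}\to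 A_i \to E[n_i] \to A_{i-1}[1]$ for $i=1,\dots,k$. Categorical entropy of an exact endofunctor $\Phi$ of $\mathcal{D}$: $h_t(\Phi) = \lim_{n\to\infty}\frac1n\log\delta_t(G,\Phi^nG) \in [-\infty,\infty)$ for a split-generator $G$ (the limit exists and is independent of $G$). Spherical functor: an exact functor $S:\mathcal{C}\to\mathcal{D}$ with right and left adjoints $R,L$ such that (1) the twist functor $T_S=\mathrm{Cone}(SR\xrightarrow{\varepsilon}\mathrm{Id}_\mathcal{D})$ ($\varepsilon$ the counit of $S\dashv R$) is an exact autoequivalence of $\mathcal{D}$; (2) the cotwist functor $C_S=\mathrm{Cone}(\mathrm{Id}_\mathcal{C}\xrightarrow{\eta}RS)[-1]$ ($\eta$ the unit of $S\dashv R$) is an exact autoequivalence of $\mathcal{C}$; (3) $R\cong LT_S[-1]$; (4) $R\cong C_SL[1]$. Finite type: $\sum_{i\in\mathbb{Z}}\dim\mathrm{Hom}_\mathcal{D}(E,F[i])<\infty$ for all objects $E,F$. The Grothendieck group $K(\mathcal{D})$ is the free abelian group on objects modulo $E-F+G$ for each exact triangle $E\to F\to G\to E[1]$; for $\mathcal{D}$ of finite type, the Euler form is $\chi([E],[F])=\sum_i(-1)^i\dim\mathrm{Hom}_\mathcal{D}(E,F[i])$, and the numerical Grothendieck group is $\mathcal{N}(\mathcal{D})=K(\mathcal{D})/\langle[E] : \chi([E],-)=0\rangle$. An exact functor $\Phi:\mathcal{C}\to\mathcal{D}$ admitting a right adjoint induces a linear map $[\Phi]:\mathcal{N}(\mathcal{C})\otimes_\mathbb{Z}\mathbb{C}\to\mathcal{N}(\mathcal{D})\otimes_\mathbb{Z}\mathbb{C}$.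 $\rho$ denotes the spectral radius (largest absolute value of the eigenvalues). *)

theory Defs
  imports Complex_Main
    "HOL-Algebra.AbelCoset"
    "HOL-Algebra.Free_Abelian_Groups"
    "HOL-Library.Extended_Real"
    "Jordan_Normal_Form.Missing_VectorSpace"
begin

section \<open>Linear categories and functors\<close>

text \<open>The ground field is a HOL-Algebra field \<open>K\<close>; morphism spaces are HOL-Algebra modules, of which
  the ring fields \<open>mult\<close> and \<open>one\<close> are never used.  Morphism spaces of different pairs of objects
  need not be disjoint, so operations on morphisms carry their source and target explicitly:
  \<open>cat_comp C X Y Z g f\<close> is the composite of \<open>f : X \<rightarrow> Y\<close> and \<open>g : Y \<rightarrow> Z\<close>.\<close>

record ('k, 'o, 'm) lin_cat =
  Ob :: "'o set"
  Hom :: "'o \<Rightarrow> 'o \<Rightarrow> ('k, 'm) module"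
  cat_comp :: "'o \<Rightarrow> 'o \<Rightarrow> 'o \<Rightarrow> 'm \<Rightarrow> 'm \<Rightarrow> 'm"
  ident :: "'o \<Rightarrow> 'm"

locale linear_category =
  fixes K :: "'k ring" and C :: "('k, 'o, 'm, 'z) lin_cat_scheme"
  assumes Hom_vectorspace:
      "\<lbrakk>X \<in> Ob C; Y \<in> Ob C\<rbrakk> \<Longrightarrow> vectorspace K (Hom C X Y)"
    and comp_linear_right:
      "\<lbrakk>X \<in> Ob C; Y \<in> Ob C; Z \<in> Ob C; g \<in> carrier (Hom C Y Z)\<rbrakk>
        \<Longrightarrow> linear_map K (Hom C X Y) (Hom C X Z) (\<lambda>f. cat_comp C X Y Z g f)"
    and comp_linear_left:
      "\<lbrakk>X \<in> Ob C; Y \<in> Ob C; Z \<in> Ob C; f \<in> carrier (Hom C X Y)\<rbrakk>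
        \<Longrightarrow> linear_map K (Hom C Y Z) (Hom C X Z) (\<lambda>g. cat_comp C X Y Z g f)"
    and ident_closed: "X \<in> Ob C \<Longrightarrow> ident C X \<in> carrier (Hom C X X)"
    and ident_left:
      "\<lbrakk>X \<in> Ob C; Y \<in> Ob C; f \<in> carrier (Hom C X Y)\<rbrakk> \<Longrightarrow> cat_comp C X Y Y (ident C Y) f = f"
    and ident_right:
      "\<lbrakk>X \<in> Ob C; Y \<in> Ob C; f \<in> carrier (Hom C X Y)\<rbrakk> \<Longrightarrow> cat_comp C X X Y f (ident C X) = f"
    and comp_assoc:
      "\<lbrakk>X \<in> Ob C; Y \<in> Ob C; Z \<in> Ob C; V \<in> Ob C; f \<in> carrier (Hom C X Y);
        g \<in> carrier (Hom C Y Z); h \<in> carrier (Hom C Z V)\<rbrakk>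
        \<Longrightarrow> cat_comp C X Z V h (cat_comp C X Y Z g f) = cat_comp C X Y V (cat_comp C Y Z V h g) f"

definition is_iso :: "('k, 'o, 'm, 'z) lin_cat_scheme \<Rightarrow> 'o \<Rightarrow> 'o \<Rightarrow> 'm \<Rightarrow> bool" where
  "is_iso C X Y f \<longleftrightarrow> f \<in> carrier (Hom C X Y) \<and>
     (\<exists>g \<in> carrier (Hom C Y X).
        cat_comp C X Y X g f = ident C X \<and> cat_comp C Y X Y f g = ident C Y)"

definition iso_objects :: "('k, 'o, 'm, 'z) lin_cat_scheme \<Rightarrow> 'o \<Rightarrow> 'o \<Rightarrow> bool" where
  "iso_objects C X Y \<longleftrightarrow> X \<in> Ob C \<and> Y \<in> Ob C \<and> (\<exists>f. is_iso C X Y f)"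

definition is_zero_object :: "('k, 'o, 'm, 'z) lin_cat_scheme \<Rightarrow> 'o \<Rightarrow> bool" where
  "is_zero_object C X \<longleftrightarrow> X \<in> Ob C \<and>
     (\<forall>Y \<in> Ob C. carrier (Hom C X Y) = {\<zero>\<^bsub>Hom C X Y\<^esub>} \<and> carrier (Hom C Y X) = {\<zero>\<^bsub>Hom C Y X\<^esub>})"

text \<open>\<open>Z\<close> is a direct sum of \<open>X\<close> and \<open>Y\<close>.\<close>

definition is_direct_sum :: "('k, 'o, 'm, 'z) lin_cat_scheme \<Rightarrow> 'o \<Rightarrow> 'o \<Rightarrow> 'o \<Rightarrow> bool" where
  "is_direct_sum C X Y Z \<longleftrightarrow> X \<in> Ob C \<and> Y \<in> Ob C \<and> Z \<in> Ob C \<and>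
     (\<exists>i1 \<in> carrier (Hom C X Z). \<exists>i2 \<in> carrier (Hom C Y Z).
      \<exists>p1 \<in> carrier (Hom C Z X). \<exists>p2 \<in> carrier (Hom C Z Y).
        cat_comp C X Z X p1 i1 = ident C X \<and> cat_comp C Y Z Y p2 i2 = ident C Y \<and>
        cat_comp C Y Z X p1 i2 = \<zero>\<^bsub>Hom C Y X\<^esub> \<and> cat_comp C X Z Y p2 i1 = \<zero>\<^bsub>Hom C X Y\<^esub> \<and>
        cat_comp C Z X Z i1 p1 \<oplus>\<^bsub>Hom C Z Z\<^esub> cat_comp C Z Y Z i2 p2 = ident C Z)"

record ('o, 'm, 'p, 'n) cfunctor =
  fob :: "'o \<Rightarrow> 'p"
  fmor :: "'o \<Rightarrow> 'o \<Rightarrow> 'm \<Rightarrow> 'n"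

definition id_functor :: "('o, 'm, 'o, 'm) cfunctor" where
  "id_functor = \<lparr>fob = (\<lambda>X. X), fmor = (\<lambda>X Y f. f)\<rparr>"

definition comp_functor ::
    "('p, 'n, 'q, 'l) cfunctor \<Rightarrow> ('o, 'm, 'p, 'n) cfunctor \<Rightarrow> ('o, 'm, 'q, 'l) cfunctor"
    (infixr \<open>\<circ>\<^sub>F\<close> 75) where
  "G \<circ>\<^sub>F F = \<lparr>fob = (\<lambda>X. fob G (fob F X)),
      fmor = (\<lambda>X Y f. fmor G (fob F X) (fob F Y) (fmor F X Y f))\<rparr>"

definition linear_functor ::
    "'k ring \<Rightarrow> ('k, 'o, 'm, 'y) lin_cat_scheme \<Rightarrow> ('k, 'p, 'n, 'z) lin_cat_scheme
      \<Rightarrow> ('o, 'm, 'p, 'n) cfunctor \<Rightarrow> bool" where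
  "linear_functor K C D F \<longleftrightarrow>
     (\<forall>X \<in> Ob C. fob F X \<in> Ob D) \<and>
     (\<forall>X \<in> Ob C. \<forall>Y \<in> Ob C.
        linear_map K (Hom C X Y) (Hom D (fob F X) (fob F Y)) (fmor F X Y)) \<and>
     (\<forall>X \<in> Ob C. fmor F X X (ident C X) = ident D (fob F X)) \<and>
     (\<forall>X \<in> Ob C. \<forall>Y \<in> Ob C. \<forall>Z \<in> Ob C.
      \<forall>f \<in> carrier (Hom C X Y). \<forall>g \<in> carrier (Hom C Y Z).
        fmor F X Z (cat_comp C X Y Z g f)
          = cat_comp D (fob F X) (fob F Y) (fob F Z) (fmor F Y Z g) (fmor F X Y f))"

definition nat_trans ::
    "('k, 'o, 'm, 'y) lin_cat_scheme \<Rightarrow> ('k, 'p, 'n, 'z) lin_cat_scheme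
      \<Rightarrow> ('o, 'm, 'p, 'n) cfunctor \<Rightarrow> ('o, 'm, 'p, 'n) cfunctor \<Rightarrow> ('o \<Rightarrow> 'n) \<Rightarrow> bool" where
  "nat_trans C D F G a \<longleftrightarrow>
     (\<forall>X \<in> Ob C. a X \<in> carrier (Hom D (fob F X) (fob G X))) \<and>
     (\<forall>X \<in> Ob C. \<forall>Y \<in> Ob C. \<forall>f \<in> carrier (Hom C X Y).
        cat_comp D (fob F X) (fob F Y) (fob G Y) (a Y) (fmor F X Y f)
          = cat_comp D (fob F X) (fob G X) (fob G Y) (fmor G X Y f) (a X))"

definition nat_iso ::
    "('k, 'o, 'm, 'y) lin_cat_scheme \<Rightarrow> ('k, 'p, 'n, 'z) lin_cat_scheme
      \<Rightarrow> ('o, 'm, 'p, 'n) cfunctor \<Rightarrow> ('o, 'm, 'p, 'n) cfunctor \<Rightarrow> ('o \<Rightarrow> 'n) \<Rightarrow> bool" where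
  "nat_iso C D F G a \<longleftrightarrow> nat_trans C D F G a \<and>
     (\<forall>X \<in> Ob C. is_iso D (fob F X) (fob G X) (a X))"

definition iso_functors ::
    "('k, 'o, 'm, 'y) lin_cat_scheme \<Rightarrow> ('k, 'p, 'n, 'z) lin_cat_scheme
      \<Rightarrow> ('o, 'm, 'p, 'n) cfunctor \<Rightarrow> ('o, 'm, 'p, 'n) cfunctor \<Rightarrow> bool" where
  "iso_functors C D F G \<longleftrightarrow> (\<exists>a. nat_iso C D F G a)"

definition quasi_inverse ::
    "'k ring \<Rightarrow> ('k, 'o, 'm, 'y) lin_cat_scheme \<Rightarrow> ('k, 'p, 'n, 'z) lin_cat_scheme
      \<Rightarrow> ('o, 'm, 'p, 'n) cfunctor \<Rightarrow> ('p, 'n, 'o, 'm) cfunctor \<Rightarrow> bool" where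
  "quasi_inverse K C D F G \<longleftrightarrow> linear_functor K C D F \<and> linear_functor K D C G \<and>
     iso_functors C C (G \<circ>\<^sub>F F) id_functor \<and> iso_functors D D (F \<circ>\<^sub>F G) id_functor"

definition equivalence ::
    "'k ring \<Rightarrow> ('k, 'o, 'm, 'y) lin_cat_scheme \<Rightarrow> ('k, 'p, 'n, 'z) lin_cat_scheme
      \<Rightarrow> ('o, 'm, 'p, 'n) cfunctor \<Rightarrow> bool" where
  "equivalence K C D F \<longleftrightarrow> (\<exists>G. quasi_inverse K C D F G)"

text \<open>\<open>S : C \<rightarrow> D\<close> is left adjoint to \<open>R : D \<rightarrow> C\<close>.\<close>

definition adjunction ::
    "'k ring \<Rightarrow> ('k, 'o, 'm, 'y) lin_cat_scheme \<Rightarrow> ('k, 'p, 'n, 'z) lin_cat_scheme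
      \<Rightarrow> ('o, 'm, 'p, 'n) cfunctor \<Rightarrow> ('p, 'n, 'o, 'm) cfunctor
      \<Rightarrow> ('o \<Rightarrow> 'm) \<Rightarrow> ('p \<Rightarrow> 'n) \<Rightarrow> bool" where
  "adjunction K C D S R unit counit \<longleftrightarrow>
     linear_functor K C D S \<and> linear_functor K D C R \<and>
     nat_trans C C id_functor (R \<circ>\<^sub>F S) unit \<and> nat_trans D D (S \<circ>\<^sub>F R) id_functor counit \<and>
     (\<forall>X \<in> Ob C. cat_comp D (fob S X) (fob S (fob R (fob S X))) (fob S X)
          (counit (fob S X)) (fmor S X (fob R (fob S X)) (unit X)) = ident D (fob S X)) \<and>
     (\<forall>Y \<in> Ob D. cat_comp C (fob R Y) (fob R (fob S (fob R Y))) (fob R Y)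
          (fmor R (fob S (fob R Y)) Y (counit Y)) (unit (fob R Y)) = ident C (fob R Y))"

section \<open>Triangulated categories and exact functors\<close>

text \<open>The shift \<open>sh\<close> is an autoequivalence, not necessarily an automorphism, so a quasi-inverse
  \<open>ush\<close> (the shift by \<open>-1\<close>) is part of the structure.\<close>

record ('k, 'o, 'm) shift_cat = "('k, 'o, 'm) lin_cat" +
  sh :: "('o, 'm, 'o, 'm) cfunctor"
  ush :: "('o, 'm, 'o, 'm) cfunctor"

type_synonym ('o, 'm) triangle = "'o \<times> 'o \<times> 'o \<times> 'm \<times> 'm \<times> 'm"

record ('k, 'o, 'm) tri_cat = "('k, 'o, 'm) shift_cat" +
  Tri :: "('o, 'm) triangle set"

definition shift_ob :: "('k, 'o, 'm, 'z) shift_cat_scheme \<Rightarrow> int \<Rightarrow> 'o \<Rightarrow> 'o" where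
  "shift_ob C n X = (if n \<ge> 0 then (fob (sh C) ^^ nat n) X else (fob (ush C) ^^ nat (- n)) X)"

fun is_triangle :: "('k, 'o, 'm, 'z) shift_cat_scheme \<Rightarrow> ('o, 'm) triangle \<Rightarrow> bool" where
  "is_triangle C (X, Y, Z, u, v, w) \<longleftrightarrow> X \<in> Ob C \<and> Y \<in> Ob C \<and> Z \<in> Ob C \<and>
     u \<in> carrier (Hom C X Y) \<and> v \<in> carrier (Hom C Y Z) \<and> w \<in> carrier (Hom C Z (fob (sh C) X))"

fun triangle_morphism ::
    "('k, 'o, 'm, 'z) shift_cat_scheme \<Rightarrow> ('o, 'm) triangle \<Rightarrow> ('o, 'm) triangle
      \<Rightarrow> 'm \<Rightarrow> 'm \<Rightarrow> 'm \<Rightarrow> bool" where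
  "triangle_morphism C (X, Y, Z, u, v, w) (X', Y', Z', u', v', w') f g h \<longleftrightarrow>
     f \<in> carrier (Hom C X X') \<and> g \<in> carrier (Hom C Y Y') \<and> h \<in> carrier (Hom C Z Z') \<and>
     cat_comp C X Y Y' g u = cat_comp C X X' Y' u' f \<and>
     cat_comp C Y Z Z' h v = cat_comp C Y Y' Z' v' g \<and>
     cat_comp C Z (fob (sh C) X) (fob (sh C) X') (fmor (sh C) X X' f) w
       = cat_comp C Z Z' (fob (sh C) X') w' h"

fun triangle_iso ::
    "('k, 'o, 'm, 'z) shift_cat_scheme \<Rightarrow> ('o, 'm) triangle \<Rightarrow> ('o, 'm) triangle \<Rightarrow> bool" where
  "triangle_iso C (X, Y, Z, u, v, w) (X', Y', Z', u', v', w') \<longleftrightarrow>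
     is_triangle C (X, Y, Z, u, v, w) \<and> is_triangle C (X', Y', Z', u', v', w') \<and>
     (\<exists>f g h. triangle_morphism C (X, Y, Z, u, v, w) (X', Y', Z', u', v', w') f g h \<and>
        is_iso C X X' f \<and> is_iso C Y Y' g \<and> is_iso C Z Z' h)"

locale triangulated_category = linear_category K C
  for K :: "'k ring" and C :: "('k, 'o, 'm, 'z) tri_cat_scheme" +
  assumes zero_object: "\<exists>Z. is_zero_object C Z"
    and direct_sums: "\<lbrakk>X \<in> Ob C; Y \<in> Ob C\<rbrakk> \<Longrightarrow> \<exists>Z. is_direct_sum C X Y Z"
    and shift_equivalence: "quasi_inverse K C C (sh C) (ush C)"
    and Tri_is_triangle: "T \<in> Tri C \<Longrightarrow> is_triangle C T"
    and Tri_iso: "\<lbrakk>T \<in> Tri C; triangle_iso C T T'\<rbrakk> \<Longrightarrow> T' \<in> Tri C"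
    and TR1_ident: "\<lbrakk>X \<in> Ob C; is_zero_object C Z\<rbrakk> \<Longrightarrow>
          (X, X, Z, ident C X, \<zero>\<^bsub>Hom C X Z\<^esub>, \<zero>\<^bsub>Hom C Z (fob (sh C) X)\<^esub>) \<in> Tri C"
    and TR1_cone: "\<lbrakk>X \<in> Ob C; Y \<in> Ob C; u \<in> carrier (Hom C X Y)\<rbrakk>
          \<Longrightarrow> \<exists>Z v w. (X, Y, Z, u, v, w) \<in> Tri C"
    and TR2: "is_triangle C (X, Y, Z, u, v, w) \<Longrightarrow>
          (X, Y, Z, u, v, w) \<in> Tri C \<longleftrightarrow>
          (Y, Z, fob (sh C) X, v, w,
             \<ominus>\<^bsub>Hom C (fob (sh C) X) (fob (sh C) Y)\<^esub> fmor (sh C) X Y u) \<in> Tri C"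
    and TR3: "\<lbrakk>(X, Y, Z, u, v, w) \<in> Tri C; (X', Y', Z', u', v', w') \<in> Tri C;
          f \<in> carrier (Hom C X X'); g \<in> carrier (Hom C Y Y');
          cat_comp C X Y Y' g u = cat_comp C X X' Y' u' f\<rbrakk> \<Longrightarrow>
          \<exists>h. triangle_morphism C (X, Y, Z, u, v, w) (X', Y', Z', u', v', w') f g h"
    and TR4: "\<lbrakk>(X, Y, Z', f, f2, f3) \<in> Tri C; (Y, Z, X', g, g2, g3) \<in> Tri C;
          (X, Z, Y', cat_comp C X Y Z g f, h2, h3) \<in> Tri C\<rbrakk> \<Longrightarrow>
          \<exists>u v. (Z', Y', X', u, v,
                  cat_comp C X' (fob (sh C) Y) (fob (sh C) Z') (fmor (sh C) Y Z' f2) g3) \<in> Tri C \<and>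
            cat_comp C Y Z' Y' u f2 = cat_comp C Y Z Y' h2 g \<and>
            cat_comp C Z' Y' (fob (sh C) X) h3 u = f3 \<and>
            cat_comp C Z Y' X' v h2 = g2 \<and>
            cat_comp C Y' X' (fob (sh C) Y) g3 v
              = cat_comp C Y' (fob (sh C) X) (fob (sh C) Y) (fmor (sh C) X Y f) h3"

definition exact_functor ::
    "'k ring \<Rightarrow> ('k, 'o, 'm, 'y) tri_cat_scheme \<Rightarrow> ('k, 'p, 'n, 'z) tri_cat_scheme
      \<Rightarrow> ('o, 'm, 'p, 'n) cfunctor \<Rightarrow> bool" where
  "exact_functor K C D F \<longleftrightarrow> linear_functor K C D F \<and>
     (\<exists>s. nat_iso C D (F \<circ>\<^sub>F sh C) (sh D \<circ>\<^sub>F F) s \<and>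
        (\<forall>X Y Z u v w. (X, Y, Z, u, v, w) \<in> Tri C \<longrightarrow>
           (fob F X, fob F Y, fob F Z, fmor F X Y u, fmor F Y Z v,
              cat_comp D (fob F Z) (fob F (fob (sh C) X)) (fob (sh D) (fob F X))
                (s X) (fmor F Z (fob (sh C) X) w)) \<in> Tri D))"

definition exact_equivalence ::
    "'k ring \<Rightarrow> ('k, 'o, 'm, 'y) tri_cat_scheme \<Rightarrow> ('k, 'p, 'n, 'z) tri_cat_scheme
      \<Rightarrow> ('o, 'm, 'p, 'n) cfunctor \<Rightarrow> bool" where
  "exact_equivalence K C D F \<longleftrightarrow> exact_functor K C D F \<and> equivalence K C D F"

section \<open>Differential graded categories and enhancements\<close>

text \<open>Cohomological grading; \<open>dg_comp A X Y Z j i g f\<close> composes \<open>f\<close> of degree \<open>i\<close> with \<open>g\<close> of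
  degree \<open>j\<close>.\<close>

record ('k, 'o, 'm) dg_cat =
  dOb :: "'o set"
  dHom :: "'o \<Rightarrow> 'o \<Rightarrow> int \<Rightarrow> ('k, 'm) module"
  diff :: "'o \<Rightarrow> 'o \<Rightarrow> int \<Rightarrow> 'm \<Rightarrow> 'm"
  dg_comp :: "'o \<Rightarrow> 'o \<Rightarrow> 'o \<Rightarrow> int \<Rightarrow> int \<Rightarrow> 'm \<Rightarrow> 'm \<Rightarrow> 'm"
  dg_ident :: "'o \<Rightarrow> 'm"

definition koszul :: "('k, 'm) module \<Rightarrow> int \<Rightarrow> 'm \<Rightarrow> 'm" where
  "koszul M n x = (if even n then x else \<ominus>\<^bsub>M\<^esub> x)"

locale dg_category =
  fixes K :: "'k ring" and A :: "('k, 'o, 'm) dg_cat"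
  assumes dHom_vectorspace:
      "\<lbrakk>X \<in> dOb A; Y \<in> dOb A\<rbrakk> \<Longrightarrow> vectorspace K (dHom A X Y n)"
    and diff_linear:
      "\<lbrakk>X \<in> dOb A; Y \<in> dOb A\<rbrakk> \<Longrightarrow>
        linear_map K (dHom A X Y n) (dHom A X Y (n + 1)) (diff A X Y n)"
    and diff_diff:
      "\<lbrakk>X \<in> dOb A; Y \<in> dOb A; f \<in> carrier (dHom A X Y n)\<rbrakk> \<Longrightarrow>
        diff A X Y (n + 1) (diff A X Y n f) = \<zero>\<^bsub>dHom A X Y (n + 2)\<^esub>"
    and dg_comp_linear_right:
      "\<lbrakk>X \<in> dOb A; Y \<in> dOb A; Z \<in> dOb A; g \<in> carrier (dHom A Y Z j)\<rbrakk> \<Longrightarrow>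
        linear_map K (dHom A X Y i) (dHom A X Z (j + i)) (\<lambda>f. dg_comp A X Y Z j i g f)"
    and dg_comp_linear_left:
      "\<lbrakk>X \<in> dOb A; Y \<in> dOb A; Z \<in> dOb A; f \<in> carrier (dHom A X Y i)\<rbrakk> \<Longrightarrow>
        linear_map K (dHom A Y Z j) (dHom A X Z (j + i)) (\<lambda>g. dg_comp A X Y Z j i g f)"
    and dg_ident_closed: "X \<in> dOb A \<Longrightarrow> dg_ident A X \<in> carrier (dHom A X X 0)"
    and dg_ident_left:
      "\<lbrakk>X \<in> dOb A; Y \<in> dOb A; f \<in> carrier (dHom A X Y i)\<rbrakk> \<Longrightarrow>
        dg_comp A X Y Y 0 i (dg_ident A Y) f = f"
    and dg_ident_right:
      "\<lbrakk>X \<in> dOb A; Y \<in> dOb A; f \<in> carrier (dHom A X Y i)\<rbrakk> \<Longrightarrow>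
        dg_comp A X X Y i 0 f (dg_ident A X) = f"
    and dg_comp_assoc:
      "\<lbrakk>X \<in> dOb A; Y \<in> dOb A; Z \<in> dOb A; V \<in> dOb A; f \<in> carrier (dHom A X Y i);
        g \<in> carrier (dHom A Y Z j); h \<in> carrier (dHom A Z V l)\<rbrakk> \<Longrightarrow>
        dg_comp A X Z V l (j + i) h (dg_comp A X Y Z j i g f)
          = dg_comp A X Y V (l + j) i (dg_comp A Y Z V l j h g) f"
    and Leibniz:
      "\<lbrakk>X \<in> dOb A; Y \<in> dOb A; Z \<in> dOb A; f \<in> carrier (dHom A X Y i);
        g \<in> carrier (dHom A Y Z j)\<rbrakk> \<Longrightarrow>
        diff A X Z (j + i) (dg_comp A X Y Z j i g f)
          = dg_comp A X Y Z (j + 1) i (diff A Y Z j g) f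
            \<oplus>\<^bsub>dHom A X Z (j + i + 1)\<^esub>
            koszul (dHom A X Z (j + i + 1)) j (dg_comp A X Y Z j (i + 1) g (diff A X Y i f))"

definition cocycles :: "('k, 'o, 'm) dg_cat \<Rightarrow> 'o \<Rightarrow> 'o \<Rightarrow> 'm set" where
  "cocycles A X Y = {f \<in> carrier (dHom A X Y 0). diff A X Y 0 f = \<zero>\<^bsub>dHom A X Y 1\<^esub>}"

definition coboundaries :: "('k, 'o, 'm) dg_cat \<Rightarrow> 'o \<Rightarrow> 'o \<Rightarrow> 'm set" where
  "coboundaries A X Y = diff A X Y (- 1) ` carrier (dHom A X Y (- 1))"

definition H0_class :: "('k, 'o, 'm) dg_cat \<Rightarrow> 'o \<Rightarrow> 'o \<Rightarrow> 'm \<Rightarrow> 'm set" where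
  "H0_class A X Y f = coboundaries A X Y +>\<^bsub>dHom A X Y 0\<^esub> f"

text \<open>\<open>X'\<close> represents the shift \<open>X[n]\<close>, through mutually inverse closed morphisms \<open>s\<close> of degree \<open>-n\<close>
  and \<open>t\<close> of degree \<open>n\<close>.\<close>

definition is_dg_shift ::
    "('k, 'o, 'm) dg_cat \<Rightarrow> int \<Rightarrow> 'o \<Rightarrow> 'o \<times> 'm \<times> 'm \<Rightarrow> bool" where
  "is_dg_shift A n X = (\<lambda>(X', s, t). X' \<in> dOb A \<and>
     s \<in> carrier (dHom A X X' (- n)) \<and> t \<in> carrier (dHom A X' X n) \<and>
     diff A X X' (- n) s = \<zero>\<^bsub>dHom A X X' (- n + 1)\<^esub> \<and>
     diff A X' X n t = \<zero>\<^bsub>dHom A X' X (n + 1)\<^esub> \<and>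
     dg_comp A X X' X n (- n) t s = dg_ident A X \<and>
     dg_comp A X' X X' (- n) n s t = dg_ident A X')"

text \<open>\<open>Z\<close> is the cone of the closed degree \<open>0\<close> morphism \<open>f : X \<rightarrow> Y\<close>: as a graded object \<open>Z\<close> is the
  direct sum of \<open>X[1]\<close> (inclusion \<open>j\<close>, projection \<open>p\<close>) and \<open>Y\<close> (inclusion \<open>i\<close>, projection \<open>q\<close>),
  with \<open>f\<close> as the off-diagonal part of the differential.  The identity \<open>d q = - f p\<close> follows.\<close>

definition is_dg_cone ::
    "('k, 'o, 'm) dg_cat \<Rightarrow> 'o \<Rightarrow> 'o \<Rightarrow> 'm \<Rightarrow> 'o \<Rightarrow> 'm \<Rightarrow> 'm \<Rightarrow> 'm \<Rightarrow> 'm \<Rightarrow> bool" where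
  "is_dg_cone A X Y f Z i q j p \<longleftrightarrow> Z \<in> dOb A \<and>
     i \<in> carrier (dHom A Y Z 0) \<and> q \<in> carrier (dHom A Z Y 0) \<and>
     j \<in> carrier (dHom A X Z (- 1)) \<and> p \<in> carrier (dHom A Z X 1) \<and>
     dg_comp A Y Z Y 0 0 q i = dg_ident A Y \<and>
     dg_comp A X Z X 1 (- 1) p j = dg_ident A X \<and>
     dg_comp A Y Z X 1 0 p i = \<zero>\<^bsub>dHom A Y X 1\<^esub> \<and>
     dg_comp A X Z Y 0 (- 1) q j = \<zero>\<^bsub>dHom A X Y (- 1)\<^esub> \<and>
     dg_comp A Z Y Z 0 0 i q \<oplus>\<^bsub>dHom A Z Z 0\<^esub> dg_comp A Z X Z (- 1) 1 j p = dg_ident A Z \<and>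
     diff A Y Z 0 i = \<zero>\<^bsub>dHom A Y Z 1\<^esub> \<and>
     diff A Z X 1 p = \<zero>\<^bsub>dHom A Z X 2\<^esub> \<and>
     diff A X Z (- 1) j = dg_comp A X Y Z 0 0 i f"

definition pretriangulated :: "('k, 'o, 'm) dg_cat \<Rightarrow> bool" where
  "pretriangulated A \<longleftrightarrow> dOb A \<noteq> {} \<and>
     (\<forall>X \<in> dOb A. (\<exists>T. is_dg_shift A 1 X T) \<and> (\<exists>T. is_dg_shift A (- 1) X T)) \<and>
     (\<forall>X \<in> dOb A. \<forall>Y \<in> dOb A. \<forall>f \<in> cocycles A X Y. \<exists>Z i q j p. is_dg_cone A X Y f Z i q j p)"

definition dg_shift :: "('k, 'o, 'm) dg_cat \<Rightarrow> int \<Rightarrow> 'o \<Rightarrow> 'o \<times> 'm \<times> 'm" where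
  "dg_shift A n X = (SOME T. is_dg_shift A n X T)"

definition H0_shift :: "('k, 'o, 'm) dg_cat \<Rightarrow> int \<Rightarrow> ('o, 'm set, 'o, 'm set) cfunctor" where
  "H0_shift A n = \<lparr>fob = (\<lambda>X. fst (dg_shift A n X)),
     fmor = (\<lambda>X Y c.
       let (X', sX, tX) = dg_shift A n X; (Y', sY, tY) = dg_shift A n Y
       in coboundaries A X' Y' <+>\<^bsub>dHom A X' Y' 0\<^esub>
          (\<lambda>h. dg_comp A X' Y Y' (- n) n sY (dg_comp A X' X Y 0 n h tX)) ` c)\<rparr>"

text \<open>The homotopy category.  Its morphisms are cosets of coboundaries; an operation on cosets
  applies the operation of \<open>A\<close> to all representatives and saturates with respect to coboundaries.\<close>

definition H0_shift_cat :: "('k, 'o, 'm) dg_cat \<Rightarrow> ('k, 'o, 'm set) shift_cat" where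
  "H0_shift_cat A = \<lparr>Ob = dOb A,
     Hom = (\<lambda>X Y. \<lparr>carrier = H0_class A X Y ` cocycles A X Y,
                   monoid.mult = undefined, one = undefined,
                   ring.zero = coboundaries A X Y,
                   add = (\<lambda>c d. c <+>\<^bsub>dHom A X Y 0\<^esub> d),
                   smult = (\<lambda>a c. coboundaries A X Y <+>\<^bsub>dHom A X Y 0\<^esub>
                              (\<lambda>f. a \<odot>\<^bsub>dHom A X Y 0\<^esub> f) ` c)\<rparr>),
     cat_comp = (\<lambda>X Y Z d c. coboundaries A X Z <+>\<^bsub>dHom A X Z 0\<^esub>
                   (\<lambda>(g, f). dg_comp A X Y Z 0 0 g f) ` (d \<times> c)),
     ident = (\<lambda>X. H0_class A X X (dg_ident A X)),
     sh = H0_shift A 1, ush = H0_shift A (- 1)\<rparr>"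

definition H0_cone_triangles :: "('k, 'o, 'm) dg_cat \<Rightarrow> ('o, 'm set) triangle set" where
  "H0_cone_triangles A = {(X, Y, Z, H0_class A X Y f, H0_class A Y Z i,
       H0_class A Z X' (dg_comp A Z X X' (- 1) 1 s p)) | X Y Z f i q j p X' s t.
     X \<in> dOb A \<and> Y \<in> dOb A \<and> f \<in> cocycles A X Y \<and>
     is_dg_cone A X Y f Z i q j p \<and> dg_shift A 1 X = (X', s, t)}"

definition H0 :: "('k, 'o, 'm) dg_cat \<Rightarrow> ('k, 'o, 'm set) tri_cat" where
  "H0 A = shift_cat.extend (H0_shift_cat A)
     (tri_cat.fields {T. \<exists>T' \<in> H0_cone_triangles A. triangle_iso (H0_shift_cat A) T' T})"

record ('o, 'm, 'p, 'n) dg_fun =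
  dg_fob :: "'o \<Rightarrow> 'p"
  dg_fmor :: "'o \<Rightarrow> 'o \<Rightarrow> int \<Rightarrow> 'm \<Rightarrow> 'n"

definition dg_functor ::
    "'k ring \<Rightarrow> ('k, 'o, 'm) dg_cat \<Rightarrow> ('k, 'p, 'n) dg_cat \<Rightarrow> ('o, 'm, 'p, 'n) dg_fun \<Rightarrow> bool" where
  "dg_functor K A B F \<longleftrightarrow>
     (\<forall>X \<in> dOb A. dg_fob F X \<in> dOb B) \<and>
     (\<forall>X \<in> dOb A. \<forall>Y \<in> dOb A. \<forall>n.
        linear_map K (dHom A X Y n) (dHom B (dg_fob F X) (dg_fob F Y) n) (dg_fmor F X Y n)) \<and>
     (\<forall>X \<in> dOb A. \<forall>Y \<in> dOb A. \<forall>n. \<forall>f \<in> carrier (dHom A X Y n).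
        dg_fmor F X Y (n + 1) (diff A X Y n f)
          = diff B (dg_fob F X) (dg_fob F Y) n (dg_fmor F X Y n f)) \<and>
     (\<forall>X \<in> dOb A. dg_fmor F X X 0 (dg_ident A X) = dg_ident B (dg_fob F X)) \<and>
     (\<forall>X \<in> dOb A. \<forall>Y \<in> dOb A. \<forall>Z \<in> dOb A. \<forall>i j.
      \<forall>f \<in> carrier (dHom A X Y i). \<forall>g \<in> carrier (dHom A Y Z j).
        dg_fmor F X Z (j + i) (dg_comp A X Y Z j i g f)
          = dg_comp B (dg_fob F X) (dg_fob F Y) (dg_fob F Z) j i
              (dg_fmor F Y Z j g) (dg_fmor F X Y i f))"

definition H0_functor ::
    "('k, 'p, 'n) dg_cat \<Rightarrow> ('o, 'm, 'p, 'n) dg_fun \<Rightarrow> ('o, 'm set, 'p, 'n set) cfunctor" where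
  "H0_functor B F = \<lparr>fob = dg_fob F,
     fmor = (\<lambda>X Y c. coboundaries B (dg_fob F X) (dg_fob F Y)
               <+>\<^bsub>dHom B (dg_fob F X) (dg_fob F Y) 0\<^esub> dg_fmor F X Y 0 ` c)\<rparr>"

text \<open>Closed degree \<open>0\<close> natural transformations.\<close>

definition dg_nat_trans ::
    "('k, 'o, 'm) dg_cat \<Rightarrow> ('k, 'p, 'n) dg_cat
      \<Rightarrow> ('o, 'm, 'p, 'n) dg_fun \<Rightarrow> ('o, 'm, 'p, 'n) dg_fun \<Rightarrow> ('o \<Rightarrow> 'n) \<Rightarrow> bool" where
  "dg_nat_trans A B F G a \<longleftrightarrow>
     (\<forall>X \<in> dOb A. a X \<in> cocycles B (dg_fob F X) (dg_fob G X)) \<and>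
     (\<forall>X \<in> dOb A. \<forall>Y \<in> dOb A. \<forall>n. \<forall>f \<in> carrier (dHom A X Y n).
        dg_comp B (dg_fob F X) (dg_fob F Y) (dg_fob G Y) 0 n (a Y) (dg_fmor F X Y n f)
          = dg_comp B (dg_fob F X) (dg_fob G X) (dg_fob G Y) n 0 (dg_fmor G X Y n f) (a X))"

text \<open>\<open>T\<close> is the cone of \<open>a : F \<rightarrow> G\<close>: on objects it is the cone of \<open>a X\<close>, on morphisms it acts
  diagonally, by \<open>G\<close> and by the shift of \<open>F\<close> (whence the sign).\<close>

definition is_dg_cone_functor ::
    "('k, 'o, 'm) dg_cat \<Rightarrow> ('k, 'p, 'n) dg_cat
      \<Rightarrow> ('o, 'm, 'p, 'n) dg_fun \<Rightarrow> ('o, 'm, 'p, 'n) dg_fun \<Rightarrow> ('o \<Rightarrow> 'n)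
      \<Rightarrow> ('o, 'm, 'p, 'n) dg_fun \<Rightarrow> bool" where
  "is_dg_cone_functor A B F G a T \<longleftrightarrow> (\<exists>i q j p.
     (\<forall>X \<in> dOb A. is_dg_cone B (dg_fob F X) (dg_fob G X) (a X) (dg_fob T X)
        (i X) (q X) (j X) (p X)) \<and>
     (\<forall>X \<in> dOb A. \<forall>Y \<in> dOb A. \<forall>n. \<forall>f \<in> carrier (dHom A X Y n).
        dg_fmor T X Y n f
          = dg_comp B (dg_fob T X) (dg_fob G Y) (dg_fob T Y) 0 n (i Y)
              (dg_comp B (dg_fob T X) (dg_fob G X) (dg_fob G Y) n 0 (dg_fmor G X Y n f) (q X))
            \<oplus>\<^bsub>dHom B (dg_fob T X) (dg_fob T Y) n\<^esub>
            koszul (dHom B (dg_fob T X) (dg_fob T Y) n) n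
              (dg_comp B (dg_fob T X) (dg_fob F Y) (dg_fob T Y) (- 1) (n + 1) (j Y)
                (dg_comp B (dg_fob T X) (dg_fob F X) (dg_fob F Y) n 1
                  (dg_fmor F X Y n f) (p X)))))"

text \<open>A triangulated category together with a dg enhancement: a pretriangulated dg category \<open>enh\<close>
  and an exact equivalence \<open>enh_eq\<close> from its homotopy category.\<close>

record ('k, 'o, 'm, 'a, 'b) enh_cat = "('k, 'o, 'm) tri_cat" +
  enh :: "('k, 'a, 'b) dg_cat"
  enh_eq :: "('a, 'b set, 'o, 'm) cfunctor"

definition enhanced_triangulated_category ::
    "'k ring \<Rightarrow> ('k, 'o, 'm, 'a, 'b) enh_cat \<Rightarrow> bool" where
  "enhanced_triangulated_category K C \<longleftrightarrow> triangulated_category K C \<and>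
     dg_category K (enh C) \<and> pretriangulated (enh C) \<and>
     exact_equivalence K (H0 (enh C)) C (enh_eq C)"

definition dg_lift ::
    "'k ring \<Rightarrow> ('k, 'o, 'm, 'a, 'b) enh_cat \<Rightarrow> ('k, 'p, 'n, 'c, 'd) enh_cat
      \<Rightarrow> ('o, 'm, 'p, 'n) cfunctor \<Rightarrow> ('a, 'b, 'c, 'd) dg_fun \<Rightarrow> ('a \<Rightarrow> 'n) \<Rightarrow> bool" where
  "dg_lift K C D F dF m \<longleftrightarrow> dg_functor K (enh C) (enh D) dF \<and>
     nat_iso (H0 (enh C)) D (enh_eq D \<circ>\<^sub>F H0_functor (enh D) dF) (F \<circ>\<^sub>F enh_eq C) m"

definition has_dg_lift ::
    "'k ring \<Rightarrow> ('k, 'o, 'm, 'a, 'b) enh_cat \<Rightarrow> ('k, 'p, 'n, 'c, 'd) enh_cat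
      \<Rightarrow> ('o, 'm, 'p, 'n) cfunctor \<Rightarrow> bool" where
  "has_dg_lift K C D F \<longleftrightarrow> (\<exists>dF m. dg_lift K C D F dF m)"

text \<open>\<open>T\<close> is the functorial cone of the natural transformation \<open>a : F \<rightarrow> G\<close>: there are dg lifts of
  \<open>F\<close> and \<open>G\<close> and a closed degree \<open>0\<close> transformation between them inducing \<open>a\<close> on homotopy
  categories, whose dg cone is a dg lift of \<open>T\<close>.\<close>

definition is_cone_of ::
    "'k ring \<Rightarrow> ('k, 'o, 'm, 'a, 'b) enh_cat \<Rightarrow> ('k, 'p, 'n, 'c, 'd) enh_cat
      \<Rightarrow> ('o, 'm, 'p, 'n) cfunctor \<Rightarrow> ('o, 'm, 'p, 'n) cfunctor \<Rightarrow> ('o \<Rightarrow> 'n)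
      \<Rightarrow> ('o, 'm, 'p, 'n) cfunctor \<Rightarrow> bool" where
  "is_cone_of K C D F G a T \<longleftrightarrow> nat_trans C D F G a \<and>
     (\<exists>dF dG dT mF mG mT da.
        dg_lift K C D F dF mF \<and> dg_lift K C D G dG mG \<and> dg_lift K C D T dT mT \<and>
        dg_nat_trans (enh C) (enh D) dF dG da \<and>
        (\<forall>X \<in> dOb (enh C).
           let E = fob (enh_eq C) X; e = fob (enh_eq D)
           in cat_comp D (e (dg_fob dF X)) (fob F E) (fob G E) (a E) (mF X)
              = cat_comp D (e (dg_fob dF X)) (e (dg_fob dG X)) (fob G E) (mG X)
                  (fmor (enh_eq D) (dg_fob dF X) (dg_fob dG X)
                    (H0_class (enh D) (dg_fob dF X) (dg_fob dG X) (da X)))) \<and>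
        is_dg_cone_functor (enh C) (enh D) dF dG da dT)"

section \<open>Spherical functors\<close>

text \<open>\<open>S\<close> is spherical with right adjoint \<open>R\<close>, left adjoint \<open>L\<close>, twist \<open>T\<close> and cotwist \<open>W\<close>.\<close>

definition spherical_functor ::
    "'k ring \<Rightarrow> ('k, 'o, 'm, 'a, 'b) enh_cat \<Rightarrow> ('k, 'p, 'n, 'c, 'd) enh_cat
      \<Rightarrow> ('o, 'm, 'p, 'n) cfunctor \<Rightarrow> ('p, 'n, 'o, 'm) cfunctor \<Rightarrow> ('p, 'n, 'o, 'm) cfunctor
      \<Rightarrow> ('p, 'n, 'p, 'n) cfunctor \<Rightarrow> ('o, 'm, 'o, 'm) cfunctor \<Rightarrow> bool" where
  "spherical_functor K C D S R L T W \<longleftrightarrow>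
     exact_functor K C D S \<and> exact_functor K D C R \<and> exact_functor K D C L \<and>
     has_dg_lift K C D S \<and> has_dg_lift K D C R \<and> has_dg_lift K D C L \<and>
     has_dg_lift K D D T \<and> has_dg_lift K C C W \<and>
     (\<exists>unit' counit'. adjunction K D C L S unit' counit') \<and>
     (\<exists>unit counit P. adjunction K C D S R unit counit \<and>
        is_cone_of K D D (S \<circ>\<^sub>F R) id_functor counit T \<and>
        is_cone_of K C C id_functor (R \<circ>\<^sub>F S) unit P \<and> iso_functors C C W (ush C \<circ>\<^sub>F P)) \<and>
     exact_equivalence K D D T \<and>
     exact_equivalence K C C W \<and>
     iso_functors D C R (ush C \<circ>\<^sub>F L \<circ>\<^sub>F T) \<and>
     iso_functors D C R (sh C \<circ>\<^sub>F W \<circ>\<^sub>F L)"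

section \<open>Split-generators and categorical entropy\<close>

definition thick_subcategory :: "('k, 'o, 'm, 'z) tri_cat_scheme \<Rightarrow> 'o set \<Rightarrow> bool" where
  "thick_subcategory C P \<longleftrightarrow> P \<subseteq> Ob C \<and> (\<exists>Z \<in> P. is_zero_object C Z) \<and>
     (\<forall>X \<in> P. fob (sh C) X \<in> P \<and> fob (ush C) X \<in> P) \<and>
     (\<forall>X Y Z u v w. (X, Y, Z, u, v, w) \<in> Tri C \<longrightarrow> X \<in> P \<longrightarrow> Y \<in> P \<longrightarrow> Z \<in> P) \<and>
     (\<forall>X Y Z. is_direct_sum C X Y Z \<longrightarrow> Z \<in> P \<longrightarrow> X \<in> P)"

definition split_generator :: "('k, 'o, 'm, 'z) tri_cat_scheme \<Rightarrow> 'o \<Rightarrow> bool" where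
  "split_generator C G \<longleftrightarrow> G \<in> Ob C \<and> \<Inter> {P. thick_subcategory C P \<and> G \<in> P} = Ob C"

definition complexity ::
    "('k, 'o, 'm, 'z) tri_cat_scheme \<Rightarrow> real \<Rightarrow> 'o \<Rightarrow> 'o \<Rightarrow> ereal" where
  "complexity C t E F = (if is_zero_object C F then 0 else
     Inf {ereal (\<Sum>n\<leftarrow>ns. exp (real_of_int n * t)) | ns.
       \<exists>F' A. is_zero_object C (A 0) \<and> is_direct_sum C F F' (A (length ns)) \<and>
         (\<forall>i < length ns. \<exists>u v w.
            (A i, A (Suc i), shift_ob C (ns ! i) E, u, v, w) \<in> Tri C)})"

text \<open>Unlike the real \<open>ln\<close>, this logarithm is \<open>-\<infinity>\<close> at \<open>0\<close>.\<close>

definition elog :: "ereal \<Rightarrow> ereal" where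
  "elog x = (if x \<le> 0 then -\<infinity> else if x = \<infinity> then \<infinity> else ereal (ln (real_of_ereal x)))"

definition entropy ::
    "('k, 'o, 'm, 'z) tri_cat_scheme \<Rightarrow> real \<Rightarrow> ('o, 'm, 'o, 'm) cfunctor \<Rightarrow> ereal" where
  "entropy C t F = (let G = SOME G. split_generator C G in
     lim (\<lambda>n. elog (complexity C t G ((fob F ^^ n) G)) / ereal (real n)))"

section \<open>Numerical Grothendieck groups\<close>

definition finite_type :: "'k ring \<Rightarrow> ('k, 'o, 'm, 'z) tri_cat_scheme \<Rightarrow> bool" where
  "finite_type K C \<longleftrightarrow> (\<forall>E \<in> Ob C. \<forall>F \<in> Ob C.
     (\<forall>i. vectorspace.fin_dim K (Hom C E (shift_ob C i F))) \<and>
     finite {i. vectorspace.dim K (Hom C E (shift_ob C i F)) \<noteq> 0})"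

definition euler_form :: "'k ring \<Rightarrow> ('k, 'o, 'm, 'z) tri_cat_scheme \<Rightarrow> 'o \<Rightarrow> 'o \<Rightarrow> int" where
  "euler_form K C E F =
     (\<Sum>i | vectorspace.dim K (Hom C E (shift_ob C i F)) \<noteq> 0.
        (if even i then 1 else - 1) * int (vectorspace.dim K (Hom C E (shift_ob C i F))))"

text \<open>If \<open>f\<close> maps cosets of a subgroup \<open>M\<close> into cosets of \<open>N \<subseteq> G\<close>, this is the map
  \<open>M x \<mapsto> N (f x)\<close> induced on quotients.\<close>

definition coset_map :: "('b, 'z) monoid_scheme \<Rightarrow> 'b set \<Rightarrow> ('a \<Rightarrow> 'b) \<Rightarrow> 'a set \<Rightarrow> 'b set" where
  "coset_map G N f c = N <#>\<^bsub>G\<^esub> (f ` c)"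

definition groth_relations ::
    "('k, 'o, 'm, 'z) tri_cat_scheme \<Rightarrow> ('o \<Rightarrow>\<^sub>0 int) set" where
  "groth_relations C = generate (free_Abelian_group (Ob C))
     {frag_of E - frag_of F + frag_of G | E F G. \<exists>u v w. (E, F, G, u, v, w) \<in> Tri C}"

definition groth_group :: "('k, 'o, 'm, 'z) tri_cat_scheme \<Rightarrow> ('o \<Rightarrow>\<^sub>0 int) set monoid" where
  "groth_group C = free_Abelian_group (Ob C) Mod groth_relations C"

definition groth_class :: "('k, 'o, 'm, 'z) tri_cat_scheme \<Rightarrow> 'o \<Rightarrow> ('o \<Rightarrow>\<^sub>0 int) set" where
  "groth_class C E = groth_relations C #>\<^bsub>free_Abelian_group (Ob C)\<^esub> frag_of E"

text \<open>Vanishing of \<open>\<chi>([E],-)\<close> is tested on classes of objects, which generate the Grothendieck group.\<close>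

definition numerically_trivial ::
    "'k ring \<Rightarrow> ('k, 'o, 'm, 'z) tri_cat_scheme \<Rightarrow> ('o \<Rightarrow>\<^sub>0 int) set set" where
  "numerically_trivial K C = generate (groth_group C)
     {groth_class C E | E. E \<in> Ob C \<and> (\<forall>F \<in> Ob C. euler_form K C E F = 0)}"

definition num_groth_group ::
    "'k ring \<Rightarrow> ('k, 'o, 'm, 'z) tri_cat_scheme \<Rightarrow> ('o \<Rightarrow>\<^sub>0 int) set set monoid" where
  "num_groth_group K C = groth_group C Mod numerically_trivial K C"

definition num_groth_map ::
    "'k ring \<Rightarrow> ('k, 'p, 'n, 'z) tri_cat_scheme \<Rightarrow> ('o, 'm, 'p, 'n) cfunctor
      \<Rightarrow> ('o \<Rightarrow>\<^sub>0 int) set set \<Rightarrow> ('p \<Rightarrow>\<^sub>0 int) set set" where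
  "num_groth_map K D F = coset_map (groth_group D) (numerically_trivial K D)
     (coset_map (free_Abelian_group (Ob D)) (groth_relations D)
       (frag_extend (\<lambda>E. frag_of (fob F E))))"

text \<open>The rank of an abelian group is the maximal size of a \<open>\<int>\<close>-linearly independent subset.\<close>

definition has_finite_rank :: "('g, 'z) monoid_scheme \<Rightarrow> bool" where
  "has_finite_rank G \<longleftrightarrow> (\<exists>r. \<forall>B. finite B \<and> B \<subseteq> carrier G \<and>
      (\<forall>c :: 'g \<Rightarrow> int. finprod G (\<lambda>b. b [^]\<^bsub>G\<^esub> c b) B = \<one>\<^bsub>G\<^esub> \<longrightarrow> (\<forall>b \<in> B. c b = 0))
      \<longrightarrow> card B \<le> r)"

text \<open>The complex vector space \<open>G \<otimes>\<^sub>\<int> \<complex>\<close> for a multiplicatively written abelian group \<open>G\<close>: the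
  free abelian group on pairs \<open>(x, a)\<close>, standing for \<open>x \<otimes> a\<close>, modulo biadditivity.\<close>

definition tensor_free :: "('g, 'z) monoid_scheme \<Rightarrow> ('g \<times> complex \<Rightarrow>\<^sub>0 int) monoid" where
  "tensor_free G = free_Abelian_group (carrier G \<times> UNIV)"

definition tensor_relations :: "('g, 'z) monoid_scheme \<Rightarrow> ('g \<times> complex \<Rightarrow>\<^sub>0 int) set" where
  "tensor_relations G = generate (tensor_free G)
     ({frag_of (x \<otimes>\<^bsub>G\<^esub> y, a) - frag_of (x, a) - frag_of (y, a) | x y a.
         x \<in> carrier G \<and> y \<in> carrier G} \<union>
      {frag_of (x, a + b) - frag_of (x, a) - frag_of (x, b) | x a b. x \<in> carrier G})"

definition complexification ::
    "('g, 'z) monoid_scheme \<Rightarrow> (complex, ('g \<times> complex \<Rightarrow>\<^sub>0 int) set) module" where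
  "complexification G =
     \<lparr>carrier = carrier (tensor_free G Mod tensor_relations G),
      monoid.mult = undefined, one = undefined,
      ring.zero = tensor_relations G,
      add = (\<lambda>c d. c <#>\<^bsub>tensor_free G\<^esub> d),
      smult = (\<lambda>a. coset_map (tensor_free G) (tensor_relations G)
                 (frag_extend (\<lambda>(x, b). frag_of (x, a * b))))\<rparr>"

definition complexification_map ::
    "('h, 'z) monoid_scheme \<Rightarrow> ('g \<Rightarrow> 'h)
      \<Rightarrow> ('g \<times> complex \<Rightarrow>\<^sub>0 int) set \<Rightarrow> ('h \<times> complex \<Rightarrow>\<^sub>0 int) set" where
  "complexification_map H f = coset_map (tensor_free H) (tensor_relations H)
     (frag_extend (\<lambda>(x, b). frag_of (f x, b)))"

abbreviation num_space where
  "num_space K C \<equiv> complexification (num_groth_group K C)"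

text \<open>The linear map induced by a functor with target category \<open>D\<close>.\<close>

abbreviation num_map where
  "num_map K D F \<equiv> complexification_map (num_groth_group K D) (num_groth_map K D F)"

definition eigenvalues :: "(complex, 'v) module \<Rightarrow> ('v \<Rightarrow> 'v) \<Rightarrow> complex set" where
  "eigenvalues V f = {c. \<exists>v \<in> carrier V. v \<noteq> \<zero>\<^bsub>V\<^esub> \<and> f v = c \<odot>\<^bsub>V\<^esub> v}"

definition spectral_radius :: "(complex, 'v) module \<Rightarrow> ('v \<Rightarrow> 'v) \<Rightarrow> real" where
  "spectral_radius V f = Max (cmod ` eigenvalues V f)"

end

theory Submission
  imports Defs "HOL-Computational_Algebra.Polynomial" "HOL-Real_Asymp.Real_Asymp"
begin

text \<open>At \<open>t = 0\<close> the complexity \<open>\<delta>(E, F)\<close> is the least length of a filtration by shifts of \<open>E\<close> of an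
  object of which \<open>F\<close> is a retract; it is submultiplicative, so Fekete's lemma makes entropies of
  autoequivalences genuine limits.  Since \<open>T X\<close> is the cone of \<open>S R X \<rightarrow> X\<close>, and \<open>R T\<close> agrees with \<open>W R\<close> up
  to shift, \<open>T\<^sup>n G\<close> is built from \<open>G\<close> and shifts of the objects \<open>S W\<^sup>k R G\<close> with \<open>k < n\<close>.  As complexities
  of nonzero objects are at least \<open>1\<close>, this gives \<open>h\<^sub>0(T) \<le> h\<^sub>0(W)\<close>.

  On numerical Grothendieck groups \<open>[T][S] = [S][W]\<close>, because \<open>\<chi>(T S X, -) = \<chi>(S W X, -)\<close> by adjunction and
  the isomorphisms \<open>R \<cong> L T[-1] \<cong> W L[1]\<close>.  So \<open>[S] v\<close> is an eigenvector of \<open>[T]\<close> for the eigenvalue \<open>\<lambda>\<close>, whence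
  \<open>\<rho>([T]) \<ge> |\<lambda>| = \<rho>([W])\<close>.  That the maximum defining \<open>\<rho>([T])\<close> is taken over a finite set follows from
  finite rank: some nonzero integral polynomial annihilates \<open>[T]\<close>.\<close>

section \<open>Linear categories, functors and equivalences\<close>

text \<open>Complexity counts filtrations of \<open>F \<oplus> F'\<close>, so composing estimates
  means gluing filtrations of objects known only up to a summand. In terms of retracts this becomes
  one statement: an extension of retracts is a retract of an extension. The fillers that TR3
  provides for it are not canonical and are repaired by inverting a unipotent endomorphism.

  The comparison of \<open>[T][S]\<close> with \<open>[S][W]\<close> is shaped by the definition of
  numerically trivial classes as a subgroup generated by classes of objects. Equality of the Euler
  forms of \<open>A\<close> and \<open>B\<close> has to be witnessed by an object of class
  \<open>[A] - [B]\<close>; the cone of the zero map is one, and for it the long exact sequence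
  breaks into short ones. The two descriptions of \<open>R\<close> shift by \<open>+1\<close> and by
  \<open>-1\<close>, which have the same parity, so no sign appears.

  The complex space is a quotient of a free group, with no basis given. Identities there are checked
  on pure tensors, and torsion is removed by dividing the complex factor.\<close>

context linear_category
begin

text \<open>Morphism spaces of different pairs of objects may overlap, so an arrow is always named
  with its source and target; including membership in \<open>Ob C\<close> leaves one premise per
  arrow.\<close>

definition arr :: "'m \<Rightarrow> 'o \<Rightarrow> 'o \<Rightarrow> bool" where
  "arr f X Y \<longleftrightarrow> X \<in> Ob C \<and> Y \<in> Ob C \<and> f \<in> carrier (Hom C X Y)"

lemma arr_closed: "arr f X Y \<Longrightarrow> f \<in> carrier (Hom C X Y)"
  and arr_dom: "arr f X Y \<Longrightarrow> X \<in> Ob C"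
  by (simp_all add: arr_def)

lemma abelian_group_Hom:
  assumes "X \<in> Ob C" and "Y \<in> Ob C"
  shows "abelian_group (Hom C X Y)"
  using Hom_vectorspace[OF assms] by (simp add: vectorspace_def module_def)

lemma arr_ident: "X \<in> Ob C \<Longrightarrow> arr (ident C X) X X"
  by (simp add: arr_def ident_closed)

lemma arr_zero: "X \<in> Ob C \<Longrightarrow> Y \<in> Ob C \<Longrightarrow> arr \<zero>\<^bsub>Hom C X Y\<^esub> X Y"
  by (simp add: arr_def abelian_group_Hom abelian_group.axioms(1) abelian_monoid.zero_closed)

lemma arr_add: "arr f X Y \<Longrightarrow> arr g X Y \<Longrightarrow> arr (f \<oplus>\<^bsub>Hom C X Y\<^esub> g) X Y"
  by (simp add: arr_def abelian_group_Hom abelian_group.axioms(1) abelian_monoid.a_closed)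

lemma arr_uminus: "arr f X Y \<Longrightarrow> arr (\<ominus>\<^bsub>Hom C X Y\<^esub> f) X Y"
  by (simp add: arr_def abelian_group_Hom abelian_group.a_inv_closed)

lemma arr_minus: "arr f X Y \<Longrightarrow> arr g X Y \<Longrightarrow> arr (f \<ominus>\<^bsub>Hom C X Y\<^esub> g) X Y"
  by (simp add: arr_def abelian_group_Hom abelian_group.minus_closed)

lemma arr_comp:
  assumes "arr f X Y" and "arr g Y Z"
  shows "arr (cat_comp C X Y Z g f) X Z"
proof -
  interpret linear_map K "Hom C X Y" "Hom C X Z" "\<lambda>f. cat_comp C X Y Z g f"
    using assms by (intro comp_linear_right) (auto simp: arr_def)
  show ?thesis using assms by (auto simp: arr_def)
qed

lemmas arrs = arr_ident arr_zero arr_add arr_uminus arr_minus arr_comp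

lemma comp_id_left: "arr f X Y \<Longrightarrow> cat_comp C X Y Y (ident C Y) f = f"
  and comp_id_right: "arr f X Y \<Longrightarrow> cat_comp C X X Y f (ident C X) = f"
  by (simp_all add: arr_def ident_left ident_right)

lemma assoc: "\<lbrakk>arr f X Y; arr g Y Z; arr h Z V\<rbrakk>
    \<Longrightarrow> cat_comp C X Y V (cat_comp C Y Z V h g) f = cat_comp C X Z V h (cat_comp C X Y Z g f)"
  by (simp add: arr_def comp_assoc)

lemma
  assumes "arr g Y Z" and "X \<in> Ob C"
  shows comp_zero_right: "cat_comp C X Y Z g \<zero>\<^bsub>Hom C X Y\<^esub> = \<zero>\<^bsub>Hom C X Z\<^esub>"
    and comp_uminus_right: "arr f X Y \<Longrightarrow>
      cat_comp C X Y Z g (\<ominus>\<^bsub>Hom C X Y\<^esub> f) = \<ominus>\<^bsub>Hom C X Z\<^esub> cat_comp C X Y Z g f"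
    and comp_minus_right: "arr f X Y \<Longrightarrow> arr f' X Y \<Longrightarrow>
      cat_comp C X Y Z g (f \<ominus>\<^bsub>Hom C X Y\<^esub> f')
        = cat_comp C X Y Z g f \<ominus>\<^bsub>Hom C X Z\<^esub> cat_comp C X Y Z g f'"
proof -
  interpret linear_map K "Hom C X Y" "Hom C X Z" "\<lambda>f. cat_comp C X Y Z g f"
    using assms by (intro comp_linear_right) (auto simp: arr_def)
  show "cat_comp C X Y Z g \<zero>\<^bsub>Hom C X Y\<^esub> = \<zero>\<^bsub>Hom C X Z\<^esub>"
    using f0_is_0 .
  show "arr f X Y \<Longrightarrow>
      cat_comp C X Y Z g (\<ominus>\<^bsub>Hom C X Y\<^esub> f) = \<ominus>\<^bsub>Hom C X Z\<^esub> cat_comp C X Y Z g f"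
    using f_neg[of f] by (simp add: arr_def)
  show "arr f X Y \<Longrightarrow> arr f' X Y \<Longrightarrow>
      cat_comp C X Y Z g (f \<ominus>\<^bsub>Hom C X Y\<^esub> f')
        = cat_comp C X Y Z g f \<ominus>\<^bsub>Hom C X Z\<^esub> cat_comp C X Y Z g f'"
    using f_minus[of f f'] by (simp add: arr_def)
qed

lemma
  assumes "arr f X Y" and "Z \<in> Ob C"
  shows comp_zero_left: "cat_comp C X Y Z \<zero>\<^bsub>Hom C Y Z\<^esub> f = \<zero>\<^bsub>Hom C X Z\<^esub>"
    and comp_uminus_left: "arr g Y Z \<Longrightarrow>
      cat_comp C X Y Z (\<ominus>\<^bsub>Hom C Y Z\<^esub> g) f = \<ominus>\<^bsub>Hom C X Z\<^esub> cat_comp C X Y Z g f"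
    and comp_minus_left: "arr g Y Z \<Longrightarrow> arr g' Y Z \<Longrightarrow>
      cat_comp C X Y Z (g \<ominus>\<^bsub>Hom C Y Z\<^esub> g') f
        = cat_comp C X Y Z g f \<ominus>\<^bsub>Hom C X Z\<^esub> cat_comp C X Y Z g' f"
proof -
  interpret linear_map K "Hom C Y Z" "Hom C X Z" "\<lambda>g. cat_comp C X Y Z g f"
    using assms by (intro comp_linear_left) (auto simp: arr_def)
  show "cat_comp C X Y Z \<zero>\<^bsub>Hom C Y Z\<^esub> f = \<zero>\<^bsub>Hom C X Z\<^esub>"
    using f0_is_0 .
  show "arr g Y Z \<Longrightarrow>
      cat_comp C X Y Z (\<ominus>\<^bsub>Hom C Y Z\<^esub> g) f = \<ominus>\<^bsub>Hom C X Z\<^esub> cat_comp C X Y Z g f"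
    using f_neg[of g] by (simp add: arr_def)
  show "arr g Y Z \<Longrightarrow> arr g' Y Z \<Longrightarrow>
      cat_comp C X Y Z (g \<ominus>\<^bsub>Hom C Y Z\<^esub> g') f
        = cat_comp C X Y Z g f \<ominus>\<^bsub>Hom C X Z\<^esub> cat_comp C X Y Z g' f"
    using f_minus[of g g'] by (simp add: arr_def)
qed

lemma add_minus_cancel:
  assumes "arr f X Y" and "arr g X Y"
  shows "g \<oplus>\<^bsub>Hom C X Y\<^esub> (f \<ominus>\<^bsub>Hom C X Y\<^esub> g) = f"
proof -
  interpret abelian_group "Hom C X Y"
    using assms by (intro abelian_group_Hom) (auto simp: arr_def)
  have "f \<in> carrier (Hom C X Y)" and "g \<in> carrier (Hom C X Y)"
    using assms by (auto simp: arr_def)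
  then show ?thesis by (simp add: a_minus_def a_lcomm[of g] r_neg)
qed

lemma minus_eq_zero_iff:
  assumes "arr f X Y" and "arr g X Y"
  shows "f \<ominus>\<^bsub>Hom C X Y\<^esub> g = \<zero>\<^bsub>Hom C X Y\<^esub> \<longleftrightarrow> f = g"
proof -
  interpret abelian_group "Hom C X Y"
    using assms by (intro abelian_group_Hom) (auto simp: arr_def)
  have "f \<in> carrier (Hom C X Y)" and "g \<in> carrier (Hom C X Y)"
    using assms by (auto simp: arr_def)
  then show ?thesis using add_minus_cancel[OF assms] by (auto simp: a_minus_def r_neg)
qed

lemma minus_self: "arr f X Y \<Longrightarrow> f \<ominus>\<^bsub>Hom C X Y\<^esub> f = \<zero>\<^bsub>Hom C X Y\<^esub>"
  by (simp add: minus_eq_zero_iff)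

lemma arr_uminus_uminus: "arr f X Y \<Longrightarrow> \<ominus>\<^bsub>Hom C X Y\<^esub> (\<ominus>\<^bsub>Hom C X Y\<^esub> f) = f"
  by (simp add: arr_def abelian_group_Hom abelian_group.minus_minus)

section \<open>Isomorphisms, retracts and zero objects\<close>

lemma iso_objectsE:
  assumes "iso_objects C X Y"
  obtains f g where "arr f X Y" "arr g Y X" "cat_comp C X Y X g f = ident C X"
    "cat_comp C Y X Y f g = ident C Y"
  using assms by (auto simp: iso_objects_def is_iso_def arr_def)

lemma iso_objectsI:
  assumes "arr f X Y" "arr g Y X" "cat_comp C X Y X g f = ident C X"
    "cat_comp C Y X Y f g = ident C Y"
  shows "iso_objects C X Y"
  using assms by (auto simp: iso_objects_def is_iso_def arr_def)

lemma is_isoI: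
  assumes "arr f X Y" "arr g Y X" "cat_comp C X Y X g f = ident C X"
    "cat_comp C Y X Y f g = ident C Y"
  shows "is_iso C X Y f"
  using assms by (auto simp: is_iso_def arr_def)

lemma is_iso_ident: "X \<in> Ob C \<Longrightarrow> is_iso C X X (ident C X)"
  by (rule is_isoI[where g = "ident C X"]) (auto simp: arrs comp_id_left)

lemma iso_objects_refl: "X \<in> Ob C \<Longrightarrow> iso_objects C X X"
  using is_iso_ident by (auto simp: iso_objects_def)

lemma iso_objects_sym: "iso_objects C X Y \<Longrightarrow> iso_objects C Y X"
  by (auto simp: iso_objects_def is_iso_def)

text \<open>Stands in for the direct summands of the definition of complexity; retracts compose
  without choosing complements, and a complement is recovered from a triangle in
  \<open>retract_direct_sum\<close>.\<close>

definition retract :: "'o \<Rightarrow> 'o \<Rightarrow> bool" where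
  "retract X Y \<longleftrightarrow> (\<exists>i p. arr i X Y \<and> arr p Y X \<and> cat_comp C X Y X p i = ident C X)"

text \<open>Used for retracts once, and for isomorphisms twice, in the two directions.\<close>

lemma comp_section:
  assumes "arr i X Y" "arr p Y X" "cat_comp C X Y X p i = ident C X"
    and "arr j Y Z" "arr q Z Y" "cat_comp C Y Z Y q j = ident C Y"
  shows "cat_comp C X Z X (cat_comp C Z Y X p q) (cat_comp C X Y Z j i) = ident C X"
proof -
  have "cat_comp C X Z X (cat_comp C Z Y X p q) (cat_comp C X Y Z j i)
      = cat_comp C X Y X p (cat_comp C X Z Y q (cat_comp C X Y Z j i))"
    using assms by (intro assoc) (auto simp: arrs)
  also have "cat_comp C X Z Y q (cat_comp C X Y Z j i)
      = cat_comp C X Y Y (cat_comp C Y Z Y q j) i"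
    using assms by (intro assoc[symmetric]) (auto simp: arrs)
  finally show ?thesis using assms by (simp add: comp_id_left)
qed

lemma iso_objects_trans:
  assumes "iso_objects C X Y" and "iso_objects C Y Z"
  shows "iso_objects C X Z"
proof -
  obtain f g where fg: "arr f X Y" "arr g Y X" "cat_comp C X Y X g f = ident C X"
    "cat_comp C Y X Y f g = ident C Y" using assms(1) by (rule iso_objectsE)
  obtain h k where hk: "arr h Y Z" "arr k Z Y" "cat_comp C Y Z Y k h = ident C Y"
    "cat_comp C Z Y Z h k = ident C Z" using assms(2) by (rule iso_objectsE)
  show ?thesis
    by (rule iso_objectsI[of "cat_comp C X Y Z h f" _ _ "cat_comp C Z Y X g k"])
      (use fg hk in \<open>auto simp: arrs intro!: comp_section\<close>)
qed

lemma retractE: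
  assumes "retract X Y"
  obtains i p where "arr i X Y" "arr p Y X" "cat_comp C X Y X p i = ident C X"
  using assms by (auto simp: retract_def)

lemma retract_trans:
  assumes "retract X Y" and "retract Y Z"
  shows "retract X Z"
proof -
  obtain i p where 1: "arr i X Y" "arr p Y X" "cat_comp C X Y X p i = ident C X"
    using assms(1) by (rule retractE)
  obtain j q where 2: "arr j Y Z" "arr q Z Y" "cat_comp C Y Z Y q j = ident C Y"
    using assms(2) by (rule retractE)
  show ?thesis unfolding retract_def
    using comp_section[OF 1 2] arr_comp[OF 1(1) 2(1)] arr_comp[OF 2(2) 1(2)] by (intro exI conjI)
qed

lemma iso_objects_retract: "iso_objects C X Y \<Longrightarrow> retract X Y"
  unfolding retract_def by (elim iso_objectsE) blast

lemma retract_refl: "X \<in> Ob C \<Longrightarrow> retract X X"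
  by (simp add: iso_objects_retract iso_objects_refl)

lemma retract_Ob: "retract X Y \<Longrightarrow> X \<in> Ob C \<and> Y \<in> Ob C"
  by (auto simp: retract_def arr_def)

lemma is_direct_sum_retract: "is_direct_sum C X Y Z \<Longrightarrow> retract X Z"
  unfolding is_direct_sum_def retract_def arr_def by (elim conjE bexE) (intro exI conjI)

text \<open>Composing with the identity shows that every arrow from or to such a \<open>Z\<close> is
  zero. The equational form is one that linear functors visibly preserve.\<close>

lemma zero_object_iff: "is_zero_object C Z \<longleftrightarrow> Z \<in> Ob C \<and> ident C Z = \<zero>\<^bsub>Hom C Z Z\<^esub>"
proof
  assume "is_zero_object C Z"
  then show "Z \<in> Ob C \<and> ident C Z = \<zero>\<^bsub>Hom C Z Z\<^esub>"
    using ident_closed unfolding is_zero_object_def by blast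
next
  assume Z: "Z \<in> Ob C \<and> ident C Z = \<zero>\<^bsub>Hom C Z Z\<^esub>"
  show "is_zero_object C Z"
    unfolding is_zero_object_def
  proof (intro conjI ballI)
    show "Z \<in> Ob C" using Z by simp
    fix Y assume Y: "Y \<in> Ob C"
    have "f = \<zero>\<^bsub>Hom C Z Y\<^esub>" if "arr f Z Y" for f
      using comp_id_right[OF that] comp_zero_right[OF that, of Z] Z by simp
    then show "carrier (Hom C Z Y) = {\<zero>\<^bsub>Hom C Z Y\<^esub>}"
      using Y Z arr_zero[of Z Y] unfolding arr_def by blast
    have "f = \<zero>\<^bsub>Hom C Y Z\<^esub>" if "arr f Y Z" for f
      using comp_id_left[OF that] comp_zero_left[OF that, of Z] Z by simp
    then show "carrier (Hom C Y Z) = {\<zero>\<^bsub>Hom C Y Z\<^esub>}"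
      using Y Z arr_zero[of Y Z] unfolding arr_def by blast
  qed
qed

lemma zero_object_from: "is_zero_object C Z \<Longrightarrow> arr f Z Y \<Longrightarrow> f = \<zero>\<^bsub>Hom C Z Y\<^esub>"
  and zero_object_to: "is_zero_object C Z \<Longrightarrow> arr f Y Z \<Longrightarrow> f = \<zero>\<^bsub>Hom C Y Z\<^esub>"
  unfolding is_zero_object_def arr_def by auto

lemma zero_object_Ob: "is_zero_object C Z \<Longrightarrow> Z \<in> Ob C"
  by (simp add: is_zero_object_def)

lemma retract_zero:
  assumes "retract X Z" and "is_zero_object C Z"
  shows "is_zero_object C X"
proof -
  obtain i p where ip: "arr i X Z" "arr p Z X" "cat_comp C X Z X p i = ident C X"
    using assms(1) by (rule retractE)
  have "i = \<zero>\<^bsub>Hom C X Z\<^esub>" using zero_object_to assms(2) ip by blast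
  with ip show ?thesis using comp_zero_right[of p Z X X] by (auto simp: zero_object_iff arr_def)
qed

end

section \<open>Linear functors and equivalences\<close>

lemma iso_functors_objects:
  assumes "iso_functors C D F G" and "X \<in> Ob C" and "fob F X \<in> Ob D" and "fob G X \<in> Ob D"
  shows "iso_objects D (fob F X) (fob G X)"
  using assms by (auto simp: iso_functors_def nat_iso_def iso_objects_def)

lemma fob_comp [simp]: "fob (G \<circ>\<^sub>F F) X = fob G (fob F X)"
  and fmor_comp [simp]: "fmor (G \<circ>\<^sub>F F) X Y f = fmor G (fob F X) (fob F Y) (fmor F X Y f)"
  and fob_id [simp]: "fob id_functor X = X"
  and fmor_id [simp]: "fmor id_functor X Y f = f"
  by (simp_all add: comp_functor_def id_functor_def)

locale linear_functor_between = src: linear_category K C + tgt: linear_category K D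
  for K :: "'k ring" and C :: "('k, 'o, 'm, 'y) lin_cat_scheme"
    and D :: "('k, 'p, 'n, 'z) lin_cat_scheme" +
  fixes F :: "('o, 'm, 'p, 'n) cfunctor"
  assumes linear_functor: "linear_functor K C D F"
begin

lemma fob_closed: "X \<in> Ob C \<Longrightarrow> fob F X \<in> Ob D"
  using linear_functor by (simp add: linear_functor_def)

lemma fmor_linear: "X \<in> Ob C \<Longrightarrow> Y \<in> Ob C \<Longrightarrow>
    linear_map K (Hom C X Y) (Hom D (fob F X) (fob F Y)) (fmor F X Y)"
  using linear_functor by (simp add: linear_functor_def)

lemma arr_fmor: "src.arr f X Y \<Longrightarrow> tgt.arr (fmor F X Y f) (fob F X) (fob F Y)"
proof -
  assume f: "src.arr f X Y"
  then interpret linear_map K "Hom C X Y" "Hom D (fob F X) (fob F Y)" "fmor F X Y"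
    by (intro fmor_linear) (auto simp: src.arr_def)
  show ?thesis using f fob_closed by (auto simp: src.arr_def tgt.arr_def)
qed

lemma fmor_ident: "X \<in> Ob C \<Longrightarrow> fmor F X X (ident C X) = ident D (fob F X)"
  using linear_functor by (simp add: linear_functor_def)

lemma fmor_cat_comp: "src.arr f X Y \<Longrightarrow> src.arr g Y Z \<Longrightarrow>
    fmor F X Z (cat_comp C X Y Z g f)
      = cat_comp D (fob F X) (fob F Y) (fob F Z) (fmor F Y Z g) (fmor F X Y f)"
  using linear_functor by (simp add: linear_functor_def src.arr_def)

lemma fmor_zero: "X \<in> Ob C \<Longrightarrow> Y \<in> Ob C \<Longrightarrow>
    fmor F X Y \<zero>\<^bsub>Hom C X Y\<^esub> = \<zero>\<^bsub>Hom D (fob F X) (fob F Y)\<^esub>"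
proof -
  assume "X \<in> Ob C" "Y \<in> Ob C"
  then interpret linear_map K "Hom C X Y" "Hom D (fob F X) (fob F Y)" "fmor F X Y"
    by (rule fmor_linear)
  show ?thesis by (rule f0_is_0)
qed

lemma zero_object: "is_zero_object C X \<Longrightarrow> is_zero_object D (fob F X)"
  using fmor_ident[of X] fmor_zero[of X X] fob_closed[of X]
  by (simp add: src.zero_object_iff tgt.zero_object_iff)

lemma fmor_section:
  assumes "src.arr i X Y" "src.arr p Y X" "cat_comp C X Y X p i = ident C X"
  shows "cat_comp D (fob F X) (fob F Y) (fob F X) (fmor F Y X p) (fmor F X Y i) = ident D (fob F X)"
  using fmor_cat_comp[OF assms(1,2)] assms(3) fmor_ident[OF src.arr_dom[OF assms(1)]] by simp

lemma iso_objects: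
  assumes "iso_objects C X Y"
  shows "iso_objects D (fob F X) (fob F Y)"
proof -
  obtain f g where "src.arr f X Y" "src.arr g Y X" "cat_comp C X Y X g f = ident C X"
    "cat_comp C Y X Y f g = ident C Y"
    using assms by (rule src.iso_objectsE)
  then show ?thesis by (intro tgt.iso_objectsI) (rule arr_fmor fmor_section; assumption)+
qed

lemma retract:
  assumes "src.retract X Y"
  shows "tgt.retract (fob F X) (fob F Y)"
proof -
  obtain i p where "src.arr i X Y" "src.arr p Y X" "cat_comp C X Y X p i = ident C X"
    using assms by (rule src.retractE)
  then show ?thesis unfolding tgt.retract_def
    by (intro exI conjI) (rule arr_fmor fmor_section; assumption)+
qed

end

lemma linear_functor_betweenI:
  "\<lbrakk>linear_category K C; linear_category K D; linear_functor K C D F\<rbrakk>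
    \<Longrightarrow> linear_functor_between K C D F"
  by (simp add: linear_functor_between_def linear_functor_between_axioms_def)

lemma nat_iso_arr:
  assumes "nat_iso C D F G a" and "X \<in> Ob C"
  shows "is_iso D (fob F X) (fob G X) (a X)"
  using assms by (simp add: nat_iso_def)

locale linear_equivalence = FG: linear_functor_between K C D F + GF: linear_functor_between K D C G
  for K :: "'k ring" and C :: "('k, 'o, 'm, 'y) lin_cat_scheme"
    and D :: "('k, 'p, 'n, 'z) lin_cat_scheme"
    and F :: "('o, 'm, 'p, 'n) cfunctor" and G :: "('p, 'n, 'o, 'm) cfunctor" +
  assumes quasi_inverse: "quasi_inverse K C D F G"
begin

lemma GF_iso: "X \<in> Ob C \<Longrightarrow> iso_objects C (fob G (fob F X)) X"
  using quasi_inverse iso_functors_objects[of C C "G \<circ>\<^sub>F F" id_functor X]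
  by (simp add: quasi_inverse_def FG.fob_closed GF.fob_closed)

lemma FG_iso: "X \<in> Ob D \<Longrightarrow> iso_objects D (fob F (fob G X)) X"
  using quasi_inverse iso_functors_objects[of D D "F \<circ>\<^sub>F G" id_functor X]
  by (simp add: quasi_inverse_def FG.fob_closed GF.fob_closed)

lemma linear_equivalence_sym: "linear_equivalence K D C G F"
  using quasi_inverse
  by (simp add: linear_equivalence_def linear_equivalence_axioms_def quasi_inverse_def
      FG.linear_functor_between_axioms GF.linear_functor_between_axioms)

text \<open>By naturality of an isomorphism \<open>a\<close> from \<open>G F\<close> to the
  identity, an arrow \<open>h\<close> is \<open>a Y\<close> after \<open>G F h\<close> after the
  inverse of \<open>a X\<close>, so \<open>F h\<close> determines it.\<close>

lemma faithful:
  assumes f: "FG.src.arr f X Y" and g: "FG.src.arr g X Y" and eq: "fmor F X Y f = fmor F X Y g"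
  shows "f = g"
proof -
  obtain a where a: "nat_iso C C (G \<circ>\<^sub>F F) id_functor a"
    using quasi_inverse by (auto simp: quasi_inverse_def iso_functors_def)
  have X: "X \<in> Ob C" and Y: "Y \<in> Ob C" using f by (auto simp: FG.src.arr_def)
  let ?X = "fob G (fob F X)" and ?Y = "fob G (fob F Y)"
  have GX: "?X \<in> Ob C" using X FG.fob_closed GF.fob_closed by simp
  have nat: "cat_comp C ?X X Y h (a X)
      = cat_comp C ?X ?Y Y (a Y) (fmor G (fob F X) (fob F Y) (fmor F X Y h))"
    if "FG.src.arr h X Y" for h
    using a that by (simp add: nat_iso_def nat_trans_def FG.src.arr_def)
  obtain b where b: "FG.src.arr b X ?X" "cat_comp C X ?X X (a X) b = ident C X"
    using nat_iso_arr[OF a X] X GX by (auto simp: is_iso_def FG.src.arr_def)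
  have aX: "FG.src.arr (a X) ?X X"
    using nat_iso_arr[OF a X] X GX by (auto simp: is_iso_def FG.src.arr_def)
  have inv: "h = cat_comp C X ?X Y (cat_comp C ?X X Y h (a X)) b" if "FG.src.arr h X Y" for h
    using FG.src.assoc[OF b(1) aX that] b(2) FG.src.comp_id_right[OF that] by simp
  show ?thesis using inv[OF f] inv[OF g] nat[OF f] nat[OF g] eq by simp
qed

end

context linear_equivalence
begin

text \<open>The preimage \<open>f\<close> is \<open>G h\<close> conjugated by the natural
  isomorphism. Then \<open>G F f = G h\<close>, and faithfulness of \<open>G\<close>, available by
  symmetry, removes \<open>G\<close>.\<close>

lemma full:
  assumes X: "X \<in> Ob C" and Y: "Y \<in> Ob C" and h: "FG.tgt.arr h (fob F X) (fob F Y)"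
  obtains f where "FG.src.arr f X Y" "fmor F X Y f = h"
proof -
  interpret sym: linear_equivalence K D C G F by (rule linear_equivalence_sym)
  obtain a where a: "nat_iso C C (G \<circ>\<^sub>F F) id_functor a"
    using quasi_inverse by (auto simp: quasi_inverse_def iso_functors_def)
  let ?X = "fob G (fob F X)" and ?Y = "fob G (fob F Y)"
  have GX: "?X \<in> Ob C" "?Y \<in> Ob C" using X Y FG.fob_closed GF.fob_closed by simp_all
  obtain b where b: "FG.src.arr b X ?X" "cat_comp C ?X X ?X b (a X) = ident C ?X"
    using nat_iso_arr[OF a X] X GX by (auto simp: is_iso_def FG.src.arr_def)
  obtain c where c: "FG.src.arr c Y ?Y" "cat_comp C ?Y Y ?Y c (a Y) = ident C ?Y"
    using nat_iso_arr[OF a Y] Y GX by (auto simp: is_iso_def FG.src.arr_def)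
  have aX: "FG.src.arr (a X) ?X X" "FG.src.arr (a Y) ?Y Y"
    using nat_iso_arr[OF a X] nat_iso_arr[OF a Y] X Y GX by (auto simp: is_iso_def FG.src.arr_def)
  let ?Gh = "fmor G (fob F X) (fob F Y) h"
  have Gh: "FG.src.arr ?Gh ?X ?Y" using GF.arr_fmor[OF h] .
  define f where "f = cat_comp C X ?Y Y (a Y) (cat_comp C X ?X ?Y ?Gh b)"
  have f: "FG.src.arr f X Y" unfolding f_def by (intro FG.src.arr_comp[OF _ aX(2)] FG.src.arr_comp[OF b(1) Gh])
  let ?GFf = "fmor G (fob F X) (fob F Y) (fmor F X Y f)"
  have GFf: "FG.src.arr ?GFf ?X ?Y" using f FG.arr_fmor GF.arr_fmor by blast
  have nat: "cat_comp C ?X X Y f (a X) = cat_comp C ?X ?Y Y (a Y) ?GFf"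
    using a f by (simp add: nat_iso_def nat_trans_def FG.src.arr_def)
  have "cat_comp C ?X X Y f (a X) = cat_comp C ?X ?Y Y (a Y) ?Gh"
    unfolding f_def using aX b Gh
    by (simp add: FG.src.assoc[of "a X" ?X X] FG.src.arrs FG.src.comp_id_right)
  with nat have "cat_comp C ?X ?Y Y (a Y) ?GFf = cat_comp C ?X ?Y Y (a Y) ?Gh" by simp
  then have "?GFf = ?Gh"
    using FG.src.assoc[OF GFf aX(2) c(1)] FG.src.assoc[OF Gh aX(2) c(1)] c(2)
      FG.src.comp_id_left[OF GFf] FG.src.comp_id_left[OF Gh] by simp
  then have "fmor F X Y f = h"
    using sym.faithful[OF _ h] FG.arr_fmor[OF f] by blast
  with f show ?thesis using that by blast
qed

lemma reflects_zero: "X \<in> Ob C \<Longrightarrow> is_zero_object D (fob F X) \<Longrightarrow> is_zero_object C X"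
  using GF.zero_object[of "fob F X"] GF_iso[of X]
    FG.src.retract_zero[OF FG.src.iso_objects_retract[OF FG.src.iso_objects_sym]] by blast

end

lemma linear_equivalenceI:
  "\<lbrakk>linear_category K C; linear_category K D; quasi_inverse K C D F G\<rbrakk>
    \<Longrightarrow> linear_equivalence K C D F G"
  by (simp add: linear_equivalence_def linear_equivalence_axioms_def linear_functor_between_def
      linear_functor_between_axioms_def quasi_inverse_def)

section \<open>Triangles\<close>

context triangulated_category
begin

sublocale sh: linear_equivalence K C C "sh C" "ush C"
  using shift_equivalence linear_category_axioms by (intro linear_equivalenceI) auto

abbreviation shob where "shob X \<equiv> fob (sh C) X"
abbreviation ushob where "ushob X \<equiv> fob (ush C) X"

section \<open>Rotation and transport of triangles\<close>

lemma tri_arr: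
  assumes "(X, Y, Z, u, v, w) \<in> Tri C"
  shows "arr u X Y" and "arr v Y Z" and "arr w Z (shob X)"
  using Tri_is_triangle[OF assms] sh.FG.fob_closed by (auto simp: arr_def)

lemma tri_rotate:
  assumes "(X, Y, Z, u, v, w) \<in> Tri C"
  shows "(Y, Z, shob X, v, w, \<ominus>\<^bsub>Hom C (shob X) (shob Y)\<^esub> fmor (sh C) X Y u) \<in> Tri C"
  using TR2[OF Tri_is_triangle[OF assms]] assms by blast

text \<open>Fullness of the shift makes the negative of \<open>w'\<close> the shift of some
  \<open>u\<close>; the sign is the one that TR2 introduces.\<close>

lemma tri_unrotate:
  assumes t: "(Y, Z, shob X, v, w, w') \<in> Tri C" and X: "X \<in> Ob C"
  obtains u where "(X, Y, Z, u, v, w) \<in> Tri C"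
proof -
  note arrs_t = tri_arr[OF t]
  then have Y: "Y \<in> Ob C" by (auto simp: arr_def)
  obtain u where u: "arr u X Y"
      "fmor (sh C) X Y u = \<ominus>\<^bsub>Hom C (shob X) (shob Y)\<^esub> w'"
    using sh.full[OF X Y arr_uminus[OF arrs_t(3)]] by blast
  have "w' = \<ominus>\<^bsub>Hom C (shob X) (shob Y)\<^esub> fmor (sh C) X Y u"
    using arrs_t(3) by (simp add: u(2) arr_uminus_uminus)
  moreover have "is_triangle C (X, Y, Z, u, v, w)"
    using u(1) arrs_t X by (auto simp: arr_def)
  ultimately show ?thesis using t TR2[of X Y Z u v w] that by blast
qed

text \<open>Two rotations move the outer pair of arrows into the first two slots of TR3, whose
  filler is then the shift of the wanted \<open>g\<close>; faithfulness strips the shift, and the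
  rotation signs cancel on both sides of each square.\<close>

lemma TR3_first_third:
  assumes t: "(X, Y, Z, u, v, w) \<in> Tri C" and t': "(X', Y', Z', u', v', w') \<in> Tri C"
    and f: "arr f X X'" and h: "arr h Z Z'"
    and eq: "cat_comp C Z (shob X) (shob X') (fmor (sh C) X X' f) w
      = cat_comp C Z Z' (shob X') w' h"
  obtains g where "arr g Y Y'" "cat_comp C X Y Y' g u = cat_comp C X X' Y' u' f"
    "cat_comp C Y Z Z' h v = cat_comp C Y Y' Z' v' g"
proof -
  note a = tri_arr[OF t] and a' = tri_arr[OF t']
  have Ob: "X \<in> Ob C" "Y \<in> Ob C" "Z \<in> Ob C" "X' \<in> Ob C" "Y' \<in> Ob C" "Z' \<in> Ob C"
    using a a' by (auto simp: arr_def)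
  note Sa = sh.FG.arr_fmor[OF a(1)] sh.FG.arr_fmor[OF a(2)] sh.FG.arr_fmor[OF a'(1)]
    sh.FG.arr_fmor[OF a'(2)] sh.FG.arr_fmor[OF f] sh.FG.arr_fmor[OF h]
  obtain k where k: "triangle_morphism C
      (Z, shob X, shob Y, w, \<ominus>\<^bsub>Hom C (shob X) (shob Y)\<^esub> fmor (sh C) X Y u,
        \<ominus>\<^bsub>Hom C (shob Y) (shob Z)\<^esub> fmor (sh C) Y Z v)
      (Z', shob X', shob Y', w', \<ominus>\<^bsub>Hom C (shob X') (shob Y')\<^esub> fmor (sh C) X' Y' u',
        \<ominus>\<^bsub>Hom C (shob Y') (shob Z')\<^esub> fmor (sh C) Y' Z' v') h (fmor (sh C) X X' f) k"
    using TR3[OF tri_rotate[OF tri_rotate[OF t]] tri_rotate[OF tri_rotate[OF t']],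
        of h "fmor (sh C) X X' f"] h Sa(5) eq by (auto simp: arr_def)
  then have k_arr: "arr k (shob Y) (shob Y')"
    using Ob sh.FG.fob_closed by (auto simp: arr_def)
  obtain g where g: "arr g Y Y'" "fmor (sh C) Y Y' g = k"
    using sh.full[OF Ob(2) Ob(5) k_arr] by blast
  show ?thesis
  proof
    show "arr g Y Y'" by fact
    have "\<ominus>\<^bsub>Hom C (shob X) (shob Y')\<^esub> cat_comp C (shob X) (shob Y) (shob Y') k (fmor (sh C) X Y u)
        = \<ominus>\<^bsub>Hom C (shob X) (shob Y')\<^esub>
            cat_comp C (shob X) (shob X') (shob Y') (fmor (sh C) X' Y' u') (fmor (sh C) X X' f)"
      using k Sa Ob sh.FG.fob_closed k_arr
      by (simp add: comp_uminus_right comp_uminus_left)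
    then have "cat_comp C (shob X) (shob Y) (shob Y') k (fmor (sh C) X Y u)
        = cat_comp C (shob X) (shob X') (shob Y') (fmor (sh C) X' Y' u') (fmor (sh C) X X' f)"
      using arr_uminus_uminus[OF arr_comp[OF Sa(1) k_arr]] arr_uminus_uminus[OF arr_comp[OF Sa(5,3)]]
      by metis
    then show "cat_comp C X Y Y' g u = cat_comp C X X' Y' u' f"
      using a a' f g by - (rule sh.faithful[of _ X Y'], auto simp: arrs sh.FG.fmor_cat_comp)
    have "\<ominus>\<^bsub>Hom C (shob Y) (shob Z')\<^esub> cat_comp C (shob Y) (shob Z) (shob Z') (fmor (sh C) Z Z' h) (fmor (sh C) Y Z v)
        = \<ominus>\<^bsub>Hom C (shob Y) (shob Z')\<^esub>
            cat_comp C (shob Y) (shob Y') (shob Z') (fmor (sh C) Y' Z' v') k"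
      using k Sa Ob sh.FG.fob_closed k_arr
      by (simp add: comp_uminus_right comp_uminus_left)
    then have "cat_comp C (shob Y) (shob Z) (shob Z') (fmor (sh C) Z Z' h) (fmor (sh C) Y Z v)
        = cat_comp C (shob Y) (shob Y') (shob Z') (fmor (sh C) Y' Z' v') k"
      using arr_uminus_uminus[OF arr_comp[OF Sa(2,6)]] arr_uminus_uminus[OF arr_comp[OF k_arr Sa(4)]]
      by metis
    then show "cat_comp C Y Z Z' h v = cat_comp C Y Y' Z' v' g"
      using a a' h g by - (rule sh.faithful[of _ Y Z'], auto simp: arrs sh.FG.fmor_cat_comp)
  qed
qed

text \<open>The new arrows are the old ones conjugated by the given isomorphisms, so the squares of
  the triangle isomorphism commute by construction.\<close>

lemma tri_iso:
  assumes t: "(X, Y, Z, u, v, w) \<in> Tri C"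
    and f: "arr f X X'" "arr f' X' X" "cat_comp C X X' X f' f = ident C X"
      "cat_comp C X' X X' f f' = ident C X'"
    and g: "arr g Y Y'" "arr g' Y' Y" "cat_comp C Y Y' Y g' g = ident C Y"
      "cat_comp C Y' Y Y' g g' = ident C Y'"
    and h: "arr h Z Z'" "arr h' Z' Z" "cat_comp C Z Z' Z h' h = ident C Z"
      "cat_comp C Z' Z Z' h h' = ident C Z'"
  shows "(X', Y', Z', cat_comp C X' X Y' (cat_comp C X Y Y' g u) f',
      cat_comp C Y' Y Z' (cat_comp C Y Z Z' h v) g',
      cat_comp C Z' Z (shob X') (cat_comp C Z (shob X) (shob X') (fmor (sh C) X X' f) w) h') \<in> Tri C"
proof (rule Tri_iso[OF t])
  note a = tri_arr[OF t]
  have Ob: "X \<in> Ob C" "Y \<in> Ob C" "Z \<in> Ob C" "X' \<in> Ob C" "Y' \<in> Ob C" "Z' \<in> Ob C"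
    using a f g h by (auto simp: arr_def)
  have gu: "arr (cat_comp C X Y Y' g u) X Y'" using a g by (auto simp: arrs)
  have hv: "arr (cat_comp C Y Z Z' h v) Y Z'" using a h by (auto simp: arrs)
  have fw: "arr (cat_comp C Z (shob X) (shob X') (fmor (sh C) X X' f) w) Z (shob X')"
    using a sh.FG.arr_fmor[OF f(1)] by (auto simp: arrs)
  have iso: "is_iso C X X' f" "is_iso C Y Y' g" "is_iso C Z Z' h"
    using f g h by (auto intro: is_isoI)
  have new: "arr (cat_comp C X' X Y' (cat_comp C X Y Y' g u) f') X' Y'"
      "arr (cat_comp C Y' Y Z' (cat_comp C Y Z Z' h v) g') Y' Z'"
      "arr (cat_comp C Z' Z (shob X') (cat_comp C Z (shob X) (shob X') (fmor (sh C) X X' f) w) h')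
        Z' (shob X')"
    using arr_comp[OF f(2) gu] arr_comp[OF g(2) hv] arr_comp[OF h(2) fw] by auto
  show "triangle_iso C (X, Y, Z, u, v, w)
     (X', Y', Z', cat_comp C X' X Y' (cat_comp C X Y Y' g u) f',
      cat_comp C Y' Y Z' (cat_comp C Y Z Z' h v) g',
      cat_comp C Z' Z (shob X') (cat_comp C Z (shob X) (shob X') (fmor (sh C) X X' f) w) h')"
    unfolding triangle_iso.simps triangle_morphism.simps is_triangle.simps
  proof (intro conjI exI)
    show "cat_comp C X Y Y' g u = cat_comp C X X' Y' (cat_comp C X' X Y' (cat_comp C X Y Y' g u) f') f"
      using assoc[OF f(1,2) gu] f(3) comp_id_right[OF gu] by simp
    show "cat_comp C Y Z Z' h v = cat_comp C Y Y' Z' (cat_comp C Y' Y Z' (cat_comp C Y Z Z' h v) g') g"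
      using assoc[OF g(1,2) hv] g(3) comp_id_right[OF hv] by simp
    show "cat_comp C Z (shob X) (shob X') (fmor (sh C) X X' f) w
      = cat_comp C Z Z' (shob X')
         (cat_comp C Z' Z (shob X') (cat_comp C Z (shob X) (shob X') (fmor (sh C) X X' f) w) h') h"
      using assoc[OF h(1,2) fw] h(3) comp_id_right[OF fw] by simp
  qed (use a f g h iso new Ob in \<open>auto simp: arr_def\<close>)
qed

definition triex :: "'o \<Rightarrow> 'o \<Rightarrow> 'o \<Rightarrow> bool" where
  "triex X Y Z \<longleftrightarrow> (\<exists>u v w. (X, Y, Z, u, v, w) \<in> Tri C)"

lemma triexI: "(X, Y, Z, u, v, w) \<in> Tri C \<Longrightarrow> triex X Y Z"
  by (auto simp: triex_def)

lemma triex_Ob: "triex X Y Z \<Longrightarrow> X \<in> Ob C \<and> Y \<in> Ob C \<and> Z \<in> Ob C"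
  unfolding triex_def using tri_arr by (fastforce simp: arr_def)

lemma triex_iso:
  assumes "triex X Y Z" and "iso_objects C X X'" and "iso_objects C Y Y'" and "iso_objects C Z Z'"
  shows "triex X' Y' Z'"
proof -
  obtain u v w where t: "(X, Y, Z, u, v, w) \<in> Tri C" using assms(1) by (auto simp: triex_def)
  obtain f f' where f: "arr f X X'" "arr f' X' X" "cat_comp C X X' X f' f = ident C X"
      "cat_comp C X' X X' f f' = ident C X'" using assms(2) by (rule iso_objectsE)
  obtain g g' where g: "arr g Y Y'" "arr g' Y' Y" "cat_comp C Y Y' Y g' g = ident C Y"
      "cat_comp C Y' Y Y' g g' = ident C Y'" using assms(3) by (rule iso_objectsE)
  obtain h h' where h: "arr h Z Z'" "arr h' Z' Z" "cat_comp C Z Z' Z h' h = ident C Z"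
      "cat_comp C Z' Z Z' h h' = ident C Z'" using assms(4) by (rule iso_objectsE)
  show ?thesis by (rule triexI[OF tri_iso[OF t f g h]])
qed

lemma triex_rotate: "triex X Y Z \<Longrightarrow> triex Y Z (shob X)"
  unfolding triex_def using tri_rotate by blast

lemma triex_unrotate: "triex Y Z (shob X) \<Longrightarrow> X \<in> Ob C \<Longrightarrow> triex X Y Z"
  unfolding triex_def using tri_unrotate by metis

lemma triex_shift: "triex X Y Z \<Longrightarrow> triex (shob X) (shob Y) (shob Z)"
  by (intro triex_rotate)

lemma triex_unshift:
  assumes "triex (shob X) (shob Y) (shob Z)" and "X \<in> Ob C" "Y \<in> Ob C" "Z \<in> Ob C"
  shows "triex X Y Z"
  using assms by (intro triex_unrotate[of Y Z] triex_unrotate[of Z "shob X"]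
      triex_unrotate[of "shob X" "shob Y"])

lemma ush_Ob: "X \<in> Ob C \<Longrightarrow> ushob X \<in> Ob C" and sh_Ob: "X \<in> Ob C \<Longrightarrow> shob X \<in> Ob C"
  by (simp_all add: sh.GF.fob_closed sh.FG.fob_closed)

text \<open>Up to isomorphism each vertex is the shift of its image under \<open>ush\<close>, so the
  given triangle is isomorphic to a shifted one and can be unshifted.\<close>

lemma triex_ush:
  assumes t: "triex X Y Z"
  shows "triex (ushob X) (ushob Y) (ushob Z)"
proof (rule triex_unshift)
  have Ob: "X \<in> Ob C" "Y \<in> Ob C" "Z \<in> Ob C" using triex_Ob[OF t] by auto
  then show "ushob X \<in> Ob C" "ushob Y \<in> Ob C" "ushob Z \<in> Ob C" by (auto intro: ush_Ob)
  show "triex (shob (ushob X)) (shob (ushob Y)) (shob (ushob Z))"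
    using Ob by (intro triex_iso[OF t] iso_objects_sym[OF sh.FG_iso])
qed

section \<open>Weak kernels, weak cokernels and invertible fillers\<close>

lemma triex_first_zero:
  assumes "is_zero_object C Z" and "X \<in> Ob C"
  shows "triex Z X X"
proof -
  have Z: "Z \<in> Ob C" using assms(1) by (rule zero_object_Ob)
  have "triex X X (shob Z)"
    using TR1_ident[OF assms(2) sh.FG.zero_object[OF assms(1)]] by (rule triexI)
  then show ?thesis using triex_unrotate Z by blast
qed

text \<open>TR3 maps the triangle on the identity of \<open>X\<close> to the given one by the
  identity and \<open>u\<close>; the resulting square factors \<open>v u\<close> through a zero
  object.\<close>

lemma comp_tri_zero:
  assumes t: "(X, Y, Z, u, v, w) \<in> Tri C"
  shows "cat_comp C X Y Z v u = \<zero>\<^bsub>Hom C X Z\<^esub>"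
proof -
  obtain O0 where O0: "is_zero_object C O0" using zero_object by blast
  note a = tri_arr[OF t]
  have Ob: "X \<in> Ob C" "O0 \<in> Ob C" "Z \<in> Ob C" using a O0 zero_object_Ob by (auto simp: arr_def)
  obtain h where "triangle_morphism C
      (X, X, O0, ident C X, \<zero>\<^bsub>Hom C X O0\<^esub>, \<zero>\<^bsub>Hom C O0 (fob (sh C) X)\<^esub>) (X, Y, Z, u, v, w)
      (ident C X) u h"
    using TR3[OF TR1_ident[OF Ob(1) O0] t, of "ident C X" u] a(1) Ob arr_ident
    by (auto simp: arr_def)
  then have "cat_comp C X O0 Z h \<zero>\<^bsub>Hom C X O0\<^esub> = cat_comp C X Y Z v u" and "arr h O0 Z"
    using Ob by (auto simp: arr_def)
  then show ?thesis using comp_zero_right Ob by metis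
qed

text \<open>As \<open>v\<close> kills \<open>f\<close>, there is a morphism from the triangle
  \<open>A \<rightarrow> 0 \<rightarrow> A[1]\<close> to the rotated triangle, starting with
  \<open>f\<close>; its filler \<open>A[1] \<rightarrow> X[1]\<close> unshifts to the
  factorisation.\<close>

lemma tri_weak_kernel:
  assumes t: "(X, Y, Z, u, v, w) \<in> Tri C" and f: "arr f A Y"
    and vf: "cat_comp C A Y Z v f = \<zero>\<^bsub>Hom C A Z\<^esub>"
  obtains g where "arr g A X" "cat_comp C A X Y u g = f"
proof -
  obtain O0 where O0: "is_zero_object C O0" using zero_object by blast
  note a = tri_arr[OF t]
  have Ob: "A \<in> Ob C" "X \<in> Ob C" "Y \<in> Ob C" "O0 \<in> Ob C" "Z \<in> Ob C"
    using a f O0 zero_object_Ob by (auto simp: arr_def)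
  note SOb = Ob[THEN sh_Ob]
  have id: "arr (ident C A) A A" using Ob by (simp add: arrs)
  note S = sh.FG.arr_fmor[OF a(1)] sh.FG.arr_fmor[OF f] sh.FG.arr_fmor[OF id]
  have z: "arr \<zero>\<^bsub>Hom C O0 Z\<^esub> O0 Z" "arr \<zero>\<^bsub>Hom C A O0\<^esub> A O0" using Ob by (auto intro: arr_zero)
  have "cat_comp C A O0 Z \<zero>\<^bsub>Hom C O0 Z\<^esub> \<zero>\<^bsub>Hom C A O0\<^esub> = cat_comp C A Y Z v f"
    using vf comp_zero_left[OF z(2)] Ob by simp
  then obtain h where h: "triangle_morphism C
      (A, O0, shob A, \<zero>\<^bsub>Hom C A O0\<^esub>, \<zero>\<^bsub>Hom C O0 (shob A)\<^esub>,
        \<ominus>\<^bsub>Hom C (shob A) (shob A)\<^esub> fmor (sh C) A A (ident C A))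
      (Y, Z, shob X, v, w, \<ominus>\<^bsub>Hom C (shob X) (shob Y)\<^esub> fmor (sh C) X Y u)
      f \<zero>\<^bsub>Hom C O0 Z\<^esub> h"
    using TR3[OF tri_rotate[OF TR1_ident[OF Ob(1) O0]] tri_rotate[OF t], of f "\<zero>\<^bsub>Hom C O0 Z\<^esub>"]
      f z(1) by (auto simp: arr_def)
  then have h_arr: "arr h (shob A) (shob X)" using SOb by (auto simp: arr_def)
  obtain g where g: "arr g A X" "fmor (sh C) A X g = h"
    using sh.full[OF Ob(1,2) h_arr] by blast
  have "\<ominus>\<^bsub>Hom C (shob A) (shob Y)\<^esub> fmor (sh C) A Y f
      = \<ominus>\<^bsub>Hom C (shob A) (shob Y)\<^esub> cat_comp C (shob A) (shob X) (shob Y) (fmor (sh C) X Y u) h"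
    using h S SOb Ob h_arr
    by (simp add: comp_uminus_right comp_uminus_left sh.FG.fmor_ident comp_id_right)
  then have "fmor (sh C) A Y f = cat_comp C (shob A) (shob X) (shob Y) (fmor (sh C) X Y u) h"
    using arr_uminus_uminus[OF S(2)] arr_uminus_uminus[OF arr_comp[OF h_arr S(1)]] by metis
  then have "cat_comp C A X Y u g = f"
    using a f g by - (rule sh.faithful[of _ A Y], auto simp: arrs sh.FG.fmor_cat_comp)
  then show ?thesis using g that by blast
qed

text \<open>Comparison with the triangle on \<open>0\<close>, \<open>B\<close>, \<open>B\<close>:
  zero on \<open>X\<close> and \<open>f\<close> on \<open>Y\<close> are compatible, and the filler
  is the factorisation.\<close>

lemma tri_weak_cokernel:
  assumes t: "(X, Y, Z, u, v, w) \<in> Tri C" and f: "arr f Y B"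
    and fu: "cat_comp C X Y B f u = \<zero>\<^bsub>Hom C X B\<^esub>"
  obtains g where "arr g Z B" "cat_comp C Y Z B g v = f"
proof -
  obtain O0 where O0: "is_zero_object C O0" using zero_object by blast
  note a = tri_arr[OF t]
  have Ob: "B \<in> Ob C" "X \<in> Ob C" "Y \<in> Ob C" "O0 \<in> Ob C" "Z \<in> Ob C"
    using a f O0 zero_object_Ob by (auto simp: arr_def)
  have id: "arr (ident C B) B B" using Ob by (simp add: arrs)
  have sO: "is_zero_object C (shob O0)" using O0 by (rule sh.FG.zero_object)
  obtain k where t0: "(O0, B, B, k, ident C B, \<zero>\<^bsub>Hom C B (shob O0)\<^esub>) \<in> Tri C"
    using tri_unrotate[OF TR1_ident[OF Ob(1) sO] Ob(4)] by blast
  have k: "k = \<zero>\<^bsub>Hom C O0 B\<^esub>" using zero_object_from[OF O0] tri_arr(1)[OF t0] by blast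
  have z: "arr \<zero>\<^bsub>Hom C X O0\<^esub> X O0" using Ob by (intro arr_zero)
  have "cat_comp C X Y B f u = cat_comp C X O0 B k \<zero>\<^bsub>Hom C X O0\<^esub>"
    using fu k comp_zero_left[OF z] Ob by simp
  then obtain h where h: "triangle_morphism C (X, Y, Z, u, v, w)
      (O0, B, B, k, ident C B, \<zero>\<^bsub>Hom C B (shob O0)\<^esub>) \<zero>\<^bsub>Hom C X O0\<^esub> f h"
    using TR3[OF t t0, of "\<zero>\<^bsub>Hom C X O0\<^esub>" f] z f by (auto simp: arr_def)
  then have "arr h Z B" "cat_comp C Y Z B h v = f"
    using Ob f by (auto simp: arr_def comp_id_left)
  then show ?thesis using that by blast
qed

text \<open>As \<open>v\<close> vanishes, the identity of \<open>Y\<close> factors through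
  \<open>u\<close>, giving a right inverse; as \<open>w\<close> vanishes, the identity of
  \<open>X[1]\<close> factors through the shift of \<open>u\<close>, giving a left inverse after
  unshifting. The two inverses agree.\<close>

lemma triex_iso_zero:
  assumes "triex X Y Z" and Z: "is_zero_object C Z"
  shows "iso_objects C X Y"
proof -
  obtain u v w where t: "(X, Y, Z, u, v, w) \<in> Tri C" using assms(1) by (auto simp: triex_def)
  note a = tri_arr[OF t]
  have Ob: "X \<in> Ob C" "Y \<in> Ob C" "Z \<in> Ob C" using a by (auto simp: arr_def)
  have v0: "v = \<zero>\<^bsub>Hom C Y Z\<^esub>" and w0: "w = \<zero>\<^bsub>Hom C Z (shob X)\<^esub>"
    using Z a zero_object_to zero_object_from by blast+
  have "cat_comp C Y Y Z v (ident C Y) = \<zero>\<^bsub>Hom C Y Z\<^esub>"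
    using v0 a(2) comp_id_right by blast
  then obtain g where g: "arr g Y X" "cat_comp C Y X Y u g = ident C Y"
    using tri_weak_kernel[OF t arr_ident[OF Ob(2)]] by blast
  let ?Su = "fmor (sh C) X Y u"
  have Su: "arr ?Su (shob X) (shob Y)" using a(1) by (rule sh.FG.arr_fmor)
  have sX: "shob X \<in> Ob C" using Ob by (intro sh_Ob)
  have "cat_comp C Z (shob X) (shob X) (ident C (shob X)) w = \<zero>\<^bsub>Hom C Z (shob X)\<^esub>"
    using w0 a(3) comp_id_left by blast
  then obtain k where k: "arr k (shob Y) (shob X)"
    "cat_comp C (shob X) (shob Y) (shob X) k (\<ominus>\<^bsub>Hom C (shob X) (shob Y)\<^esub> ?Su) = ident C (shob X)"
    using tri_weak_cokernel[OF tri_rotate[OF tri_rotate[OF t]] arr_ident[OF sX]] by blast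
  obtain k' where k': "arr k' Y X" "fmor (sh C) Y X k' = \<ominus>\<^bsub>Hom C (shob Y) (shob X)\<^esub> k"
    using sh.full[OF Ob(2,1) arr_uminus[OF k(1)]] by blast
  have "cat_comp C (shob X) (shob Y) (shob X) (fmor (sh C) Y X k') ?Su = ident C (shob X)"
    using k Su sX by (simp add: k'(2) comp_uminus_left comp_uminus_right)
  then have l: "cat_comp C X Y X k' u = ident C X"
    using a k' Ob by - (rule sh.faithful[of _ X X], auto simp: arrs sh.FG.fmor_cat_comp sh.FG.fmor_ident)
  have "k' = cat_comp C Y Y X k' (cat_comp C Y X Y u g)"
    using comp_id_right[OF k'(1)] g by simp
  also have "\<dots> = cat_comp C Y X X (cat_comp C X Y X k' u) g"
    using assoc[OF g(1) a(1) k'(1)] by simp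
  finally have "k' = g" using l comp_id_left[OF g(1)] by simp
  then show ?thesis using l g a(1) by (intro iso_objectsI) auto
qed

lemma minus_minus_cancel:
  assumes "arr f X Y" and "arr g X Y"
  shows "f \<ominus>\<^bsub>Hom C X Y\<^esub> (f \<ominus>\<^bsub>Hom C X Y\<^esub> g) = g"
proof -
  interpret abelian_group "Hom C X Y"
    using assms by (intro abelian_group_Hom) (auto simp: arr_def)
  have "f \<in> carrier (Hom C X Y)" and "g \<in> carrier (Hom C X Y)"
    using assms by (auto simp: arr_def)
  then show ?thesis by (simp add: a_minus_def minus_add r_neg2)
qed

text \<open>\<open>h - id\<close> squares to zero, as it factors through \<open>v\<close> and is killed by \<open>v\<close>.\<close>

lemma tri_endo_left_inverse:
  assumes t: "(X, Y, Z, u, v, w) \<in> Tri C" and h: "arr h Y Y"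
    and hu: "cat_comp C X Y Y h u = u" and vh: "cat_comp C Y Y Z v h = v"
  obtains k where "arr k Y Y" "cat_comp C Y Y Y k h = ident C Y"
proof -
  note a = tri_arr[OF t]
  have Ob: "X \<in> Ob C" "Y \<in> Ob C" "Z \<in> Ob C" using a by (auto simp: arr_def)
  have id: "arr (ident C Y) Y Y" using Ob by (simp add: arrs)
  let ?n = "h \<ominus>\<^bsub>Hom C Y Y\<^esub> ident C Y"
  have n: "arr ?n Y Y" using h id by (rule arr_minus)
  have "cat_comp C X Y Y ?n u = \<zero>\<^bsub>Hom C X Y\<^esub>"
    using comp_minus_left[OF a(1) Ob(2) h id] hu comp_id_left[OF a(1)] minus_self[OF a(1)] by simp
  then obtain g where g: "arr g Z Y" "cat_comp C Y Z Y g v = ?n"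
    using tri_weak_cokernel[OF t n] by blast
  have vn: "cat_comp C Y Y Z v ?n = \<zero>\<^bsub>Hom C Y Z\<^esub>"
    using comp_minus_right[OF a(2) Ob(2) h id] vh comp_id_right[OF a(2)] minus_self[OF a(2)] by simp
  have "cat_comp C Y Y Y ?n ?n = cat_comp C Y Z Y g (cat_comp C Y Y Z v ?n)"
    using assoc[OF n a(2) g(1)] g(2) by simp
  then have "cat_comp C Y Y Y ?n ?n = \<zero>\<^bsub>Hom C Y Y\<^esub>"
    using vn comp_zero_right[OF g(1)] Ob by simp
  then have nh: "cat_comp C Y Y Y ?n h = ?n"
    using comp_minus_right[OF n Ob(2) h id] comp_id_right[OF n] minus_eq_zero_iff[OF arr_comp[OF h n] n]
    by simp
  have "cat_comp C Y Y Y (ident C Y \<ominus>\<^bsub>Hom C Y Y\<^esub> ?n) h = ident C Y"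
    using comp_minus_left[OF h Ob(2) id n] comp_id_left[OF h] nh minus_minus_cancel[OF h id] by simp
  then show ?thesis using that arr_minus[OF id n] by blast
qed

text \<open>A cone of \<open>w\<close>, unrotated twice. The cone is a shift only up to isomorphism,
  so it is first replaced by the shift of \<open>ushob Q\<close>.\<close>

lemma tri_of_connecting:
  assumes w: "arr w Z (shob X)" and X: "X \<in> Ob C"
  obtains Y u v where "(X, Y, Z, u, v, w) \<in> Tri C"
proof -
  have Z: "Z \<in> Ob C" and sX: "shob X \<in> Ob C" using w by (auto simp: arr_def)
  obtain Q s t where t: "(Z, shob X, Q, w, s, t) \<in> Tri C"
    using TR1_cone[OF Z sX arr_closed[OF w]] by blast
  have Q: "Q \<in> Ob C" using tri_arr[OF t] by (auto simp: arr_def)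
  obtain f f' where f: "arr f Q (shob (ushob Q))" "arr f' (shob (ushob Q)) Q"
      "cat_comp C Q (shob (ushob Q)) Q f' f = ident C Q"
      "cat_comp C (shob (ushob Q)) Q (shob (ushob Q)) f f' = ident C (shob (ushob Q))"
    using iso_objectsE[OF iso_objects_sym[OF sh.FG_iso[OF Q]]] by blast
  have iZ: "arr (ident C Z) Z Z" "cat_comp C Z Z Z (ident C Z) (ident C Z) = ident C Z"
    and iX: "arr (ident C (shob X)) (shob X) (shob X)"
     "cat_comp C (shob X) (shob X) (shob X) (ident C (shob X)) (ident C (shob X)) = ident C (shob X)"
    using Z sX by (auto simp: arrs comp_id_left)
  from tri_iso[OF t iZ(1,1,2,2) iX(1,1,2,2) f] obtain s' t'
    where "(Z, shob X, shob (ushob Q), w, s', t') \<in> Tri C"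
    using w by (auto simp: comp_id_left comp_id_right)
  then obtain v where "(ushob Q, Z, shob X, v, w, s') \<in> Tri C"
    using tri_unrotate ush_Ob[OF Q] by blast
  then obtain u where "(X, ushob Q, Z, u, v, w) \<in> Tri C"
    using tri_unrotate X by blast
  then show ?thesis using that by blast
qed

text \<open>Allows extensions to be formed among retracts of filtered objects. The fillers between
  \<open>B\<close> and \<open>B1\<close> need not compose to the identity of \<open>B\<close>, but
  the composite is compatible with \<open>a\<close> and \<open>b\<close>, hence has a left inverse,
  which corrects the retraction.\<close>

lemma triex_retract:
  assumes "triex A B Q" and "retract A A1" and "retract Q Q1"
  obtains B1 where "triex A1 B1 Q1" "retract B B1"
proof -
  obtain a b c where t: "(A, B, Q, a, b, c) \<in> Tri C" using assms(1) by (auto simp: triex_def)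
  obtain i p where ip: "arr i A A1" "arr p A1 A" "cat_comp C A A1 A p i = ident C A"
    using assms(2) by (rule retractE)
  obtain j q where jq: "arr j Q Q1" "arr q Q1 Q" "cat_comp C Q Q1 Q q j = ident C Q"
    using assms(3) by (rule retractE)
  note ar = tri_arr[OF t]
  let ?i = "fmor (sh C) A A1 i" and ?p = "fmor (sh C) A1 A p"
  have i': "arr ?i (shob A) (shob A1)" and p': "arr ?p (shob A1) (shob A)"
    using ip sh.FG.arr_fmor by blast+
  have pi': "cat_comp C (shob A) (shob A1) (shob A) ?p ?i = ident C (shob A)"
    using sh.FG.fmor_section[OF ip] .
  let ?cq = "cat_comp C Q1 Q (shob A) c q"
  have cq: "arr ?cq Q1 (shob A)" using jq ar by (auto simp: arrs)
  \<comment> \<open>The connecting morphism \<open>c\<close> carried along the projection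
    \<open>q\<close> and the inclusion \<open>i\<close>, so that the inclusions and the projections
    both commute with the connecting morphisms.\<close>
  define w where "w = cat_comp C Q1 (shob A) (shob A1) ?i ?cq"
  have w: "arr w Q1 (shob A1)" unfolding w_def using cq i' by (rule arr_comp)
  have A1: "A1 \<in> Ob C" using ip by (auto simp: arr_def)
  obtain B1 a1 b1 where t1: "(A1, B1, Q1, a1, b1, w) \<in> Tri C"
    using tri_of_connecting[OF w A1] by blast
  note ar1 = tri_arr[OF t1]
  have "cat_comp C Q Q1 (shob A) ?cq j = c"
    using assoc[OF jq(1,2) ar(3)] jq(3) comp_id_right[OF ar(3)] by simp
  then have e1: "cat_comp C Q (shob A) (shob A1) ?i c = cat_comp C Q Q1 (shob A1) w j"
    unfolding w_def using assoc[OF jq(1) cq i'] by simp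
  have e2: "cat_comp C Q1 (shob A1) (shob A) ?p w = cat_comp C Q1 Q (shob A) c q"
    unfolding w_def using assoc[OF cq i' p'] pi' comp_id_left[OF cq] by simp
  obtain m where m: "arr m B B1" "cat_comp C A B B1 m a = cat_comp C A A1 B1 a1 i"
      "cat_comp C B Q Q1 j b = cat_comp C B B1 Q1 b1 m"
    using TR3_first_third[OF t t1 ip(1) jq(1) e1] by blast
  obtain n where n: "arr n B1 B" "cat_comp C A1 B1 B n a1 = cat_comp C A1 A B a p"
      "cat_comp C B1 Q1 Q q b1 = cat_comp C B1 B Q b n"
    using TR3_first_third[OF t1 t ip(2) jq(2) e2] by blast
  let ?h = "cat_comp C B B1 B n m"
  have h: "arr ?h B B" using m(1) n(1) by (rule arr_comp)
  have "cat_comp C A B B ?h a = cat_comp C A A1 B (cat_comp C A1 B1 B n a1) i"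
    using assoc[OF ar(1) m(1) n(1)] m(2) assoc[OF ip(1) ar1(1) n(1)] by simp
  also have "\<dots> = a" using n(2) assoc[OF ip(1,2) ar(1)] ip(3) comp_id_right[OF ar(1)] by simp
  finally have ha: "cat_comp C A B B ?h a = a" .
  have "cat_comp C B B Q b ?h = cat_comp C B Q1 Q q (cat_comp C B B1 Q1 b1 m)"
    using assoc[OF m(1) n(1) ar(2)] n(3) assoc[OF m(1) ar1(2) jq(2)] by simp
  also have "\<dots> = b" using m(3) assoc[OF ar(2) jq(1,2)] jq(3) comp_id_left[OF ar(2)] by simp
  finally have bh: "cat_comp C B B Q b ?h = b" .
  obtain k where k: "arr k B B" "cat_comp C B B B k ?h = ident C B"
    using tri_endo_left_inverse[OF t h ha bh] by blast
  have "cat_comp C B B1 B (cat_comp C B1 B B k n) m = ident C B"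
    using assoc[OF m(1) n(1) k(1)] k(2) by simp
  then have "retract B B1" unfolding retract_def using m(1) arr_comp[OF n(1) k(1)] by blast
  then show ?thesis using that triexI[OF t1] by blast
qed

text \<open>The octahedral axiom for the composite \<open>B \<rightarrow> Q \<rightarrow> P\<close>:
  its fibre \<open>B'\<close> is an extension of \<open>Q'\<close> by \<open>A\<close>. This turns
  the last step of a filtration of \<open>Q\<close> into a last step of one for
  \<open>B\<close>.\<close>

lemma triex_octahedral:
  assumes "triex A B Q" and "triex Q' Q P"
  obtains B' where "triex A B' Q'" "triex B' B P"
proof -
  obtain a b c where t: "(A, B, Q, a, b, c) \<in> Tri C" using assms(1) by (auto simp: triex_def)
  obtain d e f where t': "(Q', Q, P, d, e, f) \<in> Tri C" using assms(2) by (auto simp: triex_def)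
  note ar = tri_arr[OF t] tri_arr[OF t']
  have Ob: "A \<in> Ob C" "B \<in> Ob C" "Q' \<in> Ob C" "P \<in> Ob C" using ar by (auto simp: arr_def)
  obtain Y h2 h3 where t'': "(B, P, Y, cat_comp C B Q P e b, h2, h3) \<in> Tri C"
    using TR1_cone[OF Ob(2,4)] arr_comp[OF ar(2,5)] by (meson arr_closed)
  have Y: "Y \<in> Ob C" using tri_arr[OF t''] by (auto simp: arr_def)
  have iso: "iso_objects C Y (shob (ushob Y))" by (rule iso_objects_sym[OF sh.FG_iso[OF Y]])
  have "triex (shob A) Y (shob Q')"
    using TR4[OF tri_rotate[OF t] tri_rotate[OF t'] t''] triexI by blast
  then have "triex (shob A) (shob (ushob Y)) (shob Q')"
    using iso Ob sh_Ob by (blast intro: triex_iso iso_objects_refl)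
  then have "triex A (ushob Y) Q'"
    using triex_unshift Ob ush_Ob[OF Y] by blast
  moreover have "triex B P (shob (ushob Y))"
    using triexI[OF t''] iso Ob by (blast intro: triex_iso iso_objects_refl)
  then have "triex (ushob Y) B P"
    using triex_unrotate ush_Ob[OF Y] by blast
  ultimately show ?thesis using that by blast
qed

text \<open>The cone of the section \<open>i\<close> is the complement. As \<open>1 - i p\<close>
  kills \<open>i\<close>, it equals \<open>s v\<close> for some \<open>s\<close> from
  \<open>Q\<close> to \<open>X\<close>. The connecting arrow \<open>w\<close> is killed by the shift
  of \<open>i\<close>, a split monomorphism, so it vanishes, and this forces
  \<open>v s = 1\<close>.\<close>

lemma retract_direct_sum:
  assumes "retract F X"
  obtains Q where "is_direct_sum C F Q X"
proof -
  obtain i p where ip: "arr i F X" "arr p X F" "cat_comp C F X F p i = ident C F"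
    using assms by (rule retractE)
  have Ob: "F \<in> Ob C" "X \<in> Ob C" using ip by (auto simp: arr_def)
  obtain Q v w where t: "(F, X, Q, i, v, w) \<in> Tri C"
    using TR1_cone[OF Ob arr_closed[OF ip(1)]] by blast
  note a = tri_arr[OF t]
  have Q: "Q \<in> Ob C" using a by (auto simp: arr_def)
  have id: "arr (ident C X) X X" "arr (ident C Q) Q Q" using Ob Q by (auto simp: arrs)
  have ipa: "arr (cat_comp C X F X i p) X X" using ip by (auto intro: arr_comp)
  let ?e = "ident C X \<ominus>\<^bsub>Hom C X X\<^esub> cat_comp C X F X i p"
  have e: "arr ?e X X" using id(1) ipa by (rule arr_minus)
  have "cat_comp C F X X (cat_comp C X F X i p) i = i"
    using assoc[OF ip(1,2,1)] ip(3) comp_id_right[OF ip(1)] by simp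
  then have "cat_comp C F X X ?e i = \<zero>\<^bsub>Hom C F X\<^esub>"
    using comp_minus_left[OF ip(1) Ob(2) id(1) ipa] comp_id_left[OF ip(1)] minus_self[OF ip(1)] by simp
  then obtain s where s: "arr s Q X" "cat_comp C X Q X s v = ?e"
    using tri_weak_cokernel[OF t e] by blast
  have vi: "cat_comp C F X Q v i = \<zero>\<^bsub>Hom C F Q\<^esub>" by (rule comp_tri_zero[OF t])
  have vip: "cat_comp C X X Q v (cat_comp C X F X i p) = \<zero>\<^bsub>Hom C X Q\<^esub>"
    using assoc[OF ip(2,1) a(2)] vi comp_zero_left[OF ip(2) Q] by simp
  let ?vs = "cat_comp C Q X Q v s"
  have vs: "arr ?vs Q Q" using s(1) a(2) by (rule arr_comp)
  have zv: "arr \<zero>\<^bsub>Hom C X Q\<^esub> X Q" using Ob Q by (intro arr_zero)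
  have ve: "cat_comp C X X Q v ?e = v"
    using comp_minus_right[OF a(2) Ob(2) id(1) ipa] vip comp_id_right[OF a(2)]
      minus_minus_cancel[OF a(2) a(2)] minus_self[OF a(2)] by simp
  have "cat_comp C X Q Q ?vs v = v" using assoc[OF a(2) s(1) a(2)] s(2) ve by simp
  then have "cat_comp C X Q Q (?vs \<ominus>\<^bsub>Hom C Q Q\<^esub> ident C Q) v = \<zero>\<^bsub>Hom C X Q\<^esub>"
    using comp_minus_left[OF a(2) Q vs id(2)] comp_id_left[OF a(2)] minus_self[OF a(2)] by simp
  \<comment> \<open>The difference \<open>v s - 1\<close> kills \<open>v\<close>, hence factors
    through \<open>w\<close>, which is about to vanish.\<close>
  then obtain g where g: "arr g (shob F) Q"
      "cat_comp C Q (shob F) Q g w = ?vs \<ominus>\<^bsub>Hom C Q Q\<^esub> ident C Q"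
    using tri_weak_cokernel[OF tri_rotate[OF t] arr_minus[OF vs id(2)]] by blast
  let ?i = "fmor (sh C) F X i" and ?p = "fmor (sh C) X F p"
  have i': "arr ?i (shob F) (shob X)" and p': "arr ?p (shob X) (shob F)"
    using ip sh.FG.arr_fmor by blast+
  have iw: "cat_comp C Q (shob F) (shob X) ?i w = \<zero>\<^bsub>Hom C Q (shob X)\<^esub>"
  proof -
    have "\<ominus>\<^bsub>Hom C Q (shob X)\<^esub> cat_comp C Q (shob F) (shob X) ?i w = \<zero>\<^bsub>Hom C Q (shob X)\<^esub>"
      using comp_tri_zero[OF tri_rotate[OF tri_rotate[OF t]]] comp_uminus_left[OF a(3) sh_Ob[OF Ob(2)] i']
      by simp
    moreover interpret H: abelian_group "Hom C Q (shob X)"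
      using Q sh_Ob[OF Ob(2)] by (rule abelian_group_Hom)
    note c = arr_closed[OF arr_comp[OF a(3) i']]
    ultimately show ?thesis using H.r_neg[OF c] H.r_zero[OF c] by simp
  qed
  have "w = cat_comp C Q (shob F) (shob F) (cat_comp C (shob F) (shob X) (shob F) ?p ?i) w"
    using sh.FG.fmor_section[OF ip] comp_id_left[OF a(3)] by simp
  also have "\<dots> = \<zero>\<^bsub>Hom C Q (shob F)\<^esub>"
    using assoc[OF a(3) i' p'] iw comp_zero_right[OF p' Q] by simp
  finally have "?vs \<ominus>\<^bsub>Hom C Q Q\<^esub> ident C Q = \<zero>\<^bsub>Hom C Q Q\<^esub>"
    using g comp_zero_right[OF g(1) Q] by simp
  then have vs1: "?vs = ident C Q" using minus_eq_zero_iff[OF vs id(2)] by simp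
  \<comment> \<open>Compares \<open>(1 - i p) s = s v s = s\<close> with the expansion of the
    left-hand side.\<close>
  have ips: "cat_comp C Q X X (cat_comp C X F X i p) s = \<zero>\<^bsub>Hom C Q X\<^esub>"
  proof -
    have "cat_comp C Q X X ?e s = s"
      using assoc[OF s(1) a(2) s(1)] s(2) vs1 comp_id_right[OF s(1)] by simp
    moreover have "cat_comp C Q X X ?e s = s \<ominus>\<^bsub>Hom C Q X\<^esub> cat_comp C Q X X (cat_comp C X F X i p) s"
      using comp_minus_left[OF s(1) Ob(2) id(1) ipa] comp_id_left[OF s(1)] by simp
    ultimately show ?thesis
      using minus_minus_cancel[OF s(1) arr_comp[OF s(1) ipa]] minus_self[OF s(1)] by simp
  qed
  have psa: "arr (cat_comp C Q X F p s) Q F" using s(1) ip(2) by (rule arr_comp)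
  have "cat_comp C Q X F p s = cat_comp C Q F F (cat_comp C F X F p i) (cat_comp C Q X F p s)"
    using ip(3) comp_id_left[OF psa] by simp
  also have "\<dots> = cat_comp C Q X F p (cat_comp C Q X X (cat_comp C X F X i p) s)"
    using assoc[OF psa ip(1,2)] assoc[OF s(1) ip(2,1)] by simp
  also have "\<dots> = \<zero>\<^bsub>Hom C Q F\<^esub>" using ips comp_zero_right[OF ip(2) Q] by simp
  finally have ps: "cat_comp C Q X F p s = \<zero>\<^bsub>Hom C Q F\<^esub>" .
  have sum: "cat_comp C X F X i p \<oplus>\<^bsub>Hom C X X\<^esub> cat_comp C X Q X s v = ident C X"
    using s(2) add_minus_cancel[OF id(1) ipa] by simp
  have "is_direct_sum C F Q X"
    unfolding is_direct_sum_def
    using Ob Q arr_closed[OF ip(1)] arr_closed[OF ip(2)] arr_closed[OF s(1)] arr_closed[OF a(2)]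
      ip(3) vs1 ps vi sum by blast
  then show ?thesis using that by blast
qed

end

section \<open>Filtrations by shifts of an object\<close>

context triangulated_category
begin

text \<open>The shift is only an equivalence, so iterated shifts compose only up to isomorphism;
  closing under isomorphism removes the index bookkeeping.\<close>

definition shift_of :: "'o \<Rightarrow> 'o \<Rightarrow> bool" where
  "shift_of X Y \<longleftrightarrow> X \<in> Ob C \<and> (\<exists>n. iso_objects C (shift_ob C n X) Y)"

lemma shift_ob_closed: "X \<in> Ob C \<Longrightarrow> shift_ob C n X \<in> Ob C"
proof -
  assume X: "X \<in> Ob C"
  have "(shob ^^ k) X \<in> Ob C" and "(ushob ^^ k) X \<in> Ob C" for k
    by (induction k) (use X sh_Ob ush_Ob in auto)
  then show ?thesis by (simp add: shift_ob_def)
qed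

lemma sh_ush_iso: "X \<in> Ob C \<Longrightarrow> iso_objects C (shob (ushob X)) X"
  and ush_sh_iso: "X \<in> Ob C \<Longrightarrow> iso_objects C (ushob (shob X)) X"
  by (simp_all add: sh.FG_iso sh.GF_iso)

lemma sh_shift_ob: "X \<in> Ob C \<Longrightarrow> iso_objects C (shob (shift_ob C n X)) (shift_ob C (n + 1) X)"
proof (cases "n \<ge> 0")
  case True
  assume X: "X \<in> Ob C"
  have "shift_ob C (n + 1) X = shob (shift_ob C n X)"
    using True by (simp add: shift_ob_def nat_add_distrib)
  then show ?thesis using X sh_Ob shift_ob_closed iso_objects_refl by metis
next
  case False
  assume X: "X \<in> Ob C"
  from False have "nat (- n) = Suc (nat (- (n + 1)))" by simp
  then have "shift_ob C n X = ushob (shift_ob C (n + 1) X)"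
    using False by (auto simp: shift_ob_def)
  then show ?thesis using X shift_ob_closed sh_ush_iso by metis
qed

lemma ush_shift_ob: "X \<in> Ob C \<Longrightarrow> iso_objects C (ushob (shift_ob C n X)) (shift_ob C (n - 1) X)"
proof -
  assume X: "X \<in> Ob C"
  have "iso_objects C (ushob (shift_ob C n X)) (ushob (shob (shift_ob C (n - 1) X)))"
    using sh.GF.iso_objects[OF iso_objects_sym[OF sh_shift_ob[OF X, of "n - 1"]]] by simp
  then show ?thesis
    using iso_objects_trans ush_sh_iso[OF shift_ob_closed[OF X]] by blast
qed

lemma shift_of_refl: "X \<in> Ob C \<Longrightarrow> shift_of X X"
  unfolding shift_of_def using iso_objects_refl
  by (auto intro!: exI[of _ 0] simp: shift_ob_def)

lemma shift_of_iso: "shift_of X Y \<Longrightarrow> iso_objects C Y Y' \<Longrightarrow> shift_of X Y'"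
  unfolding shift_of_def using iso_objects_trans by blast

lemma shift_of_sh: "shift_of X Y \<Longrightarrow> shift_of X (shob Y)"
  unfolding shift_of_def
  using sh.FG.iso_objects sh_shift_ob iso_objects_trans iso_objects_sym by metis

lemma shift_of_ush: "shift_of X Y \<Longrightarrow> shift_of X (ushob Y)"
  unfolding shift_of_def
  using sh.GF.iso_objects ush_shift_ob iso_objects_trans iso_objects_sym by metis

lemma shift_of_Ob: "shift_of X Y \<Longrightarrow> X \<in> Ob C \<and> Y \<in> Ob C"
  unfolding shift_of_def iso_objects_def by blast

text \<open>Stability under arbitrary shifts follows from stability under \<open>sh\<close>,
  \<open>ush\<close> and isomorphism.\<close>

lemma shift_of_induct [consumes 1, case_names base sh ush iso]:
  assumes "shift_of X Y"
    and base: "P X"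
    and sh: "\<And>Z. Z \<in> Ob C \<Longrightarrow> P Z \<Longrightarrow> P (shob Z)"
    and ush: "\<And>Z. Z \<in> Ob C \<Longrightarrow> P Z \<Longrightarrow> P (ushob Z)"
    and iso: "\<And>Z Z'. iso_objects C Z Z' \<Longrightarrow> P Z \<Longrightarrow> P Z'"
  shows "P Y"
proof -
  obtain n where n: "iso_objects C (shift_ob C n X) Y" and X: "X \<in> Ob C"
    using assms(1) by (auto simp: shift_of_def)
  have "(shob ^^ k) X \<in> Ob C \<and> P ((shob ^^ k) X)" and "(ushob ^^ k) X \<in> Ob C \<and> P ((ushob ^^ k) X)" for k
    by (induction k) (use X sh_Ob ush_Ob base sh ush in auto)
  then have "P (shift_ob C n X)" by (simp add: shift_ob_def)
  then show ?thesis using iso n by blast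
qed

text \<open>The filtrations in the definition of complexity with their degrees forgotten: at
  \<open>t = 0\<close> only the number of steps counts.\<close>

inductive built :: "'o \<Rightarrow> nat \<Rightarrow> 'o \<Rightarrow> bool" for E where
  built_0: "is_zero_object C Z \<Longrightarrow> built E 0 Z"
| built_Suc: "\<lbrakk>built E k A; triex A B Q; shift_of E Q\<rbrakk> \<Longrightarrow> built E (Suc k) B"

definition sbuilt :: "'o \<Rightarrow> nat \<Rightarrow> 'o \<Rightarrow> bool" where
  "sbuilt E k F \<longleftrightarrow> (\<exists>X. built E k X \<and> retract F X)"

lemma built_Ob: "built E k X \<Longrightarrow> X \<in> Ob C"
  by (induction rule: built.induct) (auto dest: zero_object_Ob triex_Ob)

lemma built_iso: "built E k X \<Longrightarrow> iso_objects C X Y \<Longrightarrow> built E k Y"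
proof (induction arbitrary: Y rule: built.induct)
  case (built_0 Z)
  then show ?case
    using retract_zero iso_objects_retract iso_objects_sym built.built_0 by blast
next
  case (built_Suc k A B Q)
  then have "triex A Y Q" using triex_iso triex_Ob iso_objects_refl by blast
  with built_Suc show ?case using built.built_Suc by blast
qed

lemma built_sh: "built E k X \<Longrightarrow> built E k (shob X)"
  by (induction rule: built.induct)
    (blast intro: built.intros sh.FG.zero_object triex_shift shift_of_sh)+

lemma built_ush: "built E k X \<Longrightarrow> built E k (ushob X)"
  by (induction rule: built.induct)
    (blast intro: built.intros sh.GF.zero_object triex_ush shift_of_ush)+

text \<open>Induction along the filtration of \<open>Q\<close>, which the octahedral lemma stacks
  step by step on top of that of \<open>A\<close>.\<close>

lemma built_triex:
  "built E l Q \<Longrightarrow> built E k A \<Longrightarrow> triex A B Q \<Longrightarrow> built E (k + l) B"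
proof (induction arbitrary: B rule: built.induct)
  case (built_0 Z)
  then show ?case using built_iso triex_iso_zero by fastforce
next
  case (built_Suc l Q' Q P)
  obtain B' where "triex A B' Q'" "triex B' B P"
    using triex_octahedral[OF built_Suc.prems(2) built_Suc.hyps(2)] by blast
  with built_Suc have "built E (k + l) B'" by blast
  with \<open>triex B' B P\<close> built_Suc.hyps(3) show ?case
    using built.built_Suc by fastforce
qed

lemma sbuilt_retract: "sbuilt E k F \<Longrightarrow> retract F' F \<Longrightarrow> sbuilt E k F'"
  unfolding sbuilt_def using retract_trans by blast

lemma sbuilt_iso: "sbuilt E k F \<Longrightarrow> iso_objects C F F' \<Longrightarrow> sbuilt E k F'"
  using sbuilt_retract iso_objects_retract iso_objects_sym by blast

lemma sbuilt_Ob: "sbuilt E k F \<Longrightarrow> F \<in> Ob C"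
  unfolding sbuilt_def using retract_Ob by blast

lemma built_sbuilt: "built E k X \<Longrightarrow> sbuilt E k X"
  unfolding sbuilt_def using built_Ob retract_refl by blast

lemma sbuilt_0_iff: "sbuilt E 0 F \<longleftrightarrow> is_zero_object C F"
proof
  assume "sbuilt E 0 F"
  then obtain X where "built E 0 X" "retract F X" by (auto simp: sbuilt_def)
  then show "is_zero_object C F" using retract_zero by (auto elim: built.cases)
qed (blast intro: built_sbuilt built_0)

lemma sbuilt_sh: "sbuilt E k F \<Longrightarrow> sbuilt E k (shob F)"
  unfolding sbuilt_def using built_sh sh.FG.retract by blast

lemma sbuilt_ush: "sbuilt E k F \<Longrightarrow> sbuilt E k (ushob F)"
  unfolding sbuilt_def using built_ush sh.GF.retract by blast

lemma sbuilt_shift_of: "shift_of F F' \<Longrightarrow> sbuilt E k F \<Longrightarrow> sbuilt E k F'"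
  by (induction rule: shift_of_induct) (auto intro: sbuilt_sh sbuilt_ush sbuilt_iso)

lemma sbuilt_triex: "sbuilt E k A \<Longrightarrow> sbuilt E l Q \<Longrightarrow> triex A B Q \<Longrightarrow> sbuilt E (k + l) B"
  unfolding sbuilt_def using triex_retract built_triex by metis

lemma sbuilt_refl: "E \<in> Ob C \<Longrightarrow> sbuilt E 1 E"
proof -
  assume E: "E \<in> Ob C"
  obtain Z where "is_zero_object C Z" using zero_object by blast
  then have "built E (Suc 0) E"
    using built_Suc[OF built_0 triex_first_zero shift_of_refl] E by blast
  then show ?thesis using built_sbuilt by simp
qed

text \<open>This is submultiplicativity of complexity: each of the \<open>l\<close> steps is a shift
  of \<open>B\<close> and is replaced by \<open>k\<close> steps with shifts of
  \<open>A\<close>.\<close>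

lemma sbuilt_trans:
  assumes "sbuilt A k B" and "sbuilt B l F"
  shows "sbuilt A (l * k) F"
proof -
  obtain Y where Y: "built B l Y" "retract F Y" using assms(2) by (auto simp: sbuilt_def)
  from Y(1) have "sbuilt A (l * k) Y"
  proof (induction rule: built.induct)
    case (built_0 Z)
    then show ?case by (simp add: sbuilt_0_iff)
  next
    case (built_Suc l X Y Q)
    then have "sbuilt A (l * k + k) Y"
      using sbuilt_triex sbuilt_shift_of assms(1) by blast
    then show ?case by (simp add: add.commute)
  qed
  then show ?thesis using Y(2) sbuilt_retract by blast
qed

section \<open>Complexity at \<open>t = 0\<close> and split-generators\<close>

lemma built_imp_chain:
  "built E k X \<Longrightarrow> \<exists>ns A. length ns = k \<and> is_zero_object C (A 0) \<and> A k = X \<and>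
     (\<forall>i < k. \<exists>u v w. (A i, A (Suc i), shift_ob C (ns ! i) E, u, v, w) \<in> Tri C)"
proof (induction rule: built.induct)
  case (built_0 Z)
  then show ?case by (intro exI[of _ "[]"] exI[of _ "\<lambda>_. Z"]) auto
next
  case (built_Suc k X Y Q)
  then obtain ns A where ns: "length ns = k" "is_zero_object C (A 0)" "A k = X"
    "\<forall>i < k. \<exists>u v w. (A i, A (Suc i), shift_ob C (ns ! i) E, u, v, w) \<in> Tri C"
    by blast
  obtain n where n: "iso_objects C (shift_ob C n E) Q"
    using built_Suc.hyps(3) by (auto simp: shift_of_def)
  have "triex X Y (shift_ob C n E)"
    using triex_iso[OF built_Suc.hyps(2)] iso_objects_sym[OF n] triex_Ob[OF built_Suc.hyps(2)]
      iso_objects_refl by blast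
  then obtain u v w where last: "(X, Y, shift_ob C n E, u, v, w) \<in> Tri C"
    by (auto simp: triex_def)
  show ?case
  proof (rule exI[of _ "ns @ [n]"], rule exI[of _ "A(Suc k := Y)"], intro conjI allI impI)
    show "length (ns @ [n]) = Suc k" using ns by simp
    show "is_zero_object C ((A(Suc k := Y)) 0)" using ns by simp
    show "(A(Suc k := Y)) (Suc k) = Y" by simp
    fix i assume "i < Suc k"
    then consider "i < k" | "i = k" by linarith
    then show "\<exists>u v w. ((A(Suc k := Y)) i, (A(Suc k := Y)) (Suc i),
        shift_ob C ((ns @ [n]) ! i) E, u, v, w) \<in> Tri C"
    proof cases
      case 1 then show ?thesis using ns by (auto simp: nth_append)
    next
      case 2 then show ?thesis using ns last by (auto simp: nth_append)
    qed
  qed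
qed

lemma chain_imp_built:
  assumes E: "E \<in> Ob C" and "is_zero_object C (A 0)"
    and "\<forall>i < k. \<exists>u v w. (A i, A (Suc i), shift_ob C (ns i) E, u, v, w) \<in> Tri C"
  shows "built E k (A k)"
  using assms(3)
proof (induction k)
  case 0
  then show ?case using assms(2) built_0 by blast
next
  case (Suc k)
  then have "built E k (A k)" by simp
  moreover have "triex (A k) (A (Suc k)) (shift_ob C (ns k) E)"
    using Suc.prems by (auto simp: triex_def)
  moreover have "shift_of E (shift_ob C (ns k) E)"
    using E iso_objects_refl[OF shift_ob_closed[OF E]] by (auto simp: shift_of_def)
  ultimately show ?case using built_Suc by blast
qed

text \<open>All weights are 1 at \<open>t = 0\<close>, so the sum is the length of the filtration.
  The passage from a retract back to a direct summand is \<open>retract_direct_sum\<close>.\<close>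

lemma complexity_0_eq:
  assumes E: "E \<in> Ob C"
  shows "complexity C 0 E F =
    (if is_zero_object C F then 0 else Inf {ereal (real k) | k. sbuilt E k F})"
proof -
  have "{ereal (\<Sum>n\<leftarrow>ns. exp (real_of_int n * 0)) | ns.
       \<exists>F' A. is_zero_object C (A 0) \<and> is_direct_sum C F F' (A (length ns)) \<and>
         (\<forall>i < length ns. \<exists>u v w.
            (A i, A (Suc i), shift_ob C (ns ! i) E, u, v, w) \<in> Tri C)}
    = {ereal (real k) | k. sbuilt E k F}" (is "?L = ?R")
  proof (intro subset_antisym subsetI)
    fix x assume "x \<in> ?L"
    then obtain ns F' A where x: "x = ereal (real (length ns))" "is_zero_object C (A 0)"
      "is_direct_sum C F F' (A (length ns))"
      "\<forall>i < length ns. \<exists>u v w. (A i, A (Suc i), shift_ob C (ns ! i) E, u, v, w) \<in> Tri C"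
      by (auto simp: sum_list_triv)
    from chain_imp_built[OF E x(2,4)] is_direct_sum_retract[OF x(3)]
    have "sbuilt E (length ns) F" unfolding sbuilt_def by blast
    then show "x \<in> ?R" using x(1) by blast
  next
    fix x assume "x \<in> ?R"
    then obtain k X where x: "x = ereal (real k)" "built E k X" "retract F X"
      by (auto simp: sbuilt_def)
    obtain ns A where ns: "length ns = k" "is_zero_object C (A 0)" "A k = X"
      "\<forall>i < k. \<exists>u v w. (A i, A (Suc i), shift_ob C (ns ! i) E, u, v, w) \<in> Tri C"
      using built_imp_chain[OF x(2)] by blast
    obtain Q where "is_direct_sum C F Q X" using retract_direct_sum[OF x(3)] by blast
    with x(1) ns show "x \<in> ?L" by (auto simp: sum_list_triv intro!: exI[of _ ns])
  qed
  then show ?thesis by (simp add: complexity_def)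
qed

text \<open>Zero objects form a thick subcategory, so a zero split-generator reaches nothing
  else.\<close>

lemma split_generator_zero:
  assumes "split_generator C G" and "is_zero_object C G" and "X \<in> Ob C"
  shows "is_zero_object C X"
proof -
  have "thick_subcategory C {X. is_zero_object C X}"
    unfolding thick_subcategory_def
  proof (intro conjI allI impI ballI)
    fix X Y Z u v w
    assume t: "(X, Y, Z, u, v, w) \<in> Tri C" and X: "X \<in> {X. is_zero_object C X}"
      and Y: "Y \<in> {X. is_zero_object C X}"
    have "triex Y Z (shob X)" using triexI[OF t] triex_rotate by blast
    then have "iso_objects C Y Z" using triex_iso_zero sh.FG.zero_object X by blast
    then show "Z \<in> {X. is_zero_object C X}"
      using Y retract_zero iso_objects_retract iso_objects_sym by blast
  qed (use zero_object zero_object_Ob sh.FG.zero_object sh.GF.zero_object is_direct_sum_retract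
      retract_zero in blast)+
  then show ?thesis using assms unfolding split_generator_def by blast
qed

text \<open>The objects reachable by some finite filtration form a thick subcategory; closure under
  cones holds because after rotation \<open>Z\<close> lies between \<open>Y\<close> and the shift of
  \<open>X\<close>. This makes complexities finite.\<close>

lemma split_generator_sbuilt:
  assumes "split_generator C G" and "F \<in> Ob C"
  obtains k where "sbuilt G k F"
proof -
  let ?P = "{F. \<exists>k. sbuilt G k F}"
  have "thick_subcategory C ?P"
    unfolding thick_subcategory_def
  proof (intro conjI allI impI ballI)
    show "\<exists>Z \<in> ?P. is_zero_object C Z" using zero_object sbuilt_0_iff by blast
    fix X Y Z u v w
    assume t: "(X, Y, Z, u, v, w) \<in> Tri C" and X: "X \<in> ?P" and Y: "Y \<in> ?P"
    have "triex Y Z (shob X)" using triexI[OF t] triex_rotate by blast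
    then show "Z \<in> ?P" using sbuilt_triex X Y sbuilt_sh by blast
  qed (use sbuilt_Ob sbuilt_sh sbuilt_ush sbuilt_retract is_direct_sum_retract in blast)+
  moreover have "G \<in> ?P" using sbuilt_refl assms(1) unfolding split_generator_def by blast
  ultimately show ?thesis using assms that unfolding split_generator_def by blast
qed

end

section \<open>Exact functors preserve filtrations\<close>

locale triangulated_functor = src: triangulated_category K C + tgt: triangulated_category K D
  for K :: "'k ring" and C :: "('k, 'o, 'm, 'y) tri_cat_scheme"
    and D :: "('k, 'p, 'n, 'z) tri_cat_scheme" +
  fixes F :: "('o, 'm, 'p, 'n) cfunctor"
  assumes exact_functor: "exact_functor K C D F"
begin

sublocale linear_functor_between K C D F
  using exact_functor src.linear_category_axioms tgt.linear_category_axioms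
  by (intro linear_functor_betweenI) (auto simp: exact_functor_def)

lemma triex: "src.triex X Y Z \<Longrightarrow> tgt.triex (fob F X) (fob F Y) (fob F Z)"
  using exact_functor unfolding exact_functor_def src.triex_def tgt.triex_def by blast

lemma fob_sh_iso:
  assumes "X \<in> Ob C"
  shows "iso_objects D (fob F (fob (sh C) X)) (fob (sh D) (fob F X))"
proof -
  have "iso_functors C D (F \<circ>\<^sub>F sh C) (sh D \<circ>\<^sub>F F)"
    using exact_functor unfolding exact_functor_def iso_functors_def by blast
  then show ?thesis
    using iso_functors_objects[of C D "F \<circ>\<^sub>F sh C" "sh D \<circ>\<^sub>F F" X] assms
    by (simp add: fob_closed src.sh_Ob tgt.sh_Ob)
qed

lemma fob_ush_iso:
  assumes X: "X \<in> Ob C"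
  shows "iso_objects D (fob F (fob (ush C) X)) (fob (ush D) (fob F X))"
proof -
  let ?U = "fob (ush C) X"
  have U: "?U \<in> Ob C" using X by (rule src.ush_Ob)
  have "iso_objects D (fob (sh D) (fob F ?U)) (fob F X)"
    using fob_sh_iso[OF U] iso_objects[OF src.sh_ush_iso[OF X]]
      tgt.iso_objects_sym tgt.iso_objects_trans by blast
  then have "iso_objects D (fob (ush D) (fob (sh D) (fob F ?U))) (fob (ush D) (fob F X))"
    by (rule tgt.sh.GF.iso_objects)
  then show ?thesis
    using tgt.ush_sh_iso[OF fob_closed[OF U]] tgt.iso_objects_sym tgt.iso_objects_trans by blast
qed

lemma shift_of:
  assumes "src.shift_of X Y"
  shows "tgt.shift_of (fob F X) (fob F Y)"
  using assms
proof (induction rule: src.shift_of_induct)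
  case base
  show ?case using src.shift_of_Ob[OF assms] fob_closed tgt.shift_of_refl by blast
next
  case (sh Z)
  then show ?case
    using tgt.shift_of_iso[OF tgt.shift_of_sh] tgt.iso_objects_sym[OF fob_sh_iso] by blast
next
  case (ush Z)
  then show ?case
    using tgt.shift_of_iso[OF tgt.shift_of_ush] tgt.iso_objects_sym[OF fob_ush_iso] by blast
next
  case (iso Z Z')
  then show ?case using tgt.shift_of_iso iso_objects by blast
qed

lemma sbuilt:
  assumes "src.sbuilt E k X"
  shows "tgt.sbuilt (fob F E) k (fob F X)"
proof -
  have "tgt.built (fob F E) k (fob F Y)" if "src.built E k Y" for Y
    using that
    by (induction rule: src.built.induct)
      (blast intro: tgt.built.intros zero_object triex shift_of)+
  then show ?thesis using assms retract unfolding src.sbuilt_def tgt.sbuilt_def by blast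
qed

end

lemma triangulated_functorI:
  "\<lbrakk>triangulated_category K C; triangulated_category K D; exact_functor K C D F\<rbrakk>
    \<Longrightarrow> triangulated_functor K C D F"
  by (simp add: triangulated_functor_def triangulated_functor_axioms_def)

section \<open>Entropy\<close>

text \<open>The limit is the infimum of the quotients. Dividing \<open>n\<close> by a fixed
  \<open>m\<close> with nearly optimal quotient leaves a remainder below \<open>m\<close>, whose
  cost is bounded.\<close>

lemma subadditive_convergent:
  fixes a :: "nat \<Rightarrow> real"
  assumes nonneg: "\<And>n. a n \<ge> 0" and sub: "\<And>m n. a (m + n) \<le> a m + a n"
  shows "convergent (\<lambda>n. a n / real n)"
proof -
  define L where "L = (INF n\<in>{1..}. a n / real n)"
  have bdd: "bdd_below ((\<lambda>n. a n / real n) ` {1..})"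
    by (rule bdd_belowI2[of _ 0]) (simp add: nonneg)
  have "(\<lambda>n. a n / real n) \<longlonglongrightarrow> L"
  proof (rule LIMSEQ_I)
    fix e :: real assume e: "e > 0"
    obtain m where m: "m \<ge> 1" "a m / real m < L + e / 2"
    proof -
      have "\<exists>y\<in>(\<lambda>n. a n / real n) ` {1..}. y < L + e / 2"
        using e cInf_less_iff[OF _ bdd, of "L + e / 2"] unfolding L_def by auto
      then show ?thesis using that by auto
    qed
    \<comment> \<open>A bound for the cost of every possible remainder modulo
      \<open>m\<close>.\<close>
    define M where "M = (\<Sum>r<m. a r)"
    have M: "a r \<le> M" if "r < m" for r
      unfolding M_def using that by (intro member_le_sum) (auto simp: nonneg)
    have mult: "a (q * m + r) \<le> real q * a m + a r" for q r
    proof (induction q)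
      case (Suc q)
      have "a (Suc q * m + r) \<le> a m + a (q * m + r)"
        using sub[of m "q * m + r"] by (simp add: add.assoc)
      with Suc show ?case by (simp add: algebra_simps)
    qed simp
    have up: "a n / real n \<le> a m / real m + M / real n" if n: "n \<ge> 1" for n
    proof -
      have "a n \<le> real (n div m) * a m + a (n mod m)"
        using mult[of "n div m" "n mod m"] by simp
      also have "\<dots> \<le> real (n div m) * a m + M" using M m by simp
      also have "real (n div m) * a m \<le> (real n / real m) * a m"
        using nonneg[of m] by (intro mult_right_mono) (simp_all add: of_nat_div_le_of_nat)
      finally have "a n \<le> real n * (a m / real m) + M" by (simp add: mult.commute)
      then show ?thesis using n by (simp add: field_simps)
    qed
    obtain N where "max 1 (2 * M / e) < real N"
      using reals_Archimedean2 by blast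
    then have N: "N \<ge> 1" "2 * M / e < real N" by auto
    show "\<exists>no. \<forall>n\<ge>no. norm (a n / real n - L) < e"
    proof (intro exI allI impI)
      fix n assume n: "n \<ge> N"
      then have n1: "n \<ge> 1" "2 * M / e < real n" using N by auto
      then have "M / real n < e / 2" using e by (simp add: field_simps)
      with up[OF n1(1)] m have "a n / real n < L + e" by linarith
      moreover have "L \<le> a n / real n"
        unfolding L_def using n1 by (intro cINF_lower[OF bdd]) auto
      ultimately show "norm (a n / real n - L) < e" by simp
    qed
  qed
  then show ?thesis by (rule convergentI)
qed

text \<open>The first \<open>n\<close> terms of \<open>b\<close> add up to at most \<open>n\<close>
  times a constant times \<open>exp ((h + e) n)\<close>, and a factor linear in \<open>n\<close> has
  no exponential rate.\<close>

lemma exponential_rate_le_of_sum_bound: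
  fixes a b :: "nat \<Rightarrow> real"
  assumes a: "\<And>n. 1 \<le> a n" "\<And>n. a n \<le> 1 + c * (\<Sum>k<n. b k)" and b: "\<And>n. 1 \<le> b n" and c: "c \<ge> 0"
    and g: "(\<lambda>n. ln (a n) / real n) \<longlonglongrightarrow> g" and h: "(\<lambda>n. ln (b n) / real n) \<longlonglongrightarrow> h"
  shows "g \<le> h"
proof (rule field_le_epsilon)
  fix e :: real assume e: "e > 0"
  \<comment> \<open>With \<open>h\<close> nonnegative, \<open>exp ((h + e) k)\<close> increases in
    \<open>k\<close>, so its value at \<open>n\<close> bounds all earlier ones.\<close>
  have h0: "h \<ge> 0"
    by (rule LIMSEQ_le_const[OF h]) (auto simp: b)
  obtain N where N: "\<And>k. k \<ge> N \<Longrightarrow> ln (b k) / real k < h + e"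
    using order_tendstoD(2)[OF h, of "h + e"] e by (auto simp: eventually_sequentially)
  \<comment> \<open>Absorbs the finitely many \<open>k\<close> where the rate estimate may fail.
    Summing up to \<open>N\<close> inclusive always covers \<open>k = 0\<close>, where a quotient by
    \<open>k\<close> carries no information.\<close>
  define M where "M = 1 + (\<Sum>k<Suc N. b k)"
  have b0: "b k \<ge> 0" for k using b[of k] by simp
  have M1: "M \<ge> 1" unfolding M_def by (simp add: sum_nonneg b0 del: sum.lessThan_Suc)
  have bM: "b k \<le> M * exp ((h + e) * real k)" for k
  proof (cases "k < Suc N")
    case True
    then have "b k \<le> (\<Sum>k<Suc N. b k)" by (intro member_le_sum) (auto simp: b0)
    then have "b k \<le> M" by (simp add: M_def)
    also have "\<dots> \<le> M * exp ((h + e) * real k)" using M1 h0 e by simp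
    finally show ?thesis .
  next
    case False
    then have k: "k \<ge> N" "k > 0" by auto
    then have "ln (b k) < (h + e) * real k" using N[OF k(1)] by (simp add: field_simps)
    moreover have "b k = exp (ln (b k))" using b[of k] by (subst exp_ln) linarith+
    ultimately have "b k \<le> exp ((h + e) * real k)" by (metis exp_le_cancel_iff less_imp_le)
    also have "\<dots> \<le> M * exp ((h + e) * real k)" using M1 by simp
    finally show ?thesis .
  qed
  define d where "d = 1 + c * M"
  have d: "d > 0" unfolding d_def using c M1 by (simp add: add_pos_nonneg)
  have up: "ln (a n) / real n \<le> ln (1 + d * real n) / real n + (h + e)" if n: "n > 0" for n
  proof -
    let ?x = "exp ((h + e) * real n)"
    have x1: "?x \<ge> 1" using h0 e by simp
    have "(\<Sum>k<n. b k) \<le> (\<Sum>k<n. M * ?x)"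
    proof (intro sum_mono)
      fix k assume k: "k \<in> {..<n}"
      have "exp ((h + e) * real k) \<le> ?x" using k h0 e by (simp add: mult_left_mono)
      then have "M * exp ((h + e) * real k) \<le> M * ?x" using M1 by (intro mult_left_mono) auto
      then show "b k \<le> M * ?x" using bM[of k] by linarith
    qed
    then have "c * (\<Sum>k<n. b k) \<le> c * (\<Sum>k<n. M * ?x)" using c by (intro mult_left_mono)
    then have "a n \<le> 1 + c * M * real n * ?x" using a(2)[of n] by (simp add: ac_simps)
    also have "\<dots> \<le> (1 + c * M * real n) * ?x" using x1 by (simp add: algebra_simps)
    also have "\<dots> \<le> (1 + d * real n) * ?x"
      unfolding d_def by (intro mult_right_mono) (simp_all add: algebra_simps)
    finally have "ln (a n) \<le> ln ((1 + d * real n) * ?x)"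
      using a(1)[of n] by simp
    also have "\<dots> = ln (1 + d * real n) + (h + e) * real n"
      using d by (subst ln_mult_pos) (auto simp: add_pos_nonneg)
    finally show ?thesis using n by (simp add: field_simps)
  qed
  have "(\<lambda>n. ln (1 + d * real n) / real n + (h + e)) \<longlonglongrightarrow> 0 + (h + e)"
    by (intro tendsto_add tendsto_const) (use d in real_asymp)
  then have "(\<lambda>n. ln (1 + d * real n) / real n + (h + e)) \<longlonglongrightarrow> h + e" by simp
  then show "g \<le> h + e"
    by (rule LIMSEQ_le[OF g]) (use up in \<open>auto intro!: exI[of _ 1]\<close>)
qed

section \<open>Entropies of autoequivalences as growth rates\<close>

context triangulated_category
begin

text \<open>Meaningful once some filtration exists, as it does from a split-generator; it is then
  the complexity at \<open>t = 0\<close>, as a natural number.\<close>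

definition min_steps :: "'o \<Rightarrow> 'o \<Rightarrow> nat" where
  "min_steps E F = (LEAST k. sbuilt E k F)"

lemma min_steps_le: "sbuilt E k F \<Longrightarrow> min_steps E F \<le> k"
  unfolding min_steps_def by (rule Least_le)

lemma sbuilt_min_steps:
  "split_generator C G \<Longrightarrow> F \<in> Ob C \<Longrightarrow> sbuilt G (min_steps G F) F"
  unfolding min_steps_def by (metis LeastI split_generator_sbuilt)

lemma complexity_eq_min_steps:
  assumes G: "split_generator C G" and F: "F \<in> Ob C"
  shows "complexity C 0 G F = ereal (real (min_steps G F))"
proof -
  have GOb: "G \<in> Ob C" using G by (simp add: split_generator_def)
  show ?thesis
  proof (cases "is_zero_object C F")
    case True
    then have "min_steps G F = 0" using min_steps_le[of G 0 F] sbuilt_0_iff by simp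
    with True show ?thesis by (simp add: complexity_0_eq[OF GOb])
  next
    case False
    have "Inf {ereal (real k) | k. sbuilt G k F} = ereal (real (min_steps G F))"
      by (rule cInf_eq_minimum)
        (use sbuilt_min_steps[OF G F] min_steps_le in auto)
    with False show ?thesis by (simp add: complexity_0_eq[OF GOb])
  qed
qed

lemma min_steps_pos:
  assumes "split_generator C G" and "F \<in> Ob C" and "\<not> is_zero_object C F"
  shows "min_steps G F \<ge> 1"
  using sbuilt_min_steps[OF assms(1,2)] assms(3) by (cases "min_steps G F") (auto simp: sbuilt_0_iff)

lemma shift_of_trans: "shift_of Y Z \<Longrightarrow> shift_of X Y \<Longrightarrow> shift_of X Z"
  by (induction rule: shift_of_induct) (auto intro: shift_of_sh shift_of_ush shift_of_iso)

lemma shift_of_sym_iso: "iso_objects C Y X \<Longrightarrow> shift_of X Y"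
  using shift_of_iso[OF shift_of_refl] iso_objects_sym by (auto simp: iso_objects_def)

end

locale triangulated_autoequivalence = triangulated_functor K C C F
  for K :: "'k ring" and C :: "('k, 'o, 'm, 'z) tri_cat_scheme" and F :: "('o, 'm, 'o, 'm) cfunctor" +
  fixes F'
  assumes quasi_inverse: "quasi_inverse K C C F F'"
begin

sublocale eq: linear_equivalence K C C F F'
  using quasi_inverse src.linear_category_axioms by (intro linear_equivalenceI)

lemma iterate_closed: "X \<in> Ob C \<Longrightarrow> (fob F ^^ n) X \<in> Ob C"
  by (induction n) (auto intro: fob_closed)

lemma iterate_nonzero: "X \<in> Ob C \<Longrightarrow> \<not> is_zero_object C X \<Longrightarrow> \<not> is_zero_object C ((fob F ^^ n) X)"
  by (induction n) (use eq.reflects_zero iterate_closed in auto)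

lemma iterate_sbuilt: "src.sbuilt X k Y \<Longrightarrow> src.sbuilt ((fob F ^^ n) X) k ((fob F ^^ n) Y)"
  by (induction n) (auto intro: sbuilt)

text \<open>The nonzero object \<open>X\<close> excludes the zero category, where complexities
  vanish and \<open>elog\<close> takes the value \<open>-\<infinity>\<close>. An equivalence keeps
  all iterates of the generator nonzero, so every logarithm is a nonnegative real.\<close>

lemma entropy_rate:
  assumes gen: "\<exists>G. split_generator C G" and X: "X \<in> Ob C" "\<not> is_zero_object C X"
  obtains G h where "split_generator C G"
    and "(\<lambda>n. ln (real (src.min_steps G ((fob F ^^ n) G))) / real n) \<longlonglongrightarrow> h"
    and "entropy C 0 F = ereal h" and "\<not> is_zero_object C G"
proof -
  \<comment> \<open>The very choice made in the definition of \<open>entropy\<close>.\<close>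
  define G where "G = (SOME G. split_generator C G)"
  have G: "split_generator C G" unfolding G_def using gen by (rule someI_ex)
  then have GOb: "G \<in> Ob C" by (simp add: split_generator_def)
  have nz: "\<not> is_zero_object C G" using src.split_generator_zero[OF G _ X(1)] X(2) by blast
  define a where "a n = src.min_steps G ((fob F ^^ n) G)" for n
  have a1: "a n \<ge> 1" for n
    unfolding a_def using src.min_steps_pos[OF G iterate_closed[OF GOb] iterate_nonzero[OF GOb nz]] .
  have sb: "src.sbuilt G (a n) ((fob F ^^ n) G)" for n
    unfolding a_def by (rule src.sbuilt_min_steps[OF G iterate_closed[OF GOb]])
  \<comment> \<open>\<open>F^m G\<close> takes \<open>a m\<close> steps from \<open>G\<close>, and
    \<open>F^m\<close> applied to the filtration of \<open>F^n G\<close> reaches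
    \<open>F^(m+n) G\<close> from \<open>F^m G\<close> in \<open>a n\<close> steps.\<close>
  have sub: "a (m + n) \<le> a n * a m" for m n
    using src.min_steps_le[OF src.sbuilt_trans[OF sb[of m] iterate_sbuilt[OF sb[of n], of m]]]
    by (simp add: a_def funpow_add)
  have "ln (real (a (m + n))) \<le> ln (real (a m)) + ln (real (a n))" for m n
  proof -
    have "real (a (m + n)) \<le> real (a n * a m)" using sub[of m n] by (rule of_nat_mono)
    then have "real (a (m + n)) \<le> real (a m) * real (a n)" by (simp add: mult.commute)
    then have "ln (real (a (m + n))) \<le> ln (real (a m) * real (a n))"
      using a1[of "m + n"] by (intro ln_mono) linarith+
    also have "\<dots> = ln (real (a m)) + ln (real (a n))"
      using a1[of m] a1[of n] by (intro ln_mult_pos) linarith+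
    finally show ?thesis .
  qed
  then have "convergent (\<lambda>n. ln (real (a n)) / real n)"
    using a1 by (intro subadditive_convergent) (simp_all add: ln_ge_zero)
  then obtain h where h: "(\<lambda>n. ln (real (a n)) / real n) \<longlonglongrightarrow> h"
    by (auto simp: convergent_def)
  \<comment> \<open>At \<open>n = 0\<close> both quotients divide by zero, so equality is claimed
    only for positive \<open>n\<close>.\<close>
  have ev: "\<forall>\<^sub>F n in sequentially. ereal (ln (real (a n)) / real n)
      = elog (complexity C 0 G ((fob F ^^ n) G)) / ereal (real n)"
    using eventually_gt_at_top[of 0]
  proof eventually_elim
    case (elim n)
    have "real (a n) > 0" using a1[of n] by simp
    then have "elog (complexity C 0 G ((fob F ^^ n) G)) = ereal (ln (real (a n)))"
      using src.complexity_eq_min_steps[OF G iterate_closed[OF GOb, of n]]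
      by (simp add: elog_def a_def)
    then show ?case using elim by simp
  qed
  have "(\<lambda>n. elog (complexity C 0 G ((fob F ^^ n) G)) / ereal (real n)) \<longlonglongrightarrow> ereal h"
    using tendsto_ereal[OF h] by (rule Lim_transform_eventually[OF _ ev])
  then have "entropy C 0 F = ereal h"
    unfolding entropy_def Let_def G_def[symmetric] by (rule limI)
  with G h nz show ?thesis using that unfolding a_def by blast
qed

end

text \<open>The entropies refer to generators \<open>G\<close> of \<open>D\<close> and
  \<open>H\<close> of \<open>C\<close>; \<open>S\<close> and \<open>R\<close> transport filtrations
  between them at a fixed cost, which only changes constants. The nonzero objects \<open>XC\<close>
  and \<open>XD\<close> make both entropies real numbers.\<close>

lemma entropy_twist_le_cotwist:
  assumes C: "triangulated_category K C" and D: "triangulated_category K D"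
    and S: "exact_functor K C D S" and R: "exact_functor K D C R" and L: "exact_functor K D C L"
    and T: "exact_equivalence K D D T" and W: "exact_equivalence K C C W"
    and cone: "\<And>X. X \<in> Ob D \<Longrightarrow> triangulated_category.triex D (fob S (fob R X)) X (fob T X)"
    and RLT: "iso_functors D C R (ush C \<circ>\<^sub>F L \<circ>\<^sub>F T)"
    and RWL: "iso_functors D C R (sh C \<circ>\<^sub>F W \<circ>\<^sub>F L)"
    and genC: "\<exists>G. split_generator C G" and genD: "\<exists>G. split_generator D G"
    and XC: "XC \<in> Ob C" "\<not> is_zero_object C XC" and XD: "XD \<in> Ob D" "\<not> is_zero_object D XD"
  shows "entropy D 0 T \<le> entropy C 0 W"
proof -
  interpret C: triangulated_category K C by fact
  interpret D: triangulated_category K D by fact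
  interpret S: triangulated_functor K C D S using C D S by (rule triangulated_functorI)
  interpret R: triangulated_functor K D C R using D C R by (rule triangulated_functorI)
  interpret L: triangulated_functor K D C L using D C L by (rule triangulated_functorI)
  obtain T' W' where T': "quasi_inverse K D D T T'" and W': "quasi_inverse K C C W W'"
    using T W by (auto simp: exact_equivalence_def equivalence_def)
  interpret T: triangulated_autoequivalence K D T T'
    using T T' triangulated_functorI[OF D D]
    by (simp add: triangulated_autoequivalence_def triangulated_autoequivalence_axioms_def exact_equivalence_def)
  interpret W: triangulated_autoequivalence K C W W'
    using W W' triangulated_functorI[OF C C]
    by (simp add: triangulated_autoequivalence_def triangulated_autoequivalence_axioms_def exact_equivalence_def)
  obtain G g where G: "split_generator D G" "\<not> is_zero_object D G"
    and g: "(\<lambda>n. ln (real (D.min_steps G ((fob T ^^ n) G))) / real n) \<longlonglongrightarrow> g"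
      "entropy D 0 T = ereal g"
    using T.entropy_rate[OF genD XD] by blast
  obtain H h where H: "split_generator C H" "\<not> is_zero_object C H"
    and h: "(\<lambda>n. ln (real (C.min_steps H ((fob W ^^ n) H))) / real n) \<longlonglongrightarrow> h"
      "entropy C 0 W = ereal h"
    using W.entropy_rate[OF genC XC] by blast
  have GOb: "G \<in> Ob D" and HOb: "H \<in> Ob C" using G H by (simp_all add: split_generator_def)
  \<comment> \<open>By \<open>RLT\<close>, \<open>L T X\<close> is a shift of \<open>R X\<close>; by
    \<open>RWL\<close>, \<open>R T X\<close> is a shift of \<open>W L T X\<close>, hence of
    \<open>W R X\<close>.\<close>
  have RT: "C.shift_of (fob W (fob R X)) (fob R (fob T X))" if X: "X \<in> Ob D" for X
  proof -
    have TX: "fob T X \<in> Ob D" using X by (rule T.fob_closed)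
    have "iso_objects C (fob R X) (fob (ush C) (fob L (fob T X)))"
      using iso_functors_objects[OF RLT, of X] X TX
      by (simp add: R.fob_closed C.ush_Ob L.fob_closed)
    then have "C.shift_of (fob R X) (fob (ush C) (fob L (fob T X)))"
      using C.shift_of_sym_iso C.iso_objects_sym by blast
    then have "C.shift_of (fob R X) (fob L (fob T X))"
      using C.shift_of_iso[OF C.shift_of_sh C.sh_ush_iso[OF L.fob_closed[OF TX]]] by blast
    then have "C.shift_of (fob W (fob R X)) (fob (sh C) (fob W (fob L (fob T X))))"
      by (intro C.shift_of_sh W.shift_of)
    moreover have "iso_objects C (fob R (fob T X)) (fob (sh C) (fob W (fob L (fob T X))))"
      using iso_functors_objects[OF RWL, of "fob T X"] TX
      by (simp add: R.fob_closed C.sh_Ob L.fob_closed W.fob_closed)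
    ultimately show ?thesis using C.shift_of_iso C.iso_objects_sym by blast
  qed
  have RTn: "C.shift_of ((fob W ^^ n) (fob R G)) (fob R ((fob T ^^ n) G))" for n
  proof (induction n)
    case 0
    then show ?case using R.fob_closed[OF GOb] C.shift_of_refl by simp
  next
    case (Suc n)
    show ?case
      using C.shift_of_trans[OF RT[OF T.iterate_closed[OF GOb]] W.shift_of[OF Suc]] by simp
  qed
  define b where "b n = C.min_steps H ((fob W ^^ n) H)" for n
  \<comment> \<open>The fixed costs of reaching \<open>R G\<close> from \<open>H\<close> and
    \<open>S H\<close> from \<open>G\<close>.\<close>
  define p q where "p = C.min_steps H (fob R G)" and "q = D.min_steps G (fob S H)"
  have SRTn: "D.sbuilt G (p * b n * q) (fob S (fob R ((fob T ^^ n) G)))" for n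
  proof -
    have "C.sbuilt H p (fob R G)"
      unfolding p_def by (rule C.sbuilt_min_steps[OF H(1) R.fob_closed[OF GOb]])
    then have 1: "C.sbuilt ((fob W ^^ n) H) p ((fob W ^^ n) (fob R G))" by (rule W.iterate_sbuilt)
    have 2: "C.sbuilt H (b n) ((fob W ^^ n) H)"
      unfolding b_def by (rule C.sbuilt_min_steps[OF H(1) W.iterate_closed[OF HOb]])
    have 3: "D.sbuilt G q (fob S H)"
      unfolding q_def by (rule D.sbuilt_min_steps[OF G(1) S.fob_closed[OF HOb]])
    have "C.sbuilt H (p * b n) (fob R ((fob T ^^ n) G))"
      using C.sbuilt_shift_of[OF RTn C.sbuilt_trans[OF 2 1]] .
    then show ?thesis by (rule D.sbuilt_trans[OF 3 S.sbuilt])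
  qed
  \<comment> \<open>Each application of \<open>T\<close> glues on one shifted copy of
    \<open>S R T^n G\<close>; the summand 1 is the one-step filtration of \<open>G\<close>
    itself.\<close>
  have "D.sbuilt G (1 + p * q * (\<Sum>k<n. b k)) ((fob T ^^ n) G)" for n
  proof (induction n)
    case 0
    then show ?case using D.sbuilt_refl[OF GOb] by simp
  next
    case (Suc n)
    have "D.triex ((fob T ^^ n) G) (fob T ((fob T ^^ n) G)) (fob (sh D) (fob S (fob R ((fob T ^^ n) G))))"
      using D.triex_rotate[OF cone[OF T.iterate_closed[OF GOb]]] .
    from D.sbuilt_triex[OF Suc D.sbuilt_sh[OF SRTn] this] show ?case
      by (simp add: algebra_simps)
  qed
  then have up: "D.min_steps G ((fob T ^^ n) G) \<le> 1 + p * q * (\<Sum>k<n. b k)" for n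
    by (rule D.min_steps_le)
  have "g \<le> h"
  proof (rule exponential_rate_le_of_sum_bound[OF _ _ _ _ g(1) h(1)])
    show "1 \<le> real (D.min_steps G ((fob T ^^ n) G))" for n
      using D.min_steps_pos[OF G(1) T.iterate_closed[OF GOb] T.iterate_nonzero[OF GOb G(2)], of n] by simp
    show "1 \<le> real (C.min_steps H ((fob W ^^ n) H))" for n
      using C.min_steps_pos[OF H(1) W.iterate_closed[OF HOb] W.iterate_nonzero[OF HOb H(2)], of n] by simp
    show "real (D.min_steps G ((fob T ^^ n) G))
        \<le> 1 + real (p * q) * (\<Sum>k<n. real (C.min_steps H ((fob W ^^ k) H)))" for n
      using of_nat_mono[OF up[of n], where 'a = real] by (simp add: b_def)
  qed simp
  then show ?thesis using g(2) h(2) by simp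
qed

section \<open>Triangles from functorial cones\<close>

context dg_category
begin

definition darr :: "'m \<Rightarrow> 'o \<Rightarrow> 'o \<Rightarrow> int \<Rightarrow> bool" where
  "darr f X Y n \<longleftrightarrow> X \<in> dOb A \<and> Y \<in> dOb A \<and> f \<in> carrier (dHom A X Y n)"

lemma abelian_group_dHom: "X \<in> dOb A \<Longrightarrow> Y \<in> dOb A \<Longrightarrow> abelian_group (dHom A X Y n)"
  using dHom_vectorspace[of X Y n] by (simp add: vectorspace_def module_def)

text \<open>The degree of the composite enters through an equation, so that the index can be stated
  in whatever form the context requires.\<close>

lemma darr_comp:
  assumes "darr f X Y i" "darr g Y Z j" "k = j + i"
  shows "darr (dg_comp A X Y Z j i g f) X Z k"
proof -
  interpret linear_map K "dHom A X Y i" "dHom A X Z (j + i)" "\<lambda>f. dg_comp A X Y Z j i g f"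
    using assms by (intro dg_comp_linear_right) (auto simp: darr_def)
  show ?thesis using assms by (auto simp: darr_def)
qed

lemma darr_diff:
  assumes "darr f X Y n" "k = n + 1"
  shows "darr (diff A X Y n f) X Y k"
proof -
  interpret linear_map K "dHom A X Y n" "dHom A X Y (n + 1)" "diff A X Y n"
    using assms by (intro diff_linear) (auto simp: darr_def)
  show ?thesis using assms by (auto simp: darr_def)
qed

lemma darr_add: "darr f X Y n \<Longrightarrow> darr g X Y n \<Longrightarrow> darr (f \<oplus>\<^bsub>dHom A X Y n\<^esub> g) X Y n"
  by (simp add: darr_def abelian_group_dHom abelian_group.axioms(1) abelian_monoid.a_closed)

lemma darr_uminus: "darr f X Y n \<Longrightarrow> darr (\<ominus>\<^bsub>dHom A X Y n\<^esub> f) X Y n"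
  by (simp add: darr_def abelian_group_dHom abelian_group.a_inv_closed)

lemma darr_ident: "X \<in> dOb A \<Longrightarrow> darr (dg_ident A X) X X 0"
  by (simp add: darr_def dg_ident_closed)

lemma
  assumes "darr g Y Z j" and "X \<in> dOb A"
  shows dg_comp_zero_right: "dg_comp A X Y Z j i g \<zero>\<^bsub>dHom A X Y i\<^esub> = \<zero>\<^bsub>dHom A X Z (j + i)\<^esub>"
    and dg_comp_add_right: "darr f X Y i \<Longrightarrow> darr f' X Y i \<Longrightarrow>
      dg_comp A X Y Z j i g (f \<oplus>\<^bsub>dHom A X Y i\<^esub> f')
        = dg_comp A X Y Z j i g f \<oplus>\<^bsub>dHom A X Z (j + i)\<^esub> dg_comp A X Y Z j i g f'"
proof -
  have Y: "Y \<in> dOb A" using assms by (simp add: darr_def)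
  interpret linear_map K "dHom A X Y i" "dHom A X Z (j + i)" "\<lambda>f. dg_comp A X Y Z j i g f"
    using assms by (intro dg_comp_linear_right) (auto simp: darr_def)
  show "dg_comp A X Y Z j i g \<zero>\<^bsub>dHom A X Y i\<^esub> = \<zero>\<^bsub>dHom A X Z (j + i)\<^esub>"
    using f0_is_0 .
  show "darr f X Y i \<Longrightarrow> darr f' X Y i \<Longrightarrow>
      dg_comp A X Y Z j i g (f \<oplus>\<^bsub>dHom A X Y i\<^esub> f')
        = dg_comp A X Y Z j i g f \<oplus>\<^bsub>dHom A X Z (j + i)\<^esub> dg_comp A X Y Z j i g f'"
    using f_add[of f f'] by (simp add: darr_def)
qed

lemma
  assumes "darr f X Y i" and "Z \<in> dOb A"
  shows dg_comp_zero_left: "dg_comp A X Y Z j i \<zero>\<^bsub>dHom A Y Z j\<^esub> f = \<zero>\<^bsub>dHom A X Z (j + i)\<^esub>"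
    and dg_comp_add_left: "darr g Y Z j \<Longrightarrow> darr g' Y Z j \<Longrightarrow>
      dg_comp A X Y Z j i (g \<oplus>\<^bsub>dHom A Y Z j\<^esub> g') f
        = dg_comp A X Y Z j i g f \<oplus>\<^bsub>dHom A X Z (j + i)\<^esub> dg_comp A X Y Z j i g' f"
proof -
  interpret linear_map K "dHom A Y Z j" "dHom A X Z (j + i)" "\<lambda>g. dg_comp A X Y Z j i g f"
    using assms by (intro dg_comp_linear_left) (auto simp: darr_def)
  show "dg_comp A X Y Z j i \<zero>\<^bsub>dHom A Y Z j\<^esub> f = \<zero>\<^bsub>dHom A X Z (j + i)\<^esub>"
    using f0_is_0 .
  show "darr g Y Z j \<Longrightarrow> darr g' Y Z j \<Longrightarrow>
      dg_comp A X Y Z j i (g \<oplus>\<^bsub>dHom A Y Z j\<^esub> g') f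
        = dg_comp A X Y Z j i g f \<oplus>\<^bsub>dHom A X Z (j + i)\<^esub> dg_comp A X Y Z j i g' f"
    using f_add[of g g'] by (simp add: darr_def)
qed

lemma diff_add: "darr f X Y n \<Longrightarrow> darr g X Y n \<Longrightarrow>
    diff A X Y n (f \<oplus>\<^bsub>dHom A X Y n\<^esub> g) = diff A X Y n f \<oplus>\<^bsub>dHom A X Y (n + 1)\<^esub> diff A X Y n g"
  and diff_uminus: "darr f X Y n \<Longrightarrow>
    diff A X Y n (\<ominus>\<^bsub>dHom A X Y n\<^esub> f) = \<ominus>\<^bsub>dHom A X Y (n + 1)\<^esub> diff A X Y n f"
  and diff_zero: "X \<in> dOb A \<Longrightarrow> Y \<in> dOb A \<Longrightarrow> diff A X Y n \<zero>\<^bsub>dHom A X Y n\<^esub> = \<zero>\<^bsub>dHom A X Y (n + 1)\<^esub>"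
proof -
  have lin: "linear_map K (dHom A X Y n) (dHom A X Y (n + 1)) (diff A X Y n)"
    if "X \<in> dOb A" "Y \<in> dOb A" using that by (rule diff_linear)
  show "diff A X Y n (f \<oplus>\<^bsub>dHom A X Y n\<^esub> g) = diff A X Y n f \<oplus>\<^bsub>dHom A X Y (n + 1)\<^esub> diff A X Y n g"
    if "darr f X Y n" "darr g X Y n"
  proof -
    interpret linear_map K "dHom A X Y n" "dHom A X Y (n + 1)" "diff A X Y n"
      using lin that by (auto simp: darr_def)
    show ?thesis using that f_add[of f g] by (simp add: darr_def)
  qed
  show "diff A X Y n (\<ominus>\<^bsub>dHom A X Y n\<^esub> f) = \<ominus>\<^bsub>dHom A X Y (n + 1)\<^esub> diff A X Y n f"
    if "darr f X Y n"
  proof -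
    interpret linear_map K "dHom A X Y n" "dHom A X Y (n + 1)" "diff A X Y n"
      using lin that by (auto simp: darr_def)
    show ?thesis using that f_neg[of f] by (simp add: darr_def)
  qed
  show "diff A X Y n \<zero>\<^bsub>dHom A X Y n\<^esub> = \<zero>\<^bsub>dHom A X Y (n + 1)\<^esub>" if "X \<in> dOb A" "Y \<in> dOb A"
  proof -
    interpret linear_map K "dHom A X Y n" "dHom A X Y (n + 1)" "diff A X Y n"
      using lin that by auto
    show ?thesis by (rule f0_is_0)
  qed
qed

lemma abelian_zero:
  assumes "X \<in> dOb A" "Y \<in> dOb A"
  shows "f \<in> carrier (dHom A X Y n) \<Longrightarrow> f \<oplus>\<^bsub>dHom A X Y n\<^esub> \<zero>\<^bsub>dHom A X Y n\<^esub> = f"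
    and "f \<in> carrier (dHom A X Y n) \<Longrightarrow> \<zero>\<^bsub>dHom A X Y n\<^esub> \<oplus>\<^bsub>dHom A X Y n\<^esub> f = f"
    and "\<ominus>\<^bsub>dHom A X Y n\<^esub> \<zero>\<^bsub>dHom A X Y n\<^esub> = \<zero>\<^bsub>dHom A X Y n\<^esub>"
    and "\<zero>\<^bsub>dHom A X Y n\<^esub> \<in> carrier (dHom A X Y n)"
proof -
  interpret abelian_group "dHom A X Y n" using assms by (rule abelian_group_dHom)
  show "f \<in> carrier (dHom A X Y n) \<Longrightarrow> f \<oplus>\<^bsub>dHom A X Y n\<^esub> \<zero>\<^bsub>dHom A X Y n\<^esub> = f"
    "f \<in> carrier (dHom A X Y n) \<Longrightarrow> \<zero>\<^bsub>dHom A X Y n\<^esub> \<oplus>\<^bsub>dHom A X Y n\<^esub> f = f"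
    "\<zero>\<^bsub>dHom A X Y n\<^esub> \<in> carrier (dHom A X Y n)" by auto
  show "\<ominus>\<^bsub>dHom A X Y n\<^esub> \<zero>\<^bsub>dHom A X Y n\<^esub> = \<zero>\<^bsub>dHom A X Y n\<^esub>"
    using minus_equality[of "\<zero>\<^bsub>dHom A X Y n\<^esub>" "\<zero>\<^bsub>dHom A X Y n\<^esub>"] by auto
qed

lemma diff_comp_closed_left:
  assumes "darr f X Y i" "darr g Y Z j" "diff A Y Z j g = \<zero>\<^bsub>dHom A Y Z (j + 1)\<^esub>"
  shows "diff A X Z (j + i) (dg_comp A X Y Z j i g f)
    = koszul (dHom A X Z (j + i + 1)) j (dg_comp A X Y Z j (i + 1) g (diff A X Y i f))"
proof -
  have Ob: "X \<in> dOb A" "Z \<in> dOb A" using assms by (auto simp: darr_def)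
  have c: "darr (dg_comp A X Y Z j (i + 1) g (diff A X Y i f)) X Z (j + i + 1)"
    using assms by (intro darr_comp darr_diff) auto
  then have "darr (koszul (dHom A X Z (j + i + 1)) j (dg_comp A X Y Z j (i + 1) g (diff A X Y i f))) X Z (j + i + 1)"
    by (simp add: koszul_def darr_uminus)
  moreover have idx: "j + 1 + i = j + i + 1" by simp
  ultimately show ?thesis
    using Leibniz[of X Y Z f i g j] assms Ob
      dg_comp_zero_left[OF assms(1) Ob(2), of "j + 1", unfolded idx]
    by (auto simp: darr_def abelian_zero)
qed

lemma diff_comp_closed_right:
  assumes "darr f X Y i" "darr g Y Z j" "diff A X Y i f = \<zero>\<^bsub>dHom A X Y (i + 1)\<^esub>"
  shows "diff A X Z (j + i) (dg_comp A X Y Z j i g f)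
    = dg_comp A X Y Z (j + 1) i (diff A Y Z j g) f"
proof -
  have Ob: "X \<in> dOb A" "Z \<in> dOb A" using assms by (auto simp: darr_def)
  have "darr (dg_comp A X Y Z (j + 1) i (diff A Y Z j g) f) X Z (j + i + 1)"
    using assms by (intro darr_comp[of _ _ _ i _ _ "j + 1"] darr_diff) auto
  moreover have "dg_comp A X Y Z j (i + 1) g \<zero>\<^bsub>dHom A X Y (i + 1)\<^esub> = \<zero>\<^bsub>dHom A X Z (j + i + 1)\<^esub>"
    using dg_comp_zero_right[OF assms(2) Ob(1), of "i + 1"] by (simp add: add.assoc)
  ultimately show ?thesis
    using Leibniz[of X Y Z f i g j] assms Ob
    by (auto simp: darr_def abelian_zero koszul_def)
qed

lemma coboundariesE:
  assumes "b \<in> coboundaries A X Y" "X \<in> dOb A" "Y \<in> dOb A"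
  obtains c where "darr c X Y (- 1)" "b = diff A X Y (- 1) c"
  using assms by (auto simp: coboundaries_def darr_def)

lemma coboundariesI: "darr c X Y (- 1) \<Longrightarrow> diff A X Y (- 1) c \<in> coboundaries A X Y"
  by (auto simp: coboundaries_def darr_def)

lemma cocycles_iff: "X \<in> dOb A \<Longrightarrow> Y \<in> dOb A \<Longrightarrow>
    f \<in> cocycles A X Y \<longleftrightarrow> darr f X Y 0 \<and> diff A X Y 0 f = \<zero>\<^bsub>dHom A X Y 1\<^esub>"
  by (simp add: cocycles_def darr_def)

lemma coboundaries_darr: "b \<in> coboundaries A X Y \<Longrightarrow> X \<in> dOb A \<Longrightarrow> Y \<in> dOb A \<Longrightarrow> darr b X Y 0"
  by (erule coboundariesE) (auto intro: darr_diff)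

lemma coboundaries_add:
  assumes "b \<in> coboundaries A X Y" "b' \<in> coboundaries A X Y" "X \<in> dOb A" "Y \<in> dOb A"
  shows "b \<oplus>\<^bsub>dHom A X Y 0\<^esub> b' \<in> coboundaries A X Y"
proof -
  obtain c c' where c: "darr c X Y (- 1)" "b = diff A X Y (- 1) c"
    and c': "darr c' X Y (- 1)" "b' = diff A X Y (- 1) c'"
    using assms by (meson coboundariesE)
  have "b \<oplus>\<^bsub>dHom A X Y 0\<^esub> b' = diff A X Y (- 1) (c \<oplus>\<^bsub>dHom A X Y (- 1)\<^esub> c')"
    using diff_add[OF c(1) c'(1)] c c' by simp
  then show ?thesis using coboundariesI darr_add c(1) c'(1) by metis
qed

lemma coboundaries_uminus:
  assumes "b \<in> coboundaries A X Y" "X \<in> dOb A" "Y \<in> dOb A"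
  shows "\<ominus>\<^bsub>dHom A X Y 0\<^esub> b \<in> coboundaries A X Y"
proof -
  obtain c where c: "darr c X Y (- 1)" "b = diff A X Y (- 1) c"
    using assms by (meson coboundariesE)
  have "\<ominus>\<^bsub>dHom A X Y 0\<^esub> b = diff A X Y (- 1) (\<ominus>\<^bsub>dHom A X Y (- 1)\<^esub> c)"
    using diff_uminus[OF c(1)] c by simp
  then show ?thesis using coboundariesI darr_uminus c(1) by metis
qed

lemma coboundaries_zero:
  assumes "X \<in> dOb A" "Y \<in> dOb A"
  shows "\<zero>\<^bsub>dHom A X Y 0\<^esub> \<in> coboundaries A X Y"
  using coboundariesI[of "\<zero>\<^bsub>dHom A X Y (- 1)\<^esub>" X Y] diff_zero[OF assms, of "- 1"] assms
    abelian_zero(4)[OF assms] by (simp add: darr_def)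

lemma cocycles_add_coboundary:
  assumes "f \<in> cocycles A X Y" "b \<in> coboundaries A X Y" "X \<in> dOb A" "Y \<in> dOb A"
  shows "b \<oplus>\<^bsub>dHom A X Y 0\<^esub> f \<in> cocycles A X Y"
proof -
  obtain c where c: "darr c X Y (- 1)" "b = diff A X Y (- 1) c"
    using assms by (meson coboundariesE)
  have "diff A X Y 0 b = \<zero>\<^bsub>dHom A X Y 1\<^esub>"
    using diff_diff[of X Y c "- 1"] c assms by (simp add: darr_def)
  then show ?thesis
    using assms diff_add[of b X Y 0 f] coboundaries_darr[OF assms(2-4)]
    by (auto simp: cocycles_iff darr_add abelian_zero)
qed

lemma coboundary_comp_cocycle:
  assumes b: "b \<in> coboundaries A Y Z" and f: "f \<in> cocycles A X Y"
    and Ob: "X \<in> dOb A" "Y \<in> dOb A" "Z \<in> dOb A"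
  shows "dg_comp A X Y Z 0 0 b f \<in> coboundaries A X Z"
proof -
  obtain c where c: "darr c Y Z (- 1)" "b = diff A Y Z (- 1) c"
    using b Ob by (meson coboundariesE)
  have "diff A X Z (- 1) (dg_comp A X Y Z (- 1) 0 c f) = dg_comp A X Y Z 0 0 b f"
    using diff_comp_closed_right[of f X Y 0 c Z "- 1"] f c Ob by (simp add: cocycles_iff)
  moreover have "darr (dg_comp A X Y Z (- 1) 0 c f) X Z (- 1)"
    using f c Ob by (intro darr_comp) (auto simp: cocycles_iff)
  ultimately show ?thesis using coboundariesI by metis
qed

lemma cocycle_comp_coboundary:
  assumes b: "b \<in> coboundaries A X Y" and g: "g \<in> cocycles A Y Z"
    and Ob: "X \<in> dOb A" "Y \<in> dOb A" "Z \<in> dOb A"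
  shows "dg_comp A X Y Z 0 0 g b \<in> coboundaries A X Z"
proof -
  obtain c where c: "darr c X Y (- 1)" "b = diff A X Y (- 1) c"
    using b Ob by (meson coboundariesE)
  have "diff A X Z (- 1) (dg_comp A X Y Z 0 (- 1) g c) = dg_comp A X Y Z 0 0 g b"
    using diff_comp_closed_left[of c X Y "- 1" g Z 0] g c Ob by (simp add: cocycles_iff koszul_def)
  moreover have "darr (dg_comp A X Y Z 0 (- 1) g c) X Z (- 1)"
    using g c Ob by (intro darr_comp) (auto simp: cocycles_iff)
  ultimately show ?thesis using coboundariesI by metis
qed

text \<open>The operations on cosets act on all representatives and then add coboundaries. The
  result is a single class as soon as all values differ from one value \<open>f\<close> by
  coboundaries.\<close>

lemma coboundaries_absorb:
  assumes Ob: "X \<in> dOb A" "Y \<in> dOb A" and f: "f \<in> carrier (dHom A X Y 0)" and "f \<in> M"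
    and M: "\<And>m. m \<in> M \<Longrightarrow> \<exists>b \<in> coboundaries A X Y. m = b \<oplus>\<^bsub>dHom A X Y 0\<^esub> f"
  shows "coboundaries A X Y <+>\<^bsub>dHom A X Y 0\<^esub> M = H0_class A X Y f"
proof -
  interpret abelian_group "dHom A X Y 0" using Ob by (rule abelian_group_dHom)
  show ?thesis
    unfolding H0_class_def set_add_def' a_r_coset_def'
  proof (intro subset_antisym subsetI)
    fix x assume "x \<in> (\<Union>h\<in>coboundaries A X Y. \<Union>k\<in>M. {h \<oplus>\<^bsub>dHom A X Y 0\<^esub> k})"
    then obtain b m where x: "b \<in> coboundaries A X Y" "m \<in> M" "x = b \<oplus>\<^bsub>dHom A X Y 0\<^esub> m" by blast
    then obtain b' where b': "b' \<in> coboundaries A X Y" "m = b' \<oplus>\<^bsub>dHom A X Y 0\<^esub> f" using M by blast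
    have "x = (b \<oplus>\<^bsub>dHom A X Y 0\<^esub> b') \<oplus>\<^bsub>dHom A X Y 0\<^esub> f"
      using x b' f coboundaries_darr[OF _ Ob] by (simp add: a_assoc darr_def)
    then show "x \<in> (\<Union>h\<in>coboundaries A X Y. {h \<oplus>\<^bsub>dHom A X Y 0\<^esub> f})"
      using coboundaries_add[OF x(1) b'(1) Ob] by blast
  qed (use \<open>f \<in> M\<close> in blast)
qed

section \<open>Composition, identities and triangles in the homotopy category\<close>

lemma H0_class_iff:
  "x \<in> H0_class A X Y f \<longleftrightarrow> (\<exists>b \<in> coboundaries A X Y. x = b \<oplus>\<^bsub>dHom A X Y 0\<^esub> f)"
  unfolding H0_class_def a_r_coset_def' by blast

lemma H0_class_self:
  assumes "X \<in> dOb A" "Y \<in> dOb A" "f \<in> carrier (dHom A X Y 0)"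
  shows "f \<in> H0_class A X Y f"
  using coboundaries_zero[OF assms(1,2)] abelian_zero(2)[OF assms] H0_class_iff by metis

text \<open>Representatives \<open>b + g\<close> and \<open>c + f\<close> compose to
  \<open>b (c + f) + g c + g f\<close>, whose first two terms are coboundaries by the Leibniz
  rule.\<close>

lemma H0_comp:
  assumes Ob: "X \<in> dOb A" "Y \<in> dOb A" "Z \<in> dOb A"
    and f: "f \<in> cocycles A X Y" and g: "g \<in> cocycles A Y Z"
  shows "cat_comp (H0_shift_cat A) X Y Z (H0_class A Y Z g) (H0_class A X Y f)
    = H0_class A X Z (dg_comp A X Y Z 0 0 g f)"
proof -
  have fa: "darr f X Y 0" and ga: "darr g Y Z 0" using f g Ob by (auto simp: cocycles_iff)
  have gf: "darr (dg_comp A X Y Z 0 0 g f) X Z 0" using fa ga by (intro darr_comp) auto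
  interpret abelian_group "dHom A X Z 0" using Ob by (intro abelian_group_dHom)
  have "coboundaries A X Z <+>\<^bsub>dHom A X Z 0\<^esub>
      (\<lambda>(g, f). dg_comp A X Y Z 0 0 g f) ` (H0_class A Y Z g \<times> H0_class A X Y f)
    = H0_class A X Z (dg_comp A X Y Z 0 0 g f)"
  proof (rule coboundaries_absorb)
    show "dg_comp A X Y Z 0 0 g f \<in> (\<lambda>(g, f). dg_comp A X Y Z 0 0 g f) ` (H0_class A Y Z g \<times> H0_class A X Y f)"
      using H0_class_self Ob fa ga by (force simp: darr_def)
    fix m assume "m \<in> (\<lambda>(g, f). dg_comp A X Y Z 0 0 g f) ` (H0_class A Y Z g \<times> H0_class A X Y f)"
    then obtain b c where bc: "b \<in> coboundaries A Y Z" "c \<in> coboundaries A X Y"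
      and m: "m = dg_comp A X Y Z 0 0 (b \<oplus>\<^bsub>dHom A Y Z 0\<^esub> g) (c \<oplus>\<^bsub>dHom A X Y 0\<^esub> f)"
      by (auto simp: H0_class_iff)
    let ?f = "c \<oplus>\<^bsub>dHom A X Y 0\<^esub> f"
    have ba: "darr b Y Z 0" and ca: "darr c X Y 0" using bc Ob coboundaries_darr by blast+
    have f': "?f \<in> cocycles A X Y" using cocycles_add_coboundary f bc Ob by blast
    then have fa': "darr ?f X Y 0" using Ob by (simp add: cocycles_iff)
    have 1: "dg_comp A X Y Z 0 0 b ?f \<in> coboundaries A X Z"
      using coboundary_comp_cocycle[OF bc(1) f' Ob] .
    have 2: "dg_comp A X Y Z 0 0 g c \<in> coboundaries A X Z"
      using cocycle_comp_coboundary[OF bc(2) g Ob] .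
    have "m = dg_comp A X Y Z 0 0 b ?f \<oplus>\<^bsub>dHom A X Z 0\<^esub> dg_comp A X Y Z 0 0 g ?f"
      unfolding m using dg_comp_add_left[OF fa' Ob(3) ba ga] by simp
    also have "dg_comp A X Y Z 0 0 g ?f
        = dg_comp A X Y Z 0 0 g c \<oplus>\<^bsub>dHom A X Z 0\<^esub> dg_comp A X Y Z 0 0 g f"
      using dg_comp_add_right[OF ga Ob(1) ca fa] by simp
    finally have "m = (dg_comp A X Y Z 0 0 b ?f \<oplus>\<^bsub>dHom A X Z 0\<^esub> dg_comp A X Y Z 0 0 g c)
        \<oplus>\<^bsub>dHom A X Z 0\<^esub> dg_comp A X Y Z 0 0 g f"
      using coboundaries_darr[OF 1 Ob(1,3)] coboundaries_darr[OF 2 Ob(1,3)] gf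
      by (simp add: darr_def a_assoc)
    then show "\<exists>b\<in>coboundaries A X Z. m = b \<oplus>\<^bsub>dHom A X Z 0\<^esub> dg_comp A X Y Z 0 0 g f"
      using coboundaries_add[OF 1 2 Ob(1,3)] by blast
  qed (use Ob gf in \<open>auto simp: darr_def\<close>)
  then show ?thesis by (simp add: H0_shift_cat_def)
qed

text \<open>The Leibniz rule for the identity composed with itself reads
  \<open>d 1 = d 1 + d 1\<close>.\<close>

lemma ident_cocycle:
  assumes X: "X \<in> dOb A"
  shows "dg_ident A X \<in> cocycles A X X"
proof -
  let ?e = "dg_ident A X"
  have e: "darr ?e X X 0" using X by (rule darr_ident)
  have de: "darr (diff A X X 0 ?e) X X 1" using darr_diff[OF e] by simp
  interpret abelian_group "dHom A X X 1" using X X by (rule abelian_group_dHom)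
  have "diff A X X 0 ?e = diff A X X 0 ?e \<oplus>\<^bsub>dHom A X X 1\<^esub> diff A X X 0 ?e"
    using Leibniz[of X X X ?e 0 ?e 0] e de X
      dg_ident_right[of X X "diff A X X 0 ?e" 1] dg_ident_left[of X X "diff A X X 0 ?e" 1]
      dg_ident_left[of X X ?e 0]
    by (simp add: darr_def koszul_def)
  then have "diff A X X 0 ?e = \<zero>\<^bsub>dHom A X X 1\<^esub>"
    using de add.l_cancel_one'[of "diff A X X 0 ?e" "diff A X X 0 ?e"] by (auto simp: darr_def)
  then show ?thesis using e X by (simp add: cocycles_iff)
qed

lemma H0_comp_ident:
  assumes "X \<in> dOb A" "Y \<in> dOb A" and f: "f \<in> cocycles A X Y"
  shows "cat_comp (H0_shift_cat A) X Y Y (ident (H0_shift_cat A) Y) (H0_class A X Y f) = H0_class A X Y f"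
    and "cat_comp (H0_shift_cat A) X X Y (H0_class A X Y f) (ident (H0_shift_cat A) X) = H0_class A X Y f"
  using H0_comp[OF assms(1,2,2) f ident_cocycle] H0_comp[OF assms(1,1,2) ident_cocycle f] assms
    dg_ident_left[of X Y f 0] dg_ident_right[of X Y f 0]
  by (auto simp: cocycles_iff darr_def) (simp_all add: H0_shift_cat_def)

text \<open>Representatives of the identity differ from it by some \<open>d c\<close>, which
  conjugation by the closed arrows \<open>s\<close> and \<open>t\<close> turns into
  \<open>d (s c t)\<close> up to sign. Needed for the square of connecting arrows in the identity
  morphism of a cone triangle.\<close>

lemma H0_shift_ident:
  assumes X: "X \<in> dOb A" and s: "is_dg_shift A n X (dg_shift A n X)"
  shows "fmor (H0_shift A n) X X (ident (H0_shift_cat A) X)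
    = ident (H0_shift_cat A) (fob (H0_shift A n) X)"
proof -
  obtain X' s t where eq: "dg_shift A n X = (X', s, t)" by (rule prod_cases3)
  have X': "X' \<in> dOb A" and sa: "darr s X X' (- n)" and ta: "darr t X' X n"
    and ds: "diff A X X' (- n) s = \<zero>\<^bsub>dHom A X X' (- n + 1)\<^esub>"
    and dt: "diff A X' X n t = \<zero>\<^bsub>dHom A X' X (n + 1)\<^esub>"
    and st: "dg_comp A X' X X' (- n) n s t = dg_ident A X'"
    using s X unfolding eq by (auto simp: is_dg_shift_def darr_def)
  let ?\<Phi> = "\<lambda>h. dg_comp A X' X X' (- n) n s (dg_comp A X' X X 0 n h t)"
  have e: "darr (dg_ident A X) X X 0" using X by (rule darr_ident)
  have \<Phi>e: "?\<Phi> (dg_ident A X) = dg_ident A X'"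
    using st dg_ident_left[of X' X t n] ta by (simp add: darr_def)
  have "coboundaries A X' X' <+>\<^bsub>dHom A X' X' 0\<^esub> ?\<Phi> ` H0_class A X X (dg_ident A X)
    = H0_class A X' X' (dg_ident A X')"
  proof (rule coboundaries_absorb)
    have "dg_ident A X \<in> H0_class A X X (dg_ident A X)" using H0_class_self X dg_ident_closed by blast
    then show "dg_ident A X' \<in> ?\<Phi> ` H0_class A X X (dg_ident A X)" using \<Phi>e by force
    fix m assume "m \<in> ?\<Phi> ` H0_class A X X (dg_ident A X)"
    then obtain b where b: "b \<in> coboundaries A X X"
      and m: "m = ?\<Phi> (b \<oplus>\<^bsub>dHom A X X 0\<^esub> dg_ident A X)" by (auto simp: H0_class_iff)
    have ba: "darr b X X 0" using b X coboundaries_darr by blast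
    obtain c where c: "darr c X X (- 1)" "b = diff A X X (- 1) c"
      using b X by (meson coboundariesE)
    have bt: "darr (dg_comp A X' X X 0 n b t) X' X n" using ba ta by (intro darr_comp) auto
    have et: "darr (dg_comp A X' X X 0 n (dg_ident A X) t) X' X n" using e ta by (intro darr_comp) auto
    have "dg_comp A X' X X 0 n (b \<oplus>\<^bsub>dHom A X X 0\<^esub> dg_ident A X) t
        = dg_comp A X' X X 0 n b t \<oplus>\<^bsub>dHom A X' X n\<^esub> dg_comp A X' X X 0 n (dg_ident A X) t"
      using dg_comp_add_left[OF ta X ba e] by simp
    then have m': "m = ?\<Phi> b \<oplus>\<^bsub>dHom A X' X' 0\<^esub> dg_ident A X'"
      unfolding m using dg_comp_add_right[OF sa X' bt et] \<Phi>e by simp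
    have ct: "darr (dg_comp A X' X X (- 1) n c t) X' X (n - 1)" using c ta by (intro darr_comp) auto
    let ?sct = "dg_comp A X' X X' (- n) (n - 1) s (dg_comp A X' X X (- 1) n c t)"
    have sct: "darr ?sct X' X' (- 1)" using darr_comp[OF ct sa] by simp
    have "diff A X' X (n - 1) (dg_comp A X' X X (- 1) n c t) = dg_comp A X' X X 0 n b t"
      using diff_comp_closed_right[OF ta c(1) dt] c(2) by simp
    then have "diff A X' X' (- 1) ?sct = koszul (dHom A X' X' 0) (- n) (?\<Phi> b)"
      using diff_comp_closed_left[OF ct sa ds] by simp
    then have "koszul (dHom A X' X' 0) (- n) (?\<Phi> b) \<in> coboundaries A X' X'"
      using coboundariesI[OF sct] by simp
    moreover have "darr (?\<Phi> b) X' X' 0" using darr_comp[OF bt sa] by simp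
    ultimately have "?\<Phi> b \<in> coboundaries A X' X'"
      using coboundaries_uminus[OF _ X' X', of "\<ominus>\<^bsub>dHom A X' X' 0\<^esub> ?\<Phi> b"]
        abelian_group.minus_minus[OF abelian_group_dHom[OF X' X', of 0], of "?\<Phi> b"]
      by (auto simp: koszul_def darr_def split: if_splits)
    then show "\<exists>b\<in>coboundaries A X' X'. m = b \<oplus>\<^bsub>dHom A X' X' 0\<^esub> dg_ident A X'"
      using m' by blast
  qed (use X' dg_ident_closed in auto)
  then show ?thesis by (simp add: H0_shift_def H0_shift_cat_def eq)
qed

text \<open>\<open>Tri (H0 A)\<close> consists of the triangles isomorphic to a cone triangle, so it
  remains to see that a cone triangle is well formed and isomorphic to itself through
  identities.\<close>

lemma H0_cone_triangle:
  assumes pre: "pretriangulated A" and X: "X \<in> dOb A" and Y: "Y \<in> dOb A" and f: "f \<in> cocycles A X Y"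
    and cone: "is_dg_cone A X Y f Z i q j p"
  obtains u v w where "(X, Y, Z, u, v, w) \<in> Tri (H0 A)"
proof -
  let ?H = "H0_shift_cat A"
  have "\<exists>T. is_dg_shift A 1 X T" using pre X by (simp add: pretriangulated_def)
  then have sX: "is_dg_shift A 1 X (dg_shift A 1 X)" unfolding dg_shift_def by (rule someI_ex)
  obtain X' s t where eq: "dg_shift A 1 X = (X', s, t)" by (rule prod_cases3)
  have X': "X' \<in> dOb A" and sa: "darr s X X' (- 1)"
    and ds: "diff A X X' (- 1) s = \<zero>\<^bsub>dHom A X X' (- 1 + 1)\<^esub>"
    using sX X unfolding eq by (auto simp: is_dg_shift_def darr_def)
  have Z: "Z \<in> dOb A" and i: "i \<in> cocycles A Y Z" and pa: "darr p Z X 1"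
    and dp: "diff A Z X 1 p = \<zero>\<^bsub>dHom A Z X (1 + 1)\<^esub>"
    using cone X by (auto simp: is_dg_cone_def cocycles_def darr_def)
  let ?c = "dg_comp A Z X X' (- 1) 1 s p"
  \<comment> \<open>The connecting arrow \<open>s p\<close> has degree 0 and is closed because
    \<open>s\<close> and \<open>p\<close> are.\<close>
  have "diff A Z X' (- 1 + 1) ?c = dg_comp A Z X X' (- 1 + 1) 1 (diff A X X' (- 1) s) p"
    by (rule diff_comp_closed_right[OF pa sa dp])
  then have c: "?c \<in> cocycles A Z X'"
    using dg_comp_zero_left[OF pa X', of 0] ds darr_comp[OF pa sa, of 0] Z X'
    by (simp add: cocycles_iff)
  have H: "H0_class A U V g \<in> carrier (Hom ?H U V)" if "g \<in> cocycles A U V" for U V g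
    using that by (simp add: H0_shift_cat_def)
  have ident: "ident ?H U = H0_class A U U (dg_ident A U)" for U by (simp add: H0_shift_cat_def)
  have iso: "is_iso ?H U U (ident ?H U)" if "U \<in> dOb A" for U
    using H0_comp_ident[OF that that ident_cocycle[OF that]] H[OF ident_cocycle[OF that]]
    by (auto simp: is_iso_def ident)
  have sh: "fob (sh ?H) X = X'" "fmor (sh ?H) X X (ident ?H X) = ident ?H X'"
    using H0_shift_ident[OF X sX] by (simp_all add: H0_shift_cat_def H0_shift_def eq)
  let ?T = "(X, Y, Z, H0_class A X Y f, H0_class A Y Z i, H0_class A Z X' ?c)"
  have tri: "is_triangle ?H ?T"
    using X Y Z H[OF f] H[OF i] H[OF c] by (simp add: sh) (simp add: H0_shift_cat_def)
  have "triangle_morphism ?H ?T ?T (ident ?H X) (ident ?H Y) (ident ?H Z)"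
    using H0_comp_ident[OF X Y f] H0_comp_ident[OF Y Z i] H0_comp_ident[OF Z X' c]
      H[OF ident_cocycle[OF X]] H[OF ident_cocycle[OF Y]] H[OF ident_cocycle[OF Z]]
    by (simp add: sh flip: ident)
  then have "triangle_iso ?H ?T ?T"
    using tri iso[OF X] iso[OF Y] iso[OF Z] by auto
  moreover have "?T \<in> H0_cone_triangles A"
    unfolding H0_cone_triangles_def using X Y f cone eq by blast
  ultimately have "\<exists>T'\<in>H0_cone_triangles A. triangle_iso ?H T' ?T" by blast
  then have "?T \<in> Tri (H0 A)"
    by (simp del: triangle_iso.simps add: H0_def shift_cat.extend_def tri_cat.fields_def)
  then show ?thesis using that by blast
qed

end

lemma Ob_H0 [simp]: "Ob (H0 A) = dOb A"
  by (simp add: H0_def shift_cat.extend_def H0_shift_cat_def)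

text \<open>The dg cone yields a triangle in the homotopy category of the enhancement, and the exact
  functor \<open>enh_eq D\<close> carries it to \<open>D\<close>. There the dg lifts identify its
  vertices with \<open>F E\<close>, \<open>G E\<close> and \<open>T E\<close>, and existence of a
  triangle is invariant under isomorphism of vertices.\<close>

lemma cone_triangle:
  assumes C: "enhanced_triangulated_category K C" and D: "enhanced_triangulated_category K D"
    and cone: "is_cone_of K C D F G a T"
    and F: "linear_functor K C D F" and G: "linear_functor K C D G" and T: "linear_functor K C D T"
    and E: "E \<in> Ob C"
  shows "triangulated_category.triex D (fob F E) (fob G E) (fob T E)"
proof -
  interpret C: triangulated_category K C using C by (simp add: enhanced_triangulated_category_def)
  interpret D: triangulated_category K D using D by (simp add: enhanced_triangulated_category_def)
  interpret B: dg_category K "enh D" using D by (simp add: enhanced_triangulated_category_def)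
  have lc: "linear_category K C" "linear_category K D" by unfold_locales
  interpret F: linear_functor_between K C D F using lc F by (rule linear_functor_betweenI)
  interpret G: linear_functor_between K C D G using lc G by (rule linear_functor_betweenI)
  interpret T: linear_functor_between K C D T using lc T by (rule linear_functor_betweenI)
  obtain e' where e': "quasi_inverse K (H0 (enh C)) C (enh_eq C) e'"
    using C by (auto simp: enhanced_triangulated_category_def exact_equivalence_def equivalence_def)
  \<comment> \<open>An object of the enhancement representing \<open>E\<close> up to
    isomorphism.\<close>
  define X where "X = fob e' E"
  have X: "X \<in> dOb (enh C)"
    using e' E unfolding X_def quasi_inverse_def linear_functor_def by simp
  have eX: "fob (enh_eq C) X \<in> Ob C"
    using e' X unfolding quasi_inverse_def linear_functor_def by simp
  have iso: "iso_objects C (fob (enh_eq C) X) E"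
    using e' iso_functors_objects[of C C "enh_eq C \<circ>\<^sub>F e'" id_functor E] E eX
    by (simp add: quasi_inverse_def X_def)
  obtain dF dG dT mF mG mT da where lifts: "dg_lift K C D F dF mF" "dg_lift K C D G dG mG"
      "dg_lift K C D T dT mT"
    and da: "dg_nat_trans (enh C) (enh D) dF dG da"
    and dT: "is_dg_cone_functor (enh C) (enh D) dF dG da dT"
    using cone by (auto simp: is_cone_of_def)
  obtain i q j p where cone': "is_dg_cone (enh D) (dg_fob dF X) (dg_fob dG X) (da X) (dg_fob dT X) i q j p"
    using dT X unfolding is_dg_cone_functor_def by blast
  have Ob: "dg_fob dF X \<in> dOb (enh D)" "dg_fob dG X \<in> dOb (enh D)" "dg_fob dT X \<in> dOb (enh D)"
    using lifts X by (auto simp: dg_lift_def dg_functor_def)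
  have "da X \<in> cocycles (enh D) (dg_fob dF X) (dg_fob dG X)"
    using da X by (simp add: dg_nat_trans_def)
  then obtain u v w where t: "(dg_fob dF X, dg_fob dG X, dg_fob dT X, u, v, w) \<in> Tri (H0 (enh D))"
    using B.H0_cone_triangle[OF _ Ob(1,2) _ cone'] D by (auto simp: enhanced_triangulated_category_def)
  let ?e = "fob (enh_eq D)"
  have ex: "exact_functor K (H0 (enh D)) D (enh_eq D)"
    using D by (auto simp: enhanced_triangulated_category_def exact_equivalence_def)
  then have tD: "D.triex (?e (dg_fob dF X)) (?e (dg_fob dG X)) (?e (dg_fob dT X))"
    using t unfolding exact_functor_def D.triex_def by blast
  have eOb: "?e Y \<in> Ob D" if "Y \<in> dOb (enh D)" for Y
    using ex that by (auto simp: exact_functor_def linear_functor_def)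
  have lift_iso: "iso_objects D (?e (dg_fob dH X)) (fob H E)"
    if "dg_lift K C D H dH m" and H: "linear_functor K C D H" for H dH m
  proof -
    interpret H: linear_functor_between K C D H using lc H by (rule linear_functor_betweenI)
    have "is_iso D (?e (dg_fob dH X)) (fob H (fob (enh_eq C) X)) (m X)"
      using that(1) X nat_iso_arr[of "H0 (enh C)" D "enh_eq D \<circ>\<^sub>F H0_functor (enh D) dH" "H \<circ>\<^sub>F enh_eq C" m X]
      by (simp add: dg_lift_def H0_functor_def)
    moreover have "dg_fob dH X \<in> dOb (enh D)" using that(1) X by (simp add: dg_lift_def dg_functor_def)
    ultimately have "iso_objects D (?e (dg_fob dH X)) (fob H (fob (enh_eq C) X))"
      using eOb H.fob_closed[OF eX] by (auto simp: iso_objects_def)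
    then show ?thesis using H.iso_objects[OF iso] D.iso_objects_trans by blast
  qed
  show ?thesis
    using D.triex_iso[OF tD] lift_iso lifts F G T by blast
qed

section \<open>Complexifications\<close>

text \<open>As \<open>h\<close> maps \<open>N\<close> into \<open>M\<close>, saturating the image of
  a coset of \<open>N\<close> with \<open>M\<close> yields exactly one coset of
  \<open>M\<close>.\<close>

lemma coset_map:
  assumes G: "comm_group G" and H: "comm_group H" and N: "subgroup N G" and M: "subgroup M H"
    and h: "h \<in> hom G H" and NM: "h ` N \<subseteq> M"
  shows coset_map_hom: "coset_map H M h \<in> hom (G Mod N) (H Mod M)"
    and coset_map_coset: "x \<in> carrier G \<Longrightarrow> coset_map H M h (N #>\<^bsub>G\<^esub> x) = M #>\<^bsub>H\<^esub> h x"
proof -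
  interpret G: comm_group G by fact
  interpret H: comm_group H by fact
  interpret h: group_hom G H h using h by unfold_locales
  interpret N: normal N G using N by (rule G.subgroup_imp_normal)
  interpret M: normal M H using M by (rule H.subgroup_imp_normal)
  have coset: "coset_map H M h (N #>\<^bsub>G\<^esub> x) = M #>\<^bsub>H\<^esub> h x" if x: "x \<in> carrier G" for x
    unfolding coset_map_def
  proof (intro subset_antisym subsetI)
    fix y assume "y \<in> M <#>\<^bsub>H\<^esub> h ` (N #>\<^bsub>G\<^esub> x)"
    then obtain m n where mn: "m \<in> M" "n \<in> N" "y = m \<otimes>\<^bsub>H\<^esub> h (n \<otimes>\<^bsub>G\<^esub> x)"
      by (auto simp: set_mult_def r_coset_def)
    then have "y = (m \<otimes>\<^bsub>H\<^esub> h n) \<otimes>\<^bsub>H\<^esub> h x" using x NM by (simp add: H.m_assoc)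
    moreover have "m \<otimes>\<^bsub>H\<^esub> h n \<in> M" using mn NM by auto
    ultimately show "y \<in> M #>\<^bsub>H\<^esub> h x" by (auto simp: r_coset_def)
  next
    fix y assume "y \<in> M #>\<^bsub>H\<^esub> h x"
    moreover have "h x \<in> h ` (N #>\<^bsub>G\<^esub> x)" using G.rcos_self[OF x N] by blast
    ultimately show "y \<in> M <#>\<^bsub>H\<^esub> h ` (N #>\<^bsub>G\<^esub> x)"
      unfolding set_mult_def r_coset_def by blast
  qed
  then show "x \<in> carrier G \<Longrightarrow> coset_map H M h (N #>\<^bsub>G\<^esub> x) = M #>\<^bsub>H\<^esub> h x" .
  show "coset_map H M h \<in> hom (G Mod N) (H Mod M)"
  proof (rule homI)
    fix c assume "c \<in> carrier (G Mod N)"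
    then show "coset_map H M h c \<in> carrier (H Mod M)"
      by (auto simp: carrier_FactGroup coset)
  next
    fix c d assume "c \<in> carrier (G Mod N)" "d \<in> carrier (G Mod N)"
    then obtain x y where "x \<in> carrier G" "y \<in> carrier G" "c = N #>\<^bsub>G\<^esub> x" "d = N #>\<^bsub>G\<^esub> y"
      by (auto simp: carrier_FactGroup)
    then show "coset_map H M h (c \<otimes>\<^bsub>G Mod N\<^esub> d) = coset_map H M h c \<otimes>\<^bsub>H Mod M\<^esub> coset_map H M h d"
      by (simp add: N.rcos_sum M.rcos_sum coset)
  qed
qed

section \<open>Homomorphisms determined by their values on generators\<close>

lemma hom_pointwise_mult:
  assumes "comm_group H" and "f \<in> hom G H" and "g \<in> hom G H"
  shows "(\<lambda>x. f x \<otimes>\<^bsub>H\<^esub> g x) \<in> hom G H"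
proof -
  interpret H: comm_group H by fact
  show ?thesis
    using assms(2,3) by (auto simp: hom_def Pi_def H.m_ac)
qed

lemma hom_eq_free:
  assumes H: "group H" and f: "f \<in> hom (free_Abelian_group S) H" and g: "g \<in> hom (free_Abelian_group S) H"
    and eq: "\<And>s. s \<in> S \<Longrightarrow> f (frag_of s) = g (frag_of s)"
    and x: "x \<in> carrier (free_Abelian_group S)"
  shows "f x = g x"
proof -
  interpret f: group_hom "free_Abelian_group S" H f using H f by (simp add: group_hom_def group_hom_axioms_def)
  interpret g: group_hom "free_Abelian_group S" H g using H g by (simp add: group_hom_def group_hom_axioms_def)
  have diff: "f (p - q) = f p \<otimes>\<^bsub>H\<^esub> inv\<^bsub>H\<^esub> f q" "g (p - q) = g p \<otimes>\<^bsub>H\<^esub> inv\<^bsub>H\<^esub> g q"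
    if "Poly_Mapping.keys p \<subseteq> S" "Poly_Mapping.keys q \<subseteq> S" for p q
    using that f.hom_mult[of p "- q"] f.hom_inv[of q] g.hom_mult[of p "- q"] g.hom_inv[of q] by simp_all
  show ?thesis
  proof (rule free_Abelian_group_induct[where P = "\<lambda>x. f x = g x"])
    show "Poly_Mapping.keys x \<subseteq> S" using x by simp
    show "f 0 = g 0" using f.hom_one g.hom_one by simp
  qed (simp_all add: diff eq)
qed

lemma frag_extend_hom:
  assumes "\<And>s. s \<in> S \<Longrightarrow> f s \<in> carrier (free_Abelian_group S')"
  shows "frag_extend f \<in> hom (free_Abelian_group S) (free_Abelian_group S')"
  using assms keys_frag_extend[of f]
  by (intro homI) (fastforce simp: frag_extend_add)+

text \<open>The comparison is made after composing with the projection. The premise hands over these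
  composites as homomorphisms on \<open>G\<close>, ready for an argument on generators of
  \<open>G\<close>.\<close>

lemma hom_eq_Mod:
  assumes "comm_group G" and "subgroup N G" and "\<phi> \<in> hom (G Mod N) H" and "\<psi> \<in> hom (G Mod N) H"
    and "\<And>f g. \<lbrakk>f \<in> hom G H; g \<in> hom G H; f = (\<lambda>x. \<phi> (N #>\<^bsub>G\<^esub> x)); g = (\<lambda>x. \<psi> (N #>\<^bsub>G\<^esub> x))\<rbrakk>
      \<Longrightarrow> \<forall>x \<in> carrier G. f x = g x"
    and c: "c \<in> carrier (G Mod N)"
  shows "\<phi> c = \<psi> c"
proof -
  interpret N: normal N G using assms by (intro comm_group.subgroup_imp_normal)
  have "(\<lambda>x. \<phi> (N #>\<^bsub>G\<^esub> x)) \<in> hom G H" "(\<lambda>x. \<psi> (N #>\<^bsub>G\<^esub> x)) \<in> hom G H"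
    using Group.hom_compose[OF N.r_coset_hom_Mod assms(3)] Group.hom_compose[OF N.r_coset_hom_Mod assms(4)]
    by (simp_all add: comp_def)
  then have "\<forall>x \<in> carrier G. \<phi> (N #>\<^bsub>G\<^esub> x) = \<psi> (N #>\<^bsub>G\<^esub> x)" using assms(5) by blast
  then show ?thesis using c by (auto simp: carrier_FactGroup)
qed

lemma hom_generate_subset:
  assumes "group G" "group H" "h \<in> hom G H" "A \<subseteq> carrier G" "subgroup M H" "h ` A \<subseteq> M"
  shows "h ` generate G A \<subseteq> M"
proof -
  interpret h: group_hom G H h using assms by (simp add: group_hom_def group_hom_axioms_def)
  show ?thesis
    using h.generate_img[OF assms(4)] h.H.generate_subgroup_incl[OF assms(6,5)] by simp
qed

definition tensor_group :: "('g, 'z) monoid_scheme \<Rightarrow> ('g \<times> complex \<Rightarrow>\<^sub>0 int) set monoid" where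
  "tensor_group G = tensor_free G Mod tensor_relations G"

definition tensor :: "('g, 'z) monoid_scheme \<Rightarrow> 'g \<Rightarrow> complex \<Rightarrow> ('g \<times> complex \<Rightarrow>\<^sub>0 int) set" where
  "tensor G x a = tensor_relations G #>\<^bsub>tensor_free G\<^esub> frag_of (x, a)"

lemma carrier_complexification: "carrier (complexification G) = carrier (tensor_group G)"
  and zero_complexification: "\<zero>\<^bsub>complexification G\<^esub> = \<one>\<^bsub>tensor_group G\<^esub>"
  and smult_complexification: "module.smult (complexification G) a =
    coset_map (tensor_free G) (tensor_relations G) (frag_extend (\<lambda>(x, b). frag_of (x, a * b)))"
  by (simp_all add: complexification_def tensor_group_def)

section \<open>The complexification of an abelian group as a vector space\<close>

context comm_group
begin

lemma tensor_free_comm: "comm_group (tensor_free G)"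
  by (simp add: tensor_free_def abelian_free_Abelian_group)

lemma frag_of_tensor_free: "frag_of (x, a) \<in> carrier (tensor_free G) \<longleftrightarrow> x \<in> carrier G"
  by (simp add: tensor_free_def)

abbreviation tensor_generators where
  "tensor_generators \<equiv> {frag_of (x \<otimes> y, a) - frag_of (x, a) - frag_of (y, a) | x y a.
         x \<in> carrier G \<and> y \<in> carrier G} \<union>
      {frag_of (x, a + b) - frag_of (x, a) - frag_of (x, b) | x a b. x \<in> carrier G}"

lemma frag_diff_closed:
  assumes "p \<in> carrier (tensor_free G)" "q \<in> carrier (tensor_free G)" "r \<in> carrier (tensor_free G)"
  shows "p - q - r \<in> carrier (tensor_free G)"
  using assms keys_diff[of "p - q" r] keys_diff[of p q]
  unfolding tensor_free_def carrier_free_Abelian_group_iff by blast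

lemma tensor_generators_closed: "tensor_generators \<subseteq> carrier (tensor_free G)"
  by (auto intro!: frag_diff_closed simp del: carrier_free_Abelian_group_iff simp: frag_of_tensor_free)

lemma tensor_relations_subgroup: "subgroup (tensor_relations G) (tensor_free G)"
  unfolding tensor_relations_def
  by (intro group.generate_is_subgroup comm_group.axioms(2) tensor_free_comm tensor_generators_closed)

lemma tensor_relation_left: "\<lbrakk>x \<in> carrier G; y \<in> carrier G\<rbrakk>
    \<Longrightarrow> frag_of (x \<otimes> y, a) - frag_of (x, a) - frag_of (y, a) \<in> tensor_relations G"
  and tensor_relation_right: "x \<in> carrier G
    \<Longrightarrow> frag_of (x, a + b) - frag_of (x, a) - frag_of (x, b) \<in> tensor_relations G"
  unfolding tensor_relations_def by (rule generate.incl, blast)+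

lemma tensor_group_comm: "comm_group (tensor_group G)"
  unfolding tensor_group_def
  by (intro comm_group.abelian_FactGroup tensor_free_comm tensor_relations_subgroup)

lemma tensor_closed: "x \<in> carrier G \<Longrightarrow> tensor G x a \<in> carrier (tensor_group G)"
  by (auto simp: tensor_group_def tensor_def carrier_FactGroup frag_of_tensor_free)

text \<open>Both families of relations have the shape \<open>p - q - r\<close>, so this gives
  additivity in either factor.\<close>

lemma tensor_coset_eq:
  assumes "p \<in> carrier (tensor_free G)" "q \<in> carrier (tensor_free G)" "r \<in> carrier (tensor_free G)"
    and "p - q - r \<in> tensor_relations G"
  shows "tensor_relations G #>\<^bsub>tensor_free G\<^esub> p = (tensor_relations G #>\<^bsub>tensor_free G\<^esub> q)
      \<otimes>\<^bsub>tensor_group G\<^esub> (tensor_relations G #>\<^bsub>tensor_free G\<^esub> r)"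
proof -
  interpret F: comm_group "tensor_free G" by (rule tensor_free_comm)
  interpret N: normal "tensor_relations G" "tensor_free G"
    by (rule F.subgroup_imp_normal[OF tensor_relations_subgroup])
  have qr: "q \<otimes>\<^bsub>tensor_free G\<^esub> r \<in> carrier (tensor_free G)" using assms by blast
  have "p = (p - q - r) \<otimes>\<^bsub>tensor_free G\<^esub> (q \<otimes>\<^bsub>tensor_free G\<^esub> r)"
    by (simp add: tensor_free_def)
  then have "p \<in> tensor_relations G #>\<^bsub>tensor_free G\<^esub> (q \<otimes>\<^bsub>tensor_free G\<^esub> r)"
    using assms(4) unfolding r_coset_def by blast
  then have "tensor_relations G #>\<^bsub>tensor_free G\<^esub> p = tensor_relations G #>\<^bsub>tensor_free G\<^esub> (q \<otimes>\<^bsub>tensor_free G\<^esub> r)"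
    using F.repr_independence[OF _ qr tensor_relations_subgroup] by blast
  then show ?thesis using N.rcos_sum[OF assms(2,3)] by (simp add: tensor_group_def)
qed

lemma tensor_mult_left:
  assumes "x \<in> carrier G" "y \<in> carrier G"
  shows "tensor G (x \<otimes> y) a = tensor G x a \<otimes>\<^bsub>tensor_group G\<^esub> tensor G y a"
  unfolding tensor_def
  by (intro tensor_coset_eq) (use assms tensor_relation_left tensor_relation_right in \<open>auto simp: frag_of_tensor_free\<close>)

lemma tensor_add_right:
  assumes "x \<in> carrier G"
  shows "tensor G x (a + b) = tensor G x a \<otimes>\<^bsub>tensor_group G\<^esub> tensor G x b"
  unfolding tensor_def
  by (intro tensor_coset_eq) (use assms tensor_relation_left tensor_relation_right in \<open>auto simp: frag_of_tensor_free\<close>)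

lemma tensor_hom: "(\<lambda>x. tensor G x a) \<in> hom G (tensor_group G)"
  by (intro homI tensor_closed tensor_mult_left)

lemma tensor_one: "tensor G \<one> a = \<one>\<^bsub>tensor_group G\<^esub>"
  using hom_one[OF tensor_hom is_group comm_group.axioms(2)[OF tensor_group_comm]] .

lemma tensor_zero: "x \<in> carrier G \<Longrightarrow> tensor G x 0 = \<one>\<^bsub>tensor_group G\<^esub>"
proof -
  assume x: "x \<in> carrier G"
  interpret V: comm_group "tensor_group G" by (rule tensor_group_comm)
  have "tensor G x 0 = tensor G x 0 \<otimes>\<^bsub>tensor_group G\<^esub> tensor G x 0"
    using tensor_add_right[OF x, of 0 0] by simp
  then show ?thesis using V.l_cancel_one'[OF tensor_closed[OF x] tensor_closed[OF x]] by metis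
qed

lemma tensor_int_pow:
  assumes x: "x \<in> carrier G"
  shows "tensor G x a [^]\<^bsub>tensor_group G\<^esub> (n :: int) = tensor G x (of_int n * a)"
proof -
  interpret V: comm_group "tensor_group G" by (rule tensor_group_comm)
  note c = tensor_closed[OF x]
  have nat: "tensor G x a [^]\<^bsub>tensor_group G\<^esub> k = tensor G x (of_nat k * a)" for k :: nat
    by (induction k) (simp_all add: tensor_zero x tensor_add_right ring_distribs V.m_comm c)
  have "tensor G x (- b) = inv\<^bsub>tensor_group G\<^esub> tensor G x b" for b
    using tensor_add_right[OF x, of "- b" b] tensor_zero[OF x] c
    by (intro V.inv_equality[symmetric]) auto
  then show ?thesis
    by (cases n rule: int_cases2) (simp_all add: int_pow_int V.int_pow_neg_int c nat)
qed

text \<open>The principle by which the vector space laws and the identities between induced maps are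
  reduced to pure tensors.\<close>

lemma hom_eq_tensor:
  assumes H: "group H" and f: "f \<in> hom (tensor_group G) H" and g: "g \<in> hom (tensor_group G) H"
    and eq: "\<And>x a. x \<in> carrier G \<Longrightarrow> f (tensor G x a) = g (tensor G x a)"
    and v: "v \<in> carrier (tensor_group G)"
  shows "f v = g v"
proof (rule hom_eq_Mod[OF tensor_free_comm tensor_relations_subgroup])
  show "f \<in> hom (tensor_free G Mod tensor_relations G) H" "g \<in> hom (tensor_free G Mod tensor_relations G) H"
    "v \<in> carrier (tensor_free G Mod tensor_relations G)"
    using f g v by (simp_all add: tensor_group_def)
  fix f' g' assume *: "f' \<in> hom (tensor_free G) H" "g' \<in> hom (tensor_free G) H"
    "f' = (\<lambda>x. f (tensor_relations G #>\<^bsub>tensor_free G\<^esub> x))"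
    "g' = (\<lambda>x. g (tensor_relations G #>\<^bsub>tensor_free G\<^esub> x))"
  show "\<forall>x\<in>carrier (tensor_free G). f' x = g' x"
  proof
    fix x assume "x \<in> carrier (tensor_free G)"
    then show "f' x = g' x"
      using hom_eq_free[OF H, of f' "carrier G \<times> UNIV" g' x] *(1,2) eq
      by (auto simp: tensor_free_def *(3,4) simp flip: tensor_def)
         (auto simp: tensor_def tensor_free_def)
  qed
qed

lemma complexification_map_tensor:
  assumes H: "comm_group H" and f: "f \<in> hom G H"
  shows complexification_map_hom: "complexification_map H f \<in> hom (tensor_group G) (tensor_group H)"
    and "x \<in> carrier G \<Longrightarrow> complexification_map H f (tensor G x a) = tensor H (f x) a"
proof -
  interpret H: comm_group H by fact
  interpret f: group_hom G H f using f by unfold_locales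
  let ?h = "frag_extend (\<lambda>(x, b). frag_of (f x, b)) :: ('a \<times> complex \<Rightarrow>\<^sub>0 int) \<Rightarrow> _"
  have h: "?h \<in> hom (tensor_free G) (tensor_free H)"
    unfolding tensor_free_def by (rule frag_extend_hom) auto
  have rel: "?h ` tensor_relations G \<subseteq> tensor_relations H"
    unfolding tensor_relations_def[of G]
  proof (rule hom_generate_subset[OF _ _ h tensor_generators_closed H.tensor_relations_subgroup])
    show "?h ` tensor_generators \<subseteq> tensor_relations H"
      by (auto simp: frag_extend_diff frag_extend_of H.tensor_relation_left H.tensor_relation_right)
  qed (use tensor_free_comm H.tensor_free_comm in \<open>auto intro: comm_group.axioms(2)\<close>)
  note cm = coset_map[OF tensor_free_comm H.tensor_free_comm tensor_relations_subgroup
      H.tensor_relations_subgroup h rel]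
  show "complexification_map H f \<in> hom (tensor_group G) (tensor_group H)"
    unfolding complexification_map_def tensor_group_def by (rule cm(1))
  show "x \<in> carrier G \<Longrightarrow> complexification_map H f (tensor G x a) = tensor H (f x) a"
    unfolding complexification_map_def tensor_def
    using cm(2)[of "frag_of (x, a)"] by (simp add: frag_of_tensor_free frag_extend_of)
qed

lemma smult_tensor:
  shows smult_hom: "module.smult (complexification G) c \<in> hom (tensor_group G) (tensor_group G)"
    and "x \<in> carrier G \<Longrightarrow> c \<odot>\<^bsub>complexification G\<^esub> tensor G x a = tensor G x (c * a)"
proof -
  let ?h = "frag_extend (\<lambda>(x, b). frag_of (x, c * b)) :: ('a \<times> complex \<Rightarrow>\<^sub>0 int) \<Rightarrow> _"
  have h: "?h \<in> hom (tensor_free G) (tensor_free G)"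
    unfolding tensor_free_def by (rule frag_extend_hom) auto
  have rel: "?h ` tensor_relations G \<subseteq> tensor_relations G"
  proof -
    have "?h ` tensor_generators \<subseteq> tensor_relations G"
      by (auto simp: frag_extend_diff frag_extend_of ring_distribs tensor_relation_left
          tensor_relation_right)
    then show ?thesis
      using hom_generate_subset[OF _ _ h tensor_generators_closed tensor_relations_subgroup]
        comm_group.axioms(2)[OF tensor_free_comm]
      unfolding tensor_relations_def[of G] by blast
  qed
  note cm = coset_map[OF tensor_free_comm tensor_free_comm tensor_relations_subgroup
      tensor_relations_subgroup h rel]
  show "module.smult (complexification G) c \<in> hom (tensor_group G) (tensor_group G)"
    unfolding smult_complexification tensor_group_def by (rule cm(1))
  show "x \<in> carrier G \<Longrightarrow> c \<odot>\<^bsub>complexification G\<^esub> tensor G x a = tensor G x (c * a)"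
    unfolding smult_complexification tensor_def
    using cm(2)[of "frag_of (x, a)"] by (simp add: frag_of_tensor_free frag_extend_of)
qed

lemma smult_closed: "v \<in> carrier (tensor_group G) \<Longrightarrow> c \<odot>\<^bsub>complexification G\<^esub> v \<in> carrier (tensor_group G)"
  using smult_hom by (rule hom_in_carrier)

lemma smult_zero: "c \<odot>\<^bsub>complexification G\<^esub> \<one>\<^bsub>tensor_group G\<^esub> = \<one>\<^bsub>tensor_group G\<^esub>"
  using smult_hom tensor_group_comm by (intro hom_one) (auto intro: comm_group.axioms(2))

lemma
  assumes v: "v \<in> carrier (tensor_group G)"
  shows zero_smult: "0 \<odot>\<^bsub>complexification G\<^esub> v = \<one>\<^bsub>tensor_group G\<^esub>"
    and one_smult: "1 \<odot>\<^bsub>complexification G\<^esub> v = v"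
    and smult_smult: "a \<odot>\<^bsub>complexification G\<^esub> (b \<odot>\<^bsub>complexification G\<^esub> v) = (a * b) \<odot>\<^bsub>complexification G\<^esub> v"
    and add_smult: "(a + b) \<odot>\<^bsub>complexification G\<^esub> v
      = (a \<odot>\<^bsub>complexification G\<^esub> v) \<otimes>\<^bsub>tensor_group G\<^esub> (b \<odot>\<^bsub>complexification G\<^esub> v)"
    and int_pow_smult: "v [^]\<^bsub>tensor_group G\<^esub> (n :: int) = of_int n \<odot>\<^bsub>complexification G\<^esub> v"
proof -
  interpret V: comm_group "tensor_group G" by (rule tensor_group_comm)
  have V: "group (tensor_group G)" by (rule V.is_group)
  show "0 \<odot>\<^bsub>complexification G\<^esub> v = \<one>\<^bsub>tensor_group G\<^esub>"
    by (rule hom_eq_tensor[OF V smult_hom _ _ v]) (auto simp: smult_tensor tensor_zero hom_def)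
  show "1 \<odot>\<^bsub>complexification G\<^esub> v = v"
    by (rule hom_eq_tensor[OF V smult_hom _ _ v]) (auto simp: smult_tensor hom_def)
  show "a \<odot>\<^bsub>complexification G\<^esub> (b \<odot>\<^bsub>complexification G\<^esub> v) = (a * b) \<odot>\<^bsub>complexification G\<^esub> v"
    by (rule hom_eq_tensor[OF V Group.hom_compose[OF smult_hom smult_hom, unfolded comp_def] smult_hom _ v])
      (auto simp: smult_tensor mult.assoc)
  show "(a + b) \<odot>\<^bsub>complexification G\<^esub> v
      = (a \<odot>\<^bsub>complexification G\<^esub> v) \<otimes>\<^bsub>tensor_group G\<^esub> (b \<odot>\<^bsub>complexification G\<^esub> v)"
    by (rule hom_eq_tensor[OF V smult_hom hom_pointwise_mult[OF tensor_group_comm smult_hom smult_hom] _ v])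
      (auto simp: smult_tensor ring_distribs tensor_add_right)
  show "v [^]\<^bsub>tensor_group G\<^esub> n = of_int n \<odot>\<^bsub>complexification G\<^esub> v"
    by (rule hom_eq_tensor[OF V _ smult_hom _ v])
      (auto simp: smult_tensor tensor_int_pow hom_def V.int_pow_distrib)
qed

lemma complexification_map_smult:
  assumes H: "comm_group H" and f: "f \<in> hom G H" and v: "v \<in> carrier (tensor_group G)"
  shows "complexification_map H f (c \<odot>\<^bsub>complexification G\<^esub> v)
    = c \<odot>\<^bsub>complexification H\<^esub> complexification_map H f v"
proof -
  interpret H: comm_group H by fact
  have V: "group (tensor_group H)" using H.tensor_group_comm by (rule comm_group.axioms(2))
  show ?thesis
    using f by (intro hom_eq_tensor[OF V Group.hom_compose[OF smult_hom complexification_map_hom[OF H f], unfolded comp_def]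
        Group.hom_compose[OF complexification_map_hom[OF H f] H.smult_hom, unfolded comp_def] _ v])
      (auto simp: smult_tensor H.smult_tensor complexification_map_tensor[OF H f] dest: hom_in_carrier)
qed

end

section \<open>Eigenvalues\<close>

text \<open>The integral polynomial with coefficients \<open>cs\<close>, constant term first,
  evaluated at \<open>f\<close> and applied to \<open>x\<close>, for a group written
  multiplicatively.\<close>

primrec poly_act :: "('g, 'z) monoid_scheme \<Rightarrow> ('g \<Rightarrow> 'g) \<Rightarrow> int list \<Rightarrow> 'g \<Rightarrow> 'g" where
  "poly_act G f [] x = \<one>\<^bsub>G\<^esub>"
| "poly_act G f (c # cs) x = x [^]\<^bsub>G\<^esub> c \<otimes>\<^bsub>G\<^esub> poly_act G f cs (f x)"

definition independent :: "('g, 'z) monoid_scheme \<Rightarrow> 'g set \<Rightarrow> bool" where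
  "independent G B \<longleftrightarrow> finite B \<and> B \<subseteq> carrier G \<and>
    (\<forall>c :: 'g \<Rightarrow> int. finprod G (\<lambda>b. b [^]\<^bsub>G\<^esub> c b) B = \<one>\<^bsub>G\<^esub> \<longrightarrow> (\<forall>b \<in> B. c b = 0))"

lemma has_finite_rank_iff: "has_finite_rank G \<longleftrightarrow> (\<exists>r. \<forall>B. independent G B \<longrightarrow> card B \<le> r)"
  by (simp add: has_finite_rank_def independent_def)

section \<open>Integral polynomials in an endomorphism and finiteness of the spectrum\<close>

context comm_group
begin

context
  fixes f assumes f: "f \<in> hom G G"
begin

lemma iterate_hom: "(f ^^ n) \<in> hom G G"
proof (induction n)
  case 0 show ?case by (simp add: hom_def id_def)
next
  case (Suc n) then show ?case using Group.hom_compose[OF Suc f] by (simp only: funpow.simps)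
qed

lemma poly_act_hom: "poly_act G f cs \<in> hom G G"
proof (induction cs)
  case Nil
  have "(\<lambda>x. \<one>) \<in> hom G G" by (simp add: hom_def)
  then show ?case by (simp add: fun_eq_iff[of "poly_act G f []"] cong: hom_def)
next
  case (Cons c cs)
  have "(\<lambda>x. x [^] c \<otimes> poly_act G f cs (f x)) \<in> hom G G"
    using hom_pointwise_mult[OF comm_group_axioms, of "\<lambda>x. x [^] c" G "poly_act G f cs \<circ> f"]
      Group.hom_compose[OF f Cons] by (simp add: hom_def int_pow_distrib)
  then show ?case by (simp add: fun_eq_iff[of "poly_act G f (c # cs)"] cong: hom_def)
qed

lemma poly_act_closed: "x \<in> carrier G \<Longrightarrow> poly_act G f cs x \<in> carrier G"
  using poly_act_hom by (rule hom_in_carrier)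

lemma iterate_closed: "x \<in> carrier G \<Longrightarrow> (f ^^ n) x \<in> carrier G"
  using iterate_hom by (rule hom_in_carrier)

lemma poly_act_append: "x \<in> carrier G \<Longrightarrow>
    poly_act G f (cs @ ds) x = poly_act G f cs x \<otimes> poly_act G f ds ((f ^^ length cs) x)"
proof (induction cs arbitrary: x)
  case (Cons c cs)
  then have fx: "f x \<in> carrier G" using f hom_in_carrier by metis
  then show ?case
    using Cons poly_act_closed iterate_closed by (simp add: funpow_swap1 m_assoc)
qed (simp add: poly_act_closed)

lemma poly_act_replicate: "x \<in> carrier G \<Longrightarrow> poly_act G f (replicate n 0) x = \<one>"
proof (induction n arbitrary: x)
  case (Suc n)
  then show ?case using f hom_in_carrier by (metis int_pow_0 poly_act.simps(2) replicate_Suc l_one one_closed)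
qed simp

lemma poly_act_map: "x \<in> carrier G \<Longrightarrow>
    poly_act G f (map c [0..<n]) x = finprod G (\<lambda>k. (f ^^ k) x [^] c k) {..<n}"
proof (induction n)
  case (Suc n)
  have "poly_act G f (map c [0..<Suc n]) x = poly_act G f (map c [0..<n]) x \<otimes> (f ^^ n) x [^] c n"
    using Suc.prems poly_act_append[of x "map c [0..<n]" "[c n]"] iterate_closed by simp
  also have "\<dots> = finprod G (\<lambda>k. (f ^^ k) x [^] c k) {..<Suc n}"
    using Suc iterate_closed by (simp add: lessThan_Suc m_comm)
  finally show ?case .
qed simp

text \<open>The \<open>r + 1\<close> elements \<open>x, f x, ..., f^r x\<close> cannot be both
  distinct and independent; a repetition, like a relation, is a polynomial in \<open>f\<close> that
  kills \<open>x\<close>.\<close>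

lemma annihilating_poly:
  assumes r: "\<forall>B. independent G B \<longrightarrow> card B \<le> r" and x: "x \<in> carrier G"
  obtains cs where "poly_act G f cs x = \<one>" "\<exists>c \<in> set cs. c \<noteq> 0"
proof (cases "inj_on (\<lambda>k. (f ^^ k) x) {..<Suc r}")
  case False
  then obtain i j where ij: "i < j" "(f ^^ i) x = (f ^^ j) x"
    unfolding inj_on_def by (metis linorder_neqE_nat)
  \<comment> \<open>The coefficients of \<open>X^j - X^i\<close>.\<close>
  let ?cs = "replicate i 0 @ (-1) # replicate (j - Suc i) 0 @ [1]"
  let ?y = "(f ^^ i) x"
  have y: "?y \<in> carrier G" "f ?y \<in> carrier G"
    using iterate_closed[OF x, of i] iterate_closed[OF x, of "Suc i"] by simp_all
  have "(f ^^ (j - Suc i)) (f ?y) = (f ^^ (j - Suc i + Suc i)) x"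
    by (simp only: funpow_add) simp
  then have yj: "(f ^^ (j - Suc i)) (f ?y) = ?y" using ij by simp
  have "poly_act G f ?cs x = poly_act G f ((-1) # replicate (j - Suc i) 0 @ [1]) ?y"
    using poly_act_append[OF x, of "replicate i 0"] poly_act_replicate[OF x]
      poly_act_closed[OF y(1)] by simp
  also have "\<dots> = ?y [^] (-1 :: int) \<otimes> ?y"
    using poly_act_append[OF y(2), of "replicate (j - Suc i) 0" "[1]"] poly_act_replicate[OF y(2)] y yj
    by simp
  also have "\<dots> = \<one>" using y int_pow_mult[of ?y "-1" 1] by simp
  finally show ?thesis using that[of ?cs] by simp
next
  case True
  let ?B = "(\<lambda>k. (f ^^ k) x) ` {..<Suc r}"
  have "card ?B = Suc r" using True by (simp add: card_image)
  then have "\<not> independent G ?B" using r by (metis not_less_eq_eq order_refl)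
  then obtain c where c: "finprod G (\<lambda>b. b [^] c b) ?B = \<one>" "\<exists>b\<in>?B. c b \<noteq> (0 :: int)"
    unfolding independent_def using iterate_closed[OF x] by auto
  \<comment> \<open>The relation attaches exponents to elements; on the injective orbit they become
    coefficients of powers of \<open>f\<close>.\<close>
  let ?cs = "map (\<lambda>k. c ((f ^^ k) x)) [0..<Suc r]"
  have "finprod G (\<lambda>b. b [^] c b) ?B = finprod G (\<lambda>k. (f ^^ k) x [^] c ((f ^^ k) x)) {..<Suc r}"
    using True iterate_closed[OF x] by (intro finprod_reindex) auto
  then have "poly_act G f ?cs x = \<one>"
    using c(1) poly_act_map[OF x, of "\<lambda>k. c ((f ^^ k) x)" "Suc r"] by simp
  moreover have "\<exists>c \<in> set ?cs. c \<noteq> 0" using c(2) by (auto simp del: upt_Suc)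
  ultimately show ?thesis using that by blast
qed

end

text \<open>With \<open>g\<close> a polynomial in \<open>f\<close> this says that polynomials in
  \<open>f\<close> commute; with \<open>g\<close> a map \<open>x \<mapsto> x \<otimes> a\<close> it
  carries a polynomial over to the complexification.\<close>

lemma poly_act_natural:
  assumes H: "comm_group H" and f: "f \<in> hom G G" and f': "f' \<in> hom H H" and g: "g \<in> hom G H"
    and nat: "\<And>x. x \<in> carrier G \<Longrightarrow> g (f x) = f' (g x)"
  shows "x \<in> carrier G \<Longrightarrow> g (poly_act G f cs x) = poly_act H f' cs (g x)"
proof (induction cs arbitrary: x)
  case Nil
  interpret H: comm_group H by fact
  show ?case using hom_one[OF g is_group H.is_group] by simp
next
  case (Cons c cs)
  interpret H: comm_group H by fact
  interpret g: group_hom G H g using g by unfold_locales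
  have fx: "f x \<in> carrier G" using f Cons.prems by (rule hom_in_carrier)
  then have "poly_act G f cs (f x) \<in> carrier G" using poly_act_closed[OF f] by blast
  then show ?case
    using Cons fx nat g.hom_int_pow[of x c] by simp
qed

text \<open>A product of polynomials, realised as a composite of actions rather than by multiplying
  coefficient lists.\<close>

definition poly_acts where
  "poly_acts f css x = foldr (\<lambda>cs x. poly_act G f cs x) css x"

lemma poly_acts_hom:
  assumes f: "f \<in> hom G G"
  shows "poly_acts f css \<in> hom G G"
proof (induction css)
  case Nil
  then show ?case by (simp add: poly_acts_def[abs_def] hom_def)
next
  case (Cons cs css)
  then show ?case
    using Group.hom_compose[OF Cons poly_act_hom[OF f, of cs]]
    by (simp add: poly_acts_def[abs_def] comp_def)
qed

lemma poly_acts_one: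
  assumes f: "f \<in> hom G G"
  shows "poly_acts f css \<one> = \<one>"
  using poly_acts_hom[OF f] is_group by (intro hom_one)

text \<open>Polynomials in \<open>f\<close> commute, so the factor that kills \<open>x\<close> may
  act first.\<close>

lemma poly_acts_kill:
  assumes f: "f \<in> hom G G" and x: "x \<in> carrier G" and cs: "cs \<in> set css" "poly_act G f cs x = \<one>"
  shows "poly_acts f css x = \<one>"
  using cs(1)
proof (induction css)
  case (Cons ds css)
  have hom: "poly_act G f ds \<in> hom G G" "poly_act G f cs \<in> hom G G" for ds
    by (rule poly_act_hom[OF f])+
  have act1: "poly_act G f ds \<one> = \<one>" for ds using hom(1) is_group by (intro hom_one)
  show ?case
  proof (cases "cs \<in> set css")
    case True
    then show ?thesis using Cons.IH act1 by (simp add: poly_acts_def)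
  next
    case False
    then have ds: "ds = cs" using Cons.prems by simp
    have comm: "poly_act G f cs (f y) = f (poly_act G f cs y)" if "y \<in> carrier G" for y
      using poly_act_natural[OF comm_group_axioms f f f refl that] by simp
    have comm2: "poly_act G f cs (poly_act G f es y) = poly_act G f es (poly_act G f cs y)"
      if "y \<in> carrier G" for es y
      using poly_act_natural[OF comm_group_axioms f f hom(2) comm that] by simp
    have "poly_act G f cs (poly_acts f css y) = poly_acts f css (poly_act G f cs y)"
      if "y \<in> carrier G" for y
      using hom_in_carrier[OF poly_acts_hom[OF f] that]
      by (induction css)
        (auto simp: poly_acts_def comm2 hom_in_carrier[OF poly_acts_hom[OF f, unfolded poly_acts_def[abs_def]] that])
    then show ?thesis
      using ds x cs(2) poly_acts_one[OF f, of css] by (simp add: poly_acts_def)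
  qed
qed simp

lemma finprod_one_of_hom:
  assumes f: "f \<in> hom G G" and "finite B" and "B \<subseteq> carrier G" and "\<And>b. b \<in> B \<Longrightarrow> f b = \<one>"
  shows "f (finprod G (\<lambda>b. b [^] (c b :: int)) B) = \<one>"
  using assms(2-4)
proof (induction rule: finite_induct)
  case empty
  then show ?case using hom_one[OF f is_group is_group] by simp
next
  case (insert b B)
  interpret f: group_hom G G f using f by unfold_locales
  have "finprod G (\<lambda>b. b [^] c b) B \<in> carrier G" using insert by (intro finprod_closed) auto
  moreover have "(\<lambda>b. b [^] c b) \<in> B \<rightarrow> carrier G" using insert by auto
  ultimately show ?case using insert f.hom_int_pow[of b "c b"] by simp
qed

text \<open>The fold is Horner evaluation, parallel to the recursion of
  \<open>poly_act\<close>.\<close>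

lemma eval_nonzero_finite_roots:
  assumes "\<exists>c \<in> set cs. c \<noteq> (0 :: int)"
  shows "finite {\<mu> :: complex. foldr (\<lambda>c y. of_int c + \<mu> * y) cs 0 = 0}"
proof -
  let ?p = "Poly (map of_int cs) :: complex poly"
  have eval: "poly ?p \<mu> = foldr (\<lambda>c y. of_int c + \<mu> * y) cs 0" for \<mu>
    by (induction cs) simp_all
  have "?p \<noteq> 0"
  proof
    assume "?p = 0"
    then obtain n where n: "map of_int cs = replicate n (0 :: complex)" by (auto simp: Poly_eq_0)
    have "complex_of_int c \<in> set (replicate n 0)" if "c \<in> set cs" for c
      using that unfolding n[symmetric] by simp
    then show False using assms by (auto split: if_splits)
  qed
  then show ?thesis using poly_roots_finite[of ?p] by (simp add: eval)
qed

text \<open>The product of annihilating polynomials for the elements of a maximal independent set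
  \<open>B\<close> kills \<open>B\<close>, hence sends every element to torsion, and torsion dies in
  the complexification. The product thus annihilates the induced map, and every eigenvalue is a root
  of one of its nonzero factors.\<close>

lemma finite_eigenvalues:
  assumes rank: "has_finite_rank G" and f: "f \<in> hom G G"
  shows "finite (eigenvalues (complexification G) (complexification_map G f))"
proof -
  interpret V: comm_group "tensor_group G" by (rule tensor_group_comm)
  let ?V = "tensor_group G" and ?\<phi> = "complexification_map G f"
  note \<phi> = complexification_map_tensor[OF comm_group_axioms f]
  obtain r where r: "\<forall>B. independent G B \<longrightarrow> card B \<le> r"
    using rank by (auto simp: has_finite_rank_iff)
  have "independent G {}" by (simp add: independent_def)
  then obtain B where B: "independent G B" "\<And>B'. independent G B' \<Longrightarrow> card B' \<le> card B"
    using ex_has_greatest_nat[of "independent G" "{}" card "Suc r"] r by (metis le_imp_less_Suc)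
  then have finB: "finite B" and BG: "B \<subseteq> carrier G" by (auto simp: independent_def)
  have "\<exists>cs. poly_act G f cs b = \<one> \<and> (\<exists>c \<in> set cs. c \<noteq> 0)" if "b \<in> B" for b
    using annihilating_poly[OF f r, of b] that BG by blast
  then obtain q where q: "\<And>b. b \<in> B \<Longrightarrow> poly_act G f (q b) b = \<one>" "\<And>b. b \<in> B \<Longrightarrow> \<exists>c \<in> set (q b). c \<noteq> 0"
    by metis
  obtain bs where bs: "set bs = B" using finB finite_list by blast
  define css where "css = map q bs"
  have killB: "poly_acts f css b = \<one>" if "b \<in> B" for b
    using poly_acts_kill[OF f, of b "q b" css] that BG q(1) bs by (auto simp: css_def)
  note P = poly_acts_hom[OF f, of css]
  interpret P: group_hom G G "poly_acts f css" using P by unfold_locales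
  \<comment> \<open>Outside \<open>B\<close>, maximality gives a relation involving
    \<open>x\<close>, whose exponent at \<open>x\<close> is nonzero because \<open>B\<close> itself
    is independent; applying the product of polynomials removes the part in
    \<open>B\<close>.\<close>
  have torsion: "\<exists>n. n \<noteq> (0 :: int) \<and> poly_acts f css x [^] n = \<one>" if x: "x \<in> carrier G" for x
  proof (cases "x \<in> B")
    case True
    then show ?thesis using killB by (intro exI[of _ 1]) simp
  next
    case False
    then have "\<not> independent G (insert x B)" using B(2)[of "insert x B"] finB by auto
    then obtain c where c: "finprod G (\<lambda>b. b [^] c b) (insert x B) = \<one>" "\<exists>b\<in>insert x B. c b \<noteq> (0 :: int)"
      unfolding independent_def using finB BG x by auto
    let ?y = "finprod G (\<lambda>b. b [^] c b) B"
    have y: "?y \<in> carrier G" using BG by (intro finprod_closed) auto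
    have "(\<lambda>b. b [^] c b) \<in> B \<rightarrow> carrier G" using BG by auto
    then have xy: "x [^] c x \<otimes> ?y = \<one>" using c(1) finB False x by simp
    have "c x \<noteq> 0"
    proof
      assume "c x = 0"
      then have "?y = \<one>" using xy y by simp
      then have "\<forall>b\<in>B. c b = 0" using B(1) by (simp add: independent_def)
      then show False using c(2) \<open>c x = 0\<close> by simp
    qed
    moreover have "poly_acts f css x [^] c x \<otimes> poly_acts f css ?y = \<one>"
      using xy x y P.hom_mult[of "x [^] c x" ?y] P.hom_int_pow[OF x, of "c x"] by simp
    then have "poly_acts f css x [^] c x = \<one>"
      using finprod_one_of_hom[OF P finB BG killB] x by simp
    ultimately show ?thesis by blast
  qed
  have tens: "foldr (\<lambda>cs x. poly_act ?V ?\<phi> cs x) css (tensor G x a) = tensor G (poly_acts f css x) a"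
    if x: "x \<in> carrier G" for x a
  proof (induction css)
    case (Cons cs css)
    have "tensor G (poly_act G f cs (poly_acts f css x)) a
        = poly_act ?V ?\<phi> cs (tensor G (poly_acts f css x) a)"
      using hom_in_carrier[OF poly_acts_hom[OF f] x]
      by (intro poly_act_natural[OF V.comm_group_axioms f \<phi>(1) tensor_hom]) (simp_all add: \<phi>(2))
    then show ?case using Cons by (simp add: poly_acts_def)
  qed (simp add: poly_acts_def)
  \<comment> \<open>Divisibility of the complex numbers: \<open>y \<otimes> a\<close> is
    \<open>y^n \<otimes> (a / n)\<close>, which is trivial once \<open>y^n\<close> is.\<close>
  have "tensor G (poly_acts f css x) a = \<one>\<^bsub>?V\<^esub>" if x: "x \<in> carrier G" for x a
  proof -
    obtain n :: int where n: "n \<noteq> 0" "poly_acts f css x [^] n = \<one>" using torsion[OF x] by blast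
    interpret t: group_hom G ?V "\<lambda>x. tensor G x (a / of_int n)" using tensor_hom by unfold_locales
    have Px: "poly_acts f css x \<in> carrier G" using x by simp
    have "tensor G (poly_acts f css x) a = tensor G (poly_acts f css x) (a / of_int n) [^]\<^bsub>?V\<^esub> n"
      using n(1) by (simp add: tensor_int_pow[OF Px])
    also have "\<dots> = tensor G (poly_acts f css x [^] n) (a / of_int n)"
      using t.hom_int_pow[OF Px, of n] by simp
    finally show ?thesis using n(2) tensor_one by simp
  qed
  then have gens: "V.poly_acts ?\<phi> css (tensor G x a) = \<one>\<^bsub>?V\<^esub>" if "x \<in> carrier G" for x a
    using that tens by (simp add: V.poly_acts_def)
  have triv: "(\<lambda>_. \<one>\<^bsub>?V\<^esub>) \<in> hom ?V ?V" by (simp add: hom_def)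
  have kill: "V.poly_acts ?\<phi> css v = \<one>\<^bsub>?V\<^esub>" if "v \<in> carrier ?V" for v
    by (rule hom_eq_tensor[OF V.is_group V.poly_acts_hom[OF \<phi>(1)] triv gens that])
  let ?ev = "\<lambda>\<mu> cs. foldr (\<lambda>c y. of_int c + \<mu> * y) cs (0 :: complex)"
  \<comment> \<open>On an eigenvector for \<open>\<mu>\<close>, a polynomial in the map acts as
    multiplication by its value at \<open>\<mu>\<close>.\<close>
  have eig: "poly_act ?V ?\<phi> cs v = ?ev \<mu> cs \<odot>\<^bsub>complexification G\<^esub> v"
    if "v \<in> carrier ?V" "?\<phi> v = \<mu> \<odot>\<^bsub>complexification G\<^esub> v" for v \<mu> cs
    using that
  proof (induction cs arbitrary: v)
    case (Cons c cs)
    let ?w = "\<mu> \<odot>\<^bsub>complexification G\<^esub> v"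
    have w: "?w \<in> carrier ?V" using Cons.prems(1) by (rule smult_closed)
    have "?\<phi> ?w = \<mu> \<odot>\<^bsub>complexification G\<^esub> ?w"
      using complexification_map_smult[OF comm_group_axioms f Cons.prems(1)] Cons.prems(2) by simp
    with Cons w show ?case
      by (simp add: int_pow_smult smult_smult add_smult mult.commute)
  qed (simp add: zero_smult)
  have "eigenvalues (complexification G) ?\<phi> \<subseteq> (\<Union>cs \<in> set css. {\<mu>. ?ev \<mu> cs = 0})"
  proof
    fix \<mu> assume "\<mu> \<in> eigenvalues (complexification G) ?\<phi>"
    then obtain v where v: "v \<in> carrier ?V" "v \<noteq> \<one>\<^bsub>?V\<^esub>" "?\<phi> v = \<mu> \<odot>\<^bsub>complexification G\<^esub> v"
      by (auto simp: eigenvalues_def carrier_complexification zero_complexification)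
    have scal: "?\<phi> (c \<odot>\<^bsub>complexification G\<^esub> v) = \<mu> \<odot>\<^bsub>complexification G\<^esub> (c \<odot>\<^bsub>complexification G\<^esub> v)" for c
      using complexification_map_smult[OF comm_group_axioms f v(1)] v
      by (simp add: smult_smult mult.commute)
    have "V.poly_acts ?\<phi> ds v = (\<Prod>cs\<leftarrow>ds. ?ev \<mu> cs) \<odot>\<^bsub>complexification G\<^esub> v" for ds
    proof (induction ds)
      case (Cons cs ds)
      then show ?case
        using eig[OF smult_closed[OF v(1)] scal] v(1)
        by (simp add: V.poly_acts_def smult_smult)
    qed (simp add: V.poly_acts_def one_smult v(1))
    then have z: "(\<Prod>cs\<leftarrow>css. ?ev \<mu> cs) \<odot>\<^bsub>complexification G\<^esub> v = \<one>\<^bsub>?V\<^esub>" using kill[OF v(1)] by metis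
    have "(\<Prod>cs\<leftarrow>css. ?ev \<mu> cs) = 0"
    proof (rule ccontr)
      let ?a = "\<Prod>cs\<leftarrow>css. ?ev \<mu> cs"
      assume "?a \<noteq> 0"
      then have "v = (1 / ?a) \<odot>\<^bsub>complexification G\<^esub> (?a \<odot>\<^bsub>complexification G\<^esub> v)"
        using v(1) by (simp add: smult_smult one_smult)
      then show False using z smult_zero v(2) by simp
    qed
    then show "\<mu> \<in> (\<Union>cs \<in> set css. {\<mu>. ?ev \<mu> cs = 0})"
      by (auto simp: prod_list_zero_iff)
  qed
  moreover have "finite (\<Union>cs \<in> set css. {\<mu>. ?ev \<mu> cs = 0})"
    using q(2) bs by (auto simp: css_def intro!: eval_nonzero_finite_roots)
  ultimately show ?thesis by (rule finite_subset)
qed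

end

section \<open>Dimensions of morphism spaces\<close>

lemma linear_mapI:
  assumes "vectorspace K V" and "vectorspace K W"
    and "\<And>x. x \<in> carrier V \<Longrightarrow> f x \<in> carrier W"
    and "\<And>x y. x \<in> carrier V \<Longrightarrow> y \<in> carrier V \<Longrightarrow> f (x \<oplus>\<^bsub>V\<^esub> y) = f x \<oplus>\<^bsub>W\<^esub> f y"
    and "\<And>a x. a \<in> carrier K \<Longrightarrow> x \<in> carrier V \<Longrightarrow> f (a \<odot>\<^bsub>V\<^esub> x) = a \<odot>\<^bsub>W\<^esub> f x"
  shows "linear_map K V W f"
  using assms by (simp add: linear_map_def mod_hom_def mod_hom_axioms_def module_hom_def vectorspace_def)

lemma linear_map_comp:
  assumes "linear_map K U V f" and "linear_map K V W g"
  shows "linear_map K U W (\<lambda>x. g (f x))"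
proof -
  interpret f: linear_map K U V f by fact
  interpret g: linear_map K V W g by fact
  show ?thesis
    by (rule linear_mapI) (simp_all add: f.V.vectorspace_axioms g.W.vectorspace_axioms)
qed

lemma dim_surj_le:
  assumes "linear_map K V W f" and "vectorspace.fin_dim K V" and "f ` carrier V = carrier W"
  shows "vectorspace.dim K W \<le> vectorspace.dim K V"
proof -
  interpret f: linear_map K V W f by fact
  show ?thesis
    using f.rank_nullity[OF assms(2)] f.surj_imp_imT_carrier[OF assms(3)] by simp
qed

text \<open>The map and its inverse are both linear surjections, so each dimension bounds the
  other.\<close>

lemma dim_bij:
  assumes f: "linear_map K V W f" and fd: "vectorspace.fin_dim K V"
    and bij: "bij_betw f (carrier V) (carrier W)"
  shows "vectorspace.dim K V = vectorspace.dim K W"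
proof (rule antisym)
  interpret f: linear_map K V W f by fact
  have surj: "f ` carrier V = carrier W" using bij by (simp add: bij_betw_def)
  then show "vectorspace.dim K W \<le> vectorspace.dim K V" by (rule dim_surj_le[OF f fd])
  let ?g = "inv_into (carrier V) f"
  have g: "?g y \<in> carrier V" "f (?g y) = y" if "y \<in> carrier W" for y
    using that surj inv_into_into[of y f "carrier V"] f_inv_into_f[of y f "carrier V"] by auto
  have eq: "?g (f x) = x" if "x \<in> carrier V" for x
    using bij that by (simp add: bij_betw_def inv_into_f_f)
  have "linear_map K W V ?g"
  proof (rule linear_mapI[OF f.W.vectorspace_axioms f.V.vectorspace_axioms])
    fix x y assume "x \<in> carrier W" "y \<in> carrier W"
    then have "f (?g x \<oplus>\<^bsub>V\<^esub> ?g y) = x \<oplus>\<^bsub>W\<^esub> y" by (simp add: g)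
    then show "?g (x \<oplus>\<^bsub>W\<^esub> y) = ?g x \<oplus>\<^bsub>V\<^esub> ?g y"
      using eq[of "?g x \<oplus>\<^bsub>V\<^esub> ?g y"] g \<open>x \<in> _\<close> \<open>y \<in> _\<close> by simp
  next
    fix a x assume "a \<in> carrier K" "x \<in> carrier W"
    then have "f (a \<odot>\<^bsub>V\<^esub> ?g x) = a \<odot>\<^bsub>W\<^esub> x" by (simp add: g)
    then show "?g (a \<odot>\<^bsub>W\<^esub> x) = a \<odot>\<^bsub>V\<^esub> ?g x"
      using eq[of "a \<odot>\<^bsub>V\<^esub> ?g x"] g \<open>a \<in> _\<close> \<open>x \<in> _\<close> by simp
  qed (use g in auto)
  moreover have "?g ` carrier W = carrier V"
  proof (intro subset_antisym subsetI)
    fix x assume "x \<in> carrier V"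
    then have "x = ?g (f x)" "f x \<in> carrier W" using eq[of x] by auto
    then show "x \<in> ?g ` carrier W" by (rule image_eqI)
  qed (use g in auto)
  ultimately show "vectorspace.dim K V \<le> vectorspace.dim K W"
    using f.rank_nullity_main(2)[OF fd surj] by (intro dim_surj_le)
qed

text \<open>Rank-nullity for \<open>g\<close>, whose kernel is identified with \<open>U\<close>
  through \<open>j\<close>.\<close>

lemma dim_short_exact:
  assumes j: "linear_map K U V j" and g: "linear_map K V W g"
    and fd: "vectorspace.fin_dim K U" "vectorspace.fin_dim K V"
    and inj: "inj_on j (carrier U)" and surj: "g ` carrier V = carrier W"
    and exact: "j ` carrier U = {x \<in> carrier V. g x = \<zero>\<^bsub>W\<^esub>}"
  shows "vectorspace.dim K V = vectorspace.dim K U + vectorspace.dim K W"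
proof -
  interpret j: linear_map K U V j by fact
  interpret g: linear_map K V W g by fact
  have ker: "g.ker = j ` carrier U" using exact by (simp add: g.ker_def)
  have vs: "vectorspace K (V\<lparr>carrier := g.ker\<rparr>)"
    by (rule j.W.subspace_is_vs[OF g.kerT_is_subspace])
  have "linear_map K U (V\<lparr>carrier := g.ker\<rparr>) j"
    by (rule linear_mapI[OF j.V.vectorspace_axioms vs]) (simp_all add: ker)
  then have "vectorspace.dim K U = vectorspace.dim K (V\<lparr>carrier := g.ker\<rparr>)"
    using inj ker by (intro dim_bij[OF _ fd(1)]) (auto simp: bij_betw_def)
  then show ?thesis
    using g.rank_nullity[OF fd(2)] g.surj_imp_imT_carrier[OF surj] by simp
qed

section \<open>Euler forms\<close>

text \<open>The Euler form as a function of graded dimensions alone, so that a shift of objects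
  becomes a translation of the index.\<close>

definition altsum :: "(int \<Rightarrow> nat) \<Rightarrow> int" where
  "altsum d = (\<Sum>i | d i \<noteq> 0. (if even i then 1 else - 1) * int (d i))"

lemma altsum_superset:
  assumes "finite A" and "{i. d i \<noteq> 0} \<subseteq> A"
  shows "altsum d = (\<Sum>i\<in>A. (if even i then 1 else - 1) * int (d i))"
  unfolding altsum_def using assms by (intro sum.mono_neutral_left) auto

lemma altsum_shift: "altsum (\<lambda>i. d (i + k)) = (if even k then 1 else - 1) * altsum d"
proof -
  have "altsum (\<lambda>i. d (i + k)) = (\<Sum>i | d i \<noteq> 0. (if even (i - k) then 1 else - 1) * int (d i))"
    unfolding altsum_def
    by (rule sum.reindex_bij_witness[where i = "\<lambda>i. i - k" and j = "\<lambda>i. i + k"]) auto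
  also have "\<dots> = (\<Sum>i | d i \<noteq> 0. (if even k then 1 else - 1) * ((if even i then 1 else - 1) * int (d i)))"
    by (intro sum.cong) auto
  finally show ?thesis by (simp add: altsum_def sum_distrib_left)
qed

text \<open>The three sums run over different supports and are compared on the finite union of two
  of them.\<close>

lemma altsum_add:
  assumes "finite {i. d i \<noteq> 0}" and "finite {i. e i \<noteq> 0}"
  shows "altsum (\<lambda>i. d i + e i) = altsum d + altsum e"
proof -
  let ?A = "{i. d i \<noteq> 0} \<union> {i. e i \<noteq> 0}"
  have fin: "finite ?A" using assms by simp
  show ?thesis
    using altsum_superset[OF fin, of d] altsum_superset[OF fin, of e]
      altsum_superset[OF fin, of "\<lambda>i. d i + e i"]
    by (auto simp: sum.distrib[symmetric] ring_distribs intro!: sum.cong)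
qed

section \<open>Dimensions under retracts, equivalences and adjunctions\<close>

context linear_category
begin

abbreviation hdim :: "'o \<Rightarrow> 'o \<Rightarrow> nat" where
  "hdim E F \<equiv> vectorspace.dim K (Hom C E F)"

text \<open>Precomposition with the section \<open>i\<close> is surjective, since
  \<open>g = (g p) i\<close>.\<close>

lemma hdim_retract_left:
  assumes "vectorspace.fin_dim K (Hom C E' F)" and "retract E E'" and F: "F \<in> Ob C"
  shows "hdim E F \<le> hdim E' F"
proof -
  obtain i p where ip: "arr i E E'" "arr p E' E" "cat_comp C E E' E p i = ident C E"
    using assms(2) by (rule retractE)
  have Ob: "E \<in> Ob C" "E' \<in> Ob C" using ip by (auto simp: arr_def)
  let ?f = "\<lambda>g. cat_comp C E E' F g i"
  have lin: "linear_map K (Hom C E' F) (Hom C E F) ?f"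
    using Ob F ip by (intro comp_linear_left) (auto simp: arr_def)
  have "g \<in> ?f ` carrier (Hom C E' F)" if "arr g E F" for g
    using assoc[OF ip(1,2) that] ip(3) comp_id_right[OF that] arr_comp[OF ip(2) that]
    by (auto intro!: image_eqI[of _ _ "cat_comp C E' E F g p"] simp: arr_def)
  then have "?f ` carrier (Hom C E' F) = carrier (Hom C E F)"
    using arr_comp[OF ip(1)] Ob F by (auto simp: arr_def)
  then show ?thesis by (rule dim_surj_le[OF lin assms(1)])
qed

lemma hdim_retract_right:
  assumes "vectorspace.fin_dim K (Hom C E F')" and "retract F F'" and E: "E \<in> Ob C"
  shows "hdim E F \<le> hdim E F'"
proof -
  obtain i p where ip: "arr i F F'" "arr p F' F" "cat_comp C F F' F p i = ident C F"
    using assms(2) by (rule retractE)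
  have Ob: "F \<in> Ob C" "F' \<in> Ob C" using ip by (auto simp: arr_def)
  let ?f = "\<lambda>g. cat_comp C E F' F p g"
  have lin: "linear_map K (Hom C E F') (Hom C E F) ?f"
    using Ob E ip by (intro comp_linear_right) (auto simp: arr_def)
  have "g \<in> ?f ` carrier (Hom C E F')" if "arr g E F" for g
    using assoc[OF that ip(1,2)] ip(3) comp_id_left[OF that] arr_comp[OF that ip(1)]
    by (auto intro!: image_eqI[of _ _ "cat_comp C E F F' i g"] simp: arr_def)
  then have "?f ` carrier (Hom C E F') = carrier (Hom C E F)"
    using arr_comp[OF _ ip(2)] Ob E by (auto simp: arr_def)
  then show ?thesis by (rule dim_surj_le[OF lin assms(1)])
qed

lemma hdim_iso_left:
  assumes "vectorspace.fin_dim K (Hom C E F)" "vectorspace.fin_dim K (Hom C E' F)"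
    and "iso_objects C E E'" and F: "F \<in> Ob C"
  shows "hdim E F = hdim E' F"
  using hdim_retract_left[OF assms(2) iso_objects_retract[OF assms(3)] F]
    hdim_retract_left[OF assms(1) iso_objects_retract[OF iso_objects_sym[OF assms(3)]] F] by simp

lemma hdim_iso_right:
  assumes "vectorspace.fin_dim K (Hom C E F)" "vectorspace.fin_dim K (Hom C E F')"
    and "iso_objects C F F'" and E: "E \<in> Ob C"
  shows "hdim E F = hdim E F'"
  using hdim_retract_right[OF assms(2) iso_objects_retract[OF assms(3)] E]
    hdim_retract_right[OF assms(1) iso_objects_retract[OF iso_objects_sym[OF assms(3)]] E] by simp

end

lemma (in linear_equivalence) hdim_fob:
  assumes "vectorspace.fin_dim K (Hom C X Y)" and X: "X \<in> Ob C" and Y: "Y \<in> Ob C"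
  shows "FG.tgt.hdim (fob F X) (fob F Y) = FG.src.hdim X Y"
proof (rule dim_bij[OF FG.fmor_linear[OF X Y] assms(1), symmetric])
  show "bij_betw (fmor F X Y) (carrier (Hom C X Y)) (carrier (Hom D (fob F X) (fob F Y)))"
    unfolding bij_betw_def
  proof (intro conjI inj_onI subset_antisym subsetI)
    fix f g assume "f \<in> carrier (Hom C X Y)" "g \<in> carrier (Hom C X Y)" "fmor F X Y f = fmor F X Y g"
    then show "f = g" using faithful X Y by (auto simp: FG.src.arr_def)
  next
    fix h assume "h \<in> carrier (Hom D (fob F X) (fob F Y))"
    then have "FG.tgt.arr h (fob F X) (fob F Y)" using X Y FG.fob_closed by (simp add: FG.tgt.arr_def)
    then obtain f where "FG.src.arr f X Y" "fmor F X Y f = h" using full[OF X Y] by blast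
    then show "h \<in> fmor F X Y ` carrier (Hom C X Y)" by (auto simp: FG.src.arr_def)
  next
    fix h assume "h \<in> fmor F X Y ` carrier (Hom C X Y)"
    then show "h \<in> carrier (Hom D (fob F X) (fob F Y))"
      using FG.arr_fmor X Y by (auto simp: FG.src.arr_def FG.tgt.arr_def)
  qed
qed

text \<open>The standard bijection: \<open>f\<close> goes to \<open>R f\<close> after the unit, and
  \<open>g\<close> to the counit after \<open>S g\<close>. The composites are identities by
  naturality and the triangle identities, and linearity of the first map suffices for
  \<open>dim_bij\<close>.\<close>

lemma hdim_adjunction:
  assumes C: "linear_category K C" and D: "linear_category K D"
    and adj: "adjunction K C D S R unit counit"
    and E: "E \<in> Ob C" and F: "F \<in> Ob D" and fd: "vectorspace.fin_dim K (Hom D (fob S E) F)"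
  shows "vectorspace.dim K (Hom D (fob S E) F) = vectorspace.dim K (Hom C E (fob R F))"
proof -
  interpret C: linear_category K C by fact
  interpret D: linear_category K D by fact
  interpret S: linear_functor_between K C D S
    using adj C D by (intro linear_functor_betweenI) (auto simp: adjunction_def)
  interpret R: linear_functor_between K D C R
    using adj C D by (intro linear_functor_betweenI) (auto simp: adjunction_def)
  have unit: "C.arr (unit X) X (fob R (fob S X))" if "X \<in> Ob C" for X
    using adj that R.fob_closed S.fob_closed by (auto simp: adjunction_def nat_trans_def C.arr_def)
  have counit: "D.arr (counit Y) (fob S (fob R Y)) Y" if "Y \<in> Ob D" for Y
    using adj that R.fob_closed S.fob_closed by (auto simp: adjunction_def nat_trans_def D.arr_def)
  have unit_nat: "cat_comp C X Y (fob R (fob S Y)) (unit Y) g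
      = cat_comp C X (fob R (fob S X)) (fob R (fob S Y)) (fmor R (fob S X) (fob S Y) (fmor S X Y g)) (unit X)"
    if "C.arr g X Y" for X Y g
    using adj that by (simp add: adjunction_def nat_trans_def C.arr_def)
  have counit_nat: "cat_comp D (fob S (fob R X)) (fob S (fob R Y)) Y (counit Y) (fmor S (fob R X) (fob R Y) (fmor R X Y f))
      = cat_comp D (fob S (fob R X)) X Y f (counit X)"
    if "D.arr f X Y" for X Y f
    using adj that by (simp add: adjunction_def nat_trans_def D.arr_def)
  have tri1: "cat_comp D (fob S E) (fob S (fob R (fob S E))) (fob S E)
          (counit (fob S E)) (fmor S E (fob R (fob S E)) (unit E)) = ident D (fob S E)"
    using adj E by (simp add: adjunction_def)
  have tri2: "cat_comp C (fob R F) (fob R (fob S (fob R F))) (fob R F)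
          (fmor R (fob S (fob R F)) F (counit F)) (unit (fob R F)) = ident C (fob R F)"
    using adj F by (simp add: adjunction_def)
  have Ob: "fob S E \<in> Ob D" "fob R F \<in> Ob C" "fob R (fob S E) \<in> Ob C" "fob S (fob R F) \<in> Ob D"
    using E F S.fob_closed R.fob_closed by auto
  let ?\<phi> = "\<lambda>f. cat_comp C E (fob R (fob S E)) (fob R F) (fmor R (fob S E) F f) (unit E)"
  let ?\<psi> = "\<lambda>g. cat_comp D (fob S E) (fob S (fob R F)) F (counit F) (fmor S E (fob R F) g)"
  have \<phi>: "C.arr (?\<phi> f) E (fob R F)" if "D.arr f (fob S E) F" for f
    using R.arr_fmor[OF that] unit[OF E] by (rule C.arr_comp[rotated])
  have \<psi>: "D.arr (?\<psi> g) (fob S E) F" if "C.arr g E (fob R F)" for g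
    using S.arr_fmor[OF that] counit[OF F] by (rule D.arr_comp)
  have \<psi>\<phi>: "?\<psi> (?\<phi> f) = f" if f: "D.arr f (fob S E) F" for f
  proof -
    have Rf: "C.arr (fmor R (fob S E) F f) (fob R (fob S E)) (fob R F)" using f by (rule R.arr_fmor)
    have "?\<psi> (?\<phi> f) = cat_comp D (fob S E) (fob S (fob R F)) F (counit F)
        (cat_comp D (fob S E) (fob S (fob R (fob S E))) (fob S (fob R F))
          (fmor S (fob R (fob S E)) (fob R F) (fmor R (fob S E) F f)) (fmor S E (fob R (fob S E)) (unit E)))"
      using S.fmor_cat_comp[OF unit[OF E] Rf] by simp
    also have "\<dots> = cat_comp D (fob S E) (fob S (fob R (fob S E))) F
        (cat_comp D (fob S (fob R (fob S E))) (fob S E) F f (counit (fob S E))) (fmor S E (fob R (fob S E)) (unit E))"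
      using D.assoc[OF S.arr_fmor[OF unit[OF E]] S.arr_fmor[OF Rf] counit[OF F]] counit_nat[OF f] by simp
    also have "\<dots> = f"
      using D.assoc[OF S.arr_fmor[OF unit[OF E]] counit[OF Ob(1)] f] tri1 D.comp_id_right[OF f] by simp
    finally show ?thesis .
  qed
  have \<phi>\<psi>: "?\<phi> (?\<psi> g) = g" if g: "C.arr g E (fob R F)" for g
  proof -
    have Sg: "D.arr (fmor S E (fob R F) g) (fob S E) (fob S (fob R F))" using g by (rule S.arr_fmor)
    have "?\<phi> (?\<psi> g) = cat_comp C E (fob R (fob S E)) (fob R F)
       (cat_comp C (fob R (fob S E)) (fob R (fob S (fob R F))) (fob R F)
          (fmor R (fob S (fob R F)) F (counit F)) (fmor R (fob S E) (fob S (fob R F)) (fmor S E (fob R F) g))) (unit E)"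
      using R.fmor_cat_comp[OF Sg counit[OF F]] by simp
    also have "\<dots> = cat_comp C E (fob R (fob S (fob R F))) (fob R F)
          (fmor R (fob S (fob R F)) F (counit F)) (cat_comp C E (fob R F) (fob R (fob S (fob R F))) (unit (fob R F)) g)"
      using C.assoc[OF unit[OF E] R.arr_fmor[OF Sg] R.arr_fmor[OF counit[OF F]]] unit_nat[OF g] by simp
    also have "\<dots> = g"
      using C.assoc[OF g unit[OF Ob(2)] R.arr_fmor[OF counit[OF F]]] tri2 C.comp_id_left[OF g] by simp
    finally show ?thesis .
  qed
  have lin1: "linear_map K (Hom D (fob S E) F) (Hom C (fob R (fob S E)) (fob R F)) (fmor R (fob S E) F)"
    using Ob(1) F by (rule R.fmor_linear)
  have lin2: "linear_map K (Hom C (fob R (fob S E)) (fob R F)) (Hom C E (fob R F))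
      (\<lambda>g. cat_comp C E (fob R (fob S E)) (fob R F) g (unit E))"
    using E Ob(3,2) unit[OF E] by (intro C.comp_linear_left) (auto simp: C.arr_def)
  have lin: "linear_map K (Hom D (fob S E) F) (Hom C E (fob R F)) ?\<phi>"
    using linear_map_comp[OF lin1 lin2] by simp
  show ?thesis
  proof (rule dim_bij[OF lin fd], rule bij_betw_byWitness[where f' = ?\<psi>])
    show "\<forall>f\<in>carrier (Hom D (fob S E) F). ?\<psi> (?\<phi> f) = f"
      using \<psi>\<phi> Ob F by (simp add: D.arr_def)
    show "\<forall>g\<in>carrier (Hom C E (fob R F)). ?\<phi> (?\<psi> g) = g"
      using \<phi>\<psi> Ob E by (simp add: C.arr_def)
    show "?\<phi> ` carrier (Hom D (fob S E) F) \<subseteq> carrier (Hom C E (fob R F))"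
      using \<phi> Ob F by (auto simp: C.arr_def D.arr_def)
    show "?\<psi> ` carrier (Hom C E (fob R F)) \<subseteq> carrier (Hom D (fob S E) F)"
      using \<psi> Ob E by (auto simp: C.arr_def D.arr_def)
  qed
qed

section \<open>Shifts, graded dimensions and additivity of the Euler form\<close>

context triangulated_category
begin

lemma shift_ob_iso: "iso_objects C X Y \<Longrightarrow> iso_objects C (shift_ob C n X) (shift_ob C n Y)"
proof -
  assume iso: "iso_objects C X Y"
  have "iso_objects C ((shob ^^ k) X) ((shob ^^ k) Y)" "iso_objects C ((ushob ^^ k) X) ((ushob ^^ k) Y)" for k
    by (induction k) (use iso sh.FG.iso_objects sh.GF.iso_objects in auto)
  then show ?thesis by (simp add: shift_ob_def)
qed

lemma shift_ob_sh: "X \<in> Ob C \<Longrightarrow> iso_objects C (shift_ob C n (shob X)) (shift_ob C (n + 1) X)"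
proof (cases "n \<ge> 0")
  case True
  assume X: "X \<in> Ob C"
  have "shift_ob C (n + 1) X = shift_ob C n (shob X)"
    using True by (simp add: shift_ob_def nat_add_distrib funpow_swap1)
  then show ?thesis using X sh_Ob shift_ob_closed iso_objects_refl by metis
next
  case False
  assume X: "X \<in> Ob C"
  define k where "k = nat (- (n + 1))"
  have "nat (- n) = Suc k" "shift_ob C (n + 1) X = (ushob ^^ k) X"
    using False by (auto simp: k_def shift_ob_def)
  moreover have "iso_objects C ((ushob ^^ k) (ushob (shob X))) ((ushob ^^ k) X)"
    by (induction k) (use ush_sh_iso[OF X] sh.GF.iso_objects in auto)
  ultimately show ?thesis using False by (simp add: shift_ob_def funpow_swap1)
qed

lemma shift_ob_ush:
  assumes X: "X \<in> Ob C"
  shows "iso_objects C (shift_ob C n (ushob X)) (shift_ob C (n - 1) X)"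
proof -
  have "iso_objects C (shift_ob C (n - 1) (shob (ushob X))) (shift_ob C n (ushob X))"
    using shift_ob_sh[OF ush_Ob[OF X], of "n - 1"] by simp
  then show ?thesis
    using shift_ob_iso[OF sh_ush_iso[OF X], of "n - 1"] iso_objects_trans iso_objects_sym by blast
qed

end

context triangulated_functor
begin

lemma fob_shift_ob_iso:
  assumes X: "X \<in> Ob C"
  shows "iso_objects D (fob F (shift_ob C n X)) (shift_ob D n (fob F X))"
proof -
  have Ob: "(fob (sh C) ^^ k) X \<in> Ob C" "(fob (ush C) ^^ k) X \<in> Ob C" for k
    by (induction k) (use X src.sh_Ob src.ush_Ob in auto)
  have "iso_objects D (fob F ((fob (sh C) ^^ k) X)) ((fob (sh D) ^^ k) (fob F X))" for k
  proof (induction k)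
    case 0 show ?case using fob_closed[OF X] tgt.iso_objects_refl by simp
  next
    case (Suc k)
    then show ?case
      using tgt.iso_objects_trans[OF fob_sh_iso[OF Ob(1)] tgt.sh.FG.iso_objects[OF Suc]] by simp
  qed
  moreover have "iso_objects D (fob F ((fob (ush C) ^^ k) X)) ((fob (ush D) ^^ k) (fob F X))" for k
  proof (induction k)
    case 0 show ?case using fob_closed[OF X] tgt.iso_objects_refl by simp
  next
    case (Suc k)
    then show ?case
      using tgt.iso_objects_trans[OF fob_ush_iso[OF Ob(2)] tgt.sh.GF.iso_objects[OF Suc]] by simp
  qed
  ultimately show ?thesis by (simp add: shift_ob_def)
qed

end

locale finite_type_category = triangulated_category +
  assumes finite_type: "finite_type K C"
begin

lemma fin_dim_Hom: "E \<in> Ob C \<Longrightarrow> F \<in> Ob C \<Longrightarrow> vectorspace.fin_dim K (Hom C E F)"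
  using finite_type unfolding finite_type_def
  by (metis funpow_0 nat_0 order_refl shift_ob_def)

lemma hdim_cong:
  assumes "iso_objects C E E'" and "iso_objects C F F'"
  shows "hdim E F = hdim E' F'"
proof -
  have Ob: "E \<in> Ob C" "E' \<in> Ob C" "F \<in> Ob C" "F' \<in> Ob C" using assms by (auto simp: iso_objects_def)
  show ?thesis
    using hdim_iso_left[OF _ _ assms(1) Ob(3)] hdim_iso_right[OF _ _ assms(2) Ob(2)] fin_dim_Hom Ob
    by metis
qed

definition hdims :: "'b \<Rightarrow> 'b \<Rightarrow> int \<Rightarrow> nat" where
  "hdims E F i = hdim E (shift_ob C i F)"

lemma euler_form_altsum: "euler_form K C E F = altsum (hdims E F)"
  by (simp add: euler_form_def altsum_def hdims_def)

lemma finite_hdims: "E \<in> Ob C \<Longrightarrow> F \<in> Ob C \<Longrightarrow> finite {i. hdims E F i \<noteq> 0}"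
  using finite_type by (simp add: finite_type_def hdims_def)

lemma hdims_cong:
  assumes "iso_objects C E E'" and "iso_objects C F F'"
  shows "hdims E F i = hdims E' F' i"
  unfolding hdims_def by (intro hdim_cong assms shift_ob_iso)

lemma hdims_sh_right: "E \<in> Ob C \<Longrightarrow> F \<in> Ob C \<Longrightarrow> hdims E (shob F) i = hdims E F (i + 1)"
  unfolding hdims_def by (intro hdim_cong iso_objects_refl shift_ob_sh)

lemma hdims_ush_right: "E \<in> Ob C \<Longrightarrow> F \<in> Ob C \<Longrightarrow> hdims E (ushob F) i = hdims E F (i - 1)"
  unfolding hdims_def by (intro hdim_cong iso_objects_refl shift_ob_ush)

text \<open>The second argument is written as a shift of \<open>ushob ?F\<close>; full faithfulness
  of the shift then removes one shift from both arguments.\<close>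

lemma hdims_sh_left:
  assumes E: "E \<in> Ob C" and F: "F \<in> Ob C"
  shows "hdims (shob E) F i = hdims E F (i - 1)"
proof -
  let ?F = "shift_ob C i F"
  have Fi: "?F \<in> Ob C" using F by (rule shift_ob_closed)
  have "hdims (shob E) F i = hdim (shob E) (shob (ushob ?F))"
    unfolding hdims_def
    using hdim_cong iso_objects_refl[OF sh_Ob[OF E]] iso_objects_sym[OF sh_ush_iso[OF Fi]] by blast
  also have "\<dots> = hdim E (ushob ?F)"
    using sh.hdim_fob[OF fin_dim_Hom E ush_Ob[OF Fi]] E ush_Ob[OF Fi] by blast
  also have "\<dots> = hdims E F (i - 1)"
    unfolding hdims_def using hdim_cong[OF iso_objects_refl[OF E] ush_shift_ob[OF F]] .
  finally show ?thesis .
qed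

text \<open>The long exact sequence splits at a zero map.\<close>

lemma hdim_cone_zero:
  assumes t: "(B, A, Z, \<zero>\<^bsub>Hom C B A\<^esub>, v, w) \<in> Tri C" and F: "F \<in> Ob C"
  shows "hdim Z F = hdim (shob B) F + hdim A F"
proof -
  note a = tri_arr[OF t]
  have Ob: "A \<in> Ob C" "B \<in> Ob C" "Z \<in> Ob C" "shob B \<in> Ob C" "shob A \<in> Ob C"
    using a sh_Ob by (auto simp: arr_def)
  let ?j = "\<lambda>g. cat_comp C Z (shob B) F g w" and ?g = "\<lambda>h. cat_comp C A Z F h v"
  have lj: "linear_map K (Hom C (shob B) F) (Hom C Z F) ?j"
    using Ob F a by (intro comp_linear_left) (auto simp: arr_def)
  have lg: "linear_map K (Hom C Z F) (Hom C A F) ?g"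
    using Ob F a by (intro comp_linear_left) (auto simp: arr_def)
  interpret j: linear_map K "Hom C (shob B) F" "Hom C Z F" ?j by (rule lj)
  let ?t2 = "\<ominus>\<^bsub>Hom C (shob B) (shob A)\<^esub> fmor (sh C) B A \<zero>\<^bsub>Hom C B A\<^esub>"
  have t2: "(Z, shob B, shob A, w, ?t2, \<ominus>\<^bsub>Hom C (shob A) (shob Z)\<^esub> fmor (sh C) A Z v) \<in> Tri C"
    using tri_rotate[OF tri_rotate[OF t]] .
  have "?t2 = \<zero>\<^bsub>Hom C (shob B) (shob A)\<^esub>"
  proof -
    interpret H: abelian_group "Hom C (shob B) (shob A)" using Ob(4,5) by (rule abelian_group_Hom)
    show ?thesis
      using H.minus_equality[of "\<zero>\<^bsub>Hom C (shob B) (shob A)\<^esub>" "\<zero>\<^bsub>Hom C (shob B) (shob A)\<^esub>"]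
        sh.FG.fmor_zero[OF Ob(2,1)] by simp
  qed
  note t2 = t2[unfolded this]
  have kernel: "g = \<zero>\<^bsub>Hom C (shob B) F\<^esub>"
    if g: "arr g (shob B) F" and gw: "?j g = \<zero>\<^bsub>Hom C Z F\<^esub>" for g
  proof -
    obtain k where k: "arr k (shob A) F"
      "cat_comp C (shob B) (shob A) F k \<zero>\<^bsub>Hom C (shob B) (shob A)\<^esub> = g"
      using tri_weak_cokernel[OF t2 g gw] by blast
    then show ?thesis using comp_zero_right[OF k(1) Ob(4)] by simp
  qed
  have inj: "inj_on ?j (carrier (Hom C (shob B) F))"
  proof (rule inj_onI)
    fix g h assume "g \<in> carrier (Hom C (shob B) F)" "h \<in> carrier (Hom C (shob B) F)" and eq: "?j g = ?j h"
    then have gh: "arr g (shob B) F" "arr h (shob B) F" using Ob F by (auto simp: arr_def)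
    have "?j (g \<ominus>\<^bsub>Hom C (shob B) F\<^esub> h) = \<zero>\<^bsub>Hom C Z F\<^esub>"
      using comp_minus_left[OF a(3) F gh] eq minus_self[OF arr_comp[OF a(3) gh(2)]] by simp
    then show "g = h" using kernel[OF arr_minus[OF gh]] minus_eq_zero_iff[OF gh] by simp
  qed
  have surj: "?g ` carrier (Hom C Z F) = carrier (Hom C A F)"
  proof (intro subset_antisym subsetI)
    fix f assume "f \<in> carrier (Hom C A F)"
    then have f: "arr f A F" using Ob F by (simp add: arr_def)
    obtain h where "arr h Z F" "?g h = f"
      using tri_weak_cokernel[OF t f comp_zero_right[OF f Ob(2)]] by blast
    then show "f \<in> ?g ` carrier (Hom C Z F)" by (auto simp: arr_def)
  qed (use arr_comp[OF a(2)] Ob F in \<open>auto simp: arr_def\<close>)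
  have exact: "?j ` carrier (Hom C (shob B) F) = {h \<in> carrier (Hom C Z F). ?g h = \<zero>\<^bsub>Hom C A F\<^esub>}"
  proof (intro subset_antisym subsetI)
    fix h assume "h \<in> ?j ` carrier (Hom C (shob B) F)"
    then obtain g where g: "arr g (shob B) F" "h = ?j g" using Ob F by (auto simp: arr_def)
    have "?g h = cat_comp C A (shob B) F g (cat_comp C A Z (shob B) w v)"
      using assoc[OF a(2,3) g(1)] g(2) by simp
    then have "?g h = \<zero>\<^bsub>Hom C A F\<^esub>"
      using comp_tri_zero[OF tri_rotate[OF t]] comp_zero_right[OF g(1) Ob(1)] by simp
    then show "h \<in> {h \<in> carrier (Hom C Z F). ?g h = \<zero>\<^bsub>Hom C A F\<^esub>}"
      using arr_comp[OF a(3) g(1)] g(2) by (simp add: arr_def)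
  next
    fix h assume "h \<in> {h \<in> carrier (Hom C Z F). ?g h = \<zero>\<^bsub>Hom C A F\<^esub>}"
    then have h: "arr h Z F" "?g h = \<zero>\<^bsub>Hom C A F\<^esub>" using Ob F by (auto simp: arr_def)
    obtain g where "arr g (shob B) F" "?j g = h"
      using tri_weak_cokernel[OF tri_rotate[OF t] h] by blast
    then show "h \<in> ?j ` carrier (Hom C (shob B) F)" by (auto simp: arr_def)
  qed
  show ?thesis
    by (rule dim_short_exact[OF lj lg _ _ inj surj exact]) (use fin_dim_Hom Ob F in auto)
qed

text \<open>The cone of a zero map, a direct sum of \<open>A\<close> and \<open>B[1]\<close>, is an
  object of class \<open>[A] - [B]\<close>.\<close>

lemma cone_zero:
  assumes A: "A \<in> Ob C" and B: "B \<in> Ob C"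
  obtains Z where "triex B A Z" and "\<And>F. F \<in> Ob C \<Longrightarrow> euler_form K C Z F = euler_form K C A F - euler_form K C B F"
proof -
  obtain Z v w where t: "(B, A, Z, \<zero>\<^bsub>Hom C B A\<^esub>, v, w) \<in> Tri C"
    using TR1_cone[OF B A arr_closed[OF arr_zero[OF B A]]] by blast
  have "euler_form K C Z F = euler_form K C A F - euler_form K C B F" if F: "F \<in> Ob C" for F
  proof -
    \<comment> \<open>Shifting \<open>B\<close> moves its dimensions by one degree, which is the
      source of the minus sign.\<close>
    have "hdims Z F i = hdims A F i + hdims B F (i + (- 1))" for i
      using hdim_cone_zero[OF t shift_ob_closed[OF F], of i] hdims_sh_left[OF B F, of i]
      by (simp add: hdims_def)
    then have "hdims Z F = (\<lambda>i. hdims A F i + hdims B F (i + (- 1)))" by blast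
    moreover have "finite {i. hdims B F (i + (- 1)) \<noteq> 0}"
    proof -
      have "{i. hdims B F (i + (- 1)) \<noteq> 0} = (\<lambda>i. i + 1) ` {i. hdims B F i \<noteq> 0}"
        by (force simp: image_iff)
      then show ?thesis using finite_hdims[OF B F] by simp
    qed
    ultimately show ?thesis
      using altsum_add[OF finite_hdims[OF A F], of "\<lambda>i. hdims B F (i + (- 1))"]
        altsum_shift[of "hdims B F" "- 1"] by (simp add: euler_form_altsum)
  qed
  then show ?thesis using that triexI[OF t] by blast
qed

end

section \<open>Numerical Grothendieck groups\<close>

lemma coset_mult_eqI:
  assumes G: "comm_group G" and N: "subgroup N G"
    and "p \<in> carrier G" "q \<in> carrier G" "n \<in> N" "p = n \<otimes>\<^bsub>G\<^esub> q"
  shows "N #>\<^bsub>G\<^esub> p = N #>\<^bsub>G\<^esub> q"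
proof -
  interpret G: comm_group G by fact
  have "p \<in> N #>\<^bsub>G\<^esub> q" using assms by (auto simp: r_coset_def)
  then show ?thesis using G.repr_independence[OF _ assms(4) N] by simp
qed

context triangulated_category
begin

abbreviation free_objects where "free_objects \<equiv> free_Abelian_group (Ob C)"

lemma groth_relations_subgroup: "subgroup (groth_relations C) free_objects"
  unfolding groth_relations_def
proof (rule group.generate_is_subgroup[OF group_free_Abelian_group])
  have "Poly_Mapping.keys (frag_of E - frag_of F + frag_of G) \<subseteq> Ob C"
    if "(E, F, G, u, v, w) \<in> Tri C" for E F G u v w
  proof -
    have "Poly_Mapping.keys (frag_of E) \<subseteq> Ob C" "Poly_Mapping.keys (frag_of F) \<subseteq> Ob C"
      "Poly_Mapping.keys (frag_of G) \<subseteq> Ob C"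
      using tri_arr[OF that] by (auto simp: arr_def)
    then show ?thesis
      using keys_add[of "frag_of E - frag_of F" "frag_of G"] keys_diff[of "frag_of E" "frag_of F"] by blast
  qed
  then show "{frag_of E - frag_of F + frag_of G | E F G. \<exists>u v w. (E, F, G, u, v, w) \<in> Tri C}
      \<subseteq> carrier free_objects" by fastforce
qed

lemma groth_group_comm: "comm_group (groth_group C)"
  unfolding groth_group_def
  by (intro comm_group.abelian_FactGroup abelian_free_Abelian_group groth_relations_subgroup)

lemma groth_class_closed: "E \<in> Ob C \<Longrightarrow> groth_class C E \<in> carrier (groth_group C)"
  by (auto simp: groth_group_def groth_class_def carrier_FactGroup)

lemma groth_relationI: "triex E F G \<Longrightarrow> frag_of E - frag_of F + frag_of G \<in> groth_relations C"
  unfolding groth_relations_def triex_def by (rule generate.incl) blast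

lemma groth_class_triex:
  assumes "triex E F G"
  shows "groth_class C F = groth_class C E \<otimes>\<^bsub>groth_group C\<^esub> groth_class C G"
proof -
  interpret N: normal "groth_relations C" free_objects
    by (rule comm_group.subgroup_imp_normal[OF abelian_free_Abelian_group groth_relations_subgroup])
  have Ob: "E \<in> Ob C" "F \<in> Ob C" "G \<in> Ob C" using triex_Ob[OF assms] by auto
  let ?r = "frag_of E - frag_of F + frag_of G"
  have r: "?r \<in> groth_relations C"
    using assms by (rule groth_relationI)
  have EG: "frag_of E + frag_of G \<in> carrier free_objects"
    using Ob keys_add[of "frag_of E" "frag_of G"] by auto
  have "groth_relations C #>\<^bsub>free_objects\<^esub> (frag_of E + frag_of G)
      = groth_relations C #>\<^bsub>free_objects\<^esub> frag_of F"
    by (rule coset_mult_eqI[OF abelian_free_Abelian_group groth_relations_subgroup EG _ r])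
      (use Ob in simp_all)
  then show ?thesis
    using N.rcos_sum[of "frag_of E" "frag_of G"] Ob by (simp add: groth_class_def groth_group_def)
qed

lemma numerically_trivial_subgroup: "subgroup (numerically_trivial K C) (groth_group C)"
  unfolding numerically_trivial_def
  by (intro group.generate_is_subgroup comm_group.axioms(2) groth_group_comm) (auto intro: groth_class_closed)

lemma num_groth_group_comm: "comm_group (num_groth_group K C)"
  unfolding num_groth_group_def
  by (intro comm_group.abelian_FactGroup groth_group_comm numerically_trivial_subgroup)

definition num_class :: "'o \<Rightarrow> ('o \<Rightarrow>\<^sub>0 int) set set" where
  "num_class E = numerically_trivial K C #>\<^bsub>groth_group C\<^esub> groth_class C E"

text \<open>The numerical group is a quotient of a quotient of a free group, so
  \<open>hom_eq_Mod\<close> is applied once for each quotient before comparing on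
  generators.\<close>

lemma hom_eq_num_class:
  assumes H: "group H" and f: "f \<in> hom (num_groth_group K C) H" and g: "g \<in> hom (num_groth_group K C) H"
    and eq: "\<And>E. E \<in> Ob C \<Longrightarrow> f (num_class E) = g (num_class E)"
    and x: "x \<in> carrier (num_groth_group K C)"
  shows "f x = g x"
proof (rule hom_eq_Mod[OF groth_group_comm numerically_trivial_subgroup])
  show "f \<in> hom (groth_group C Mod numerically_trivial K C) H"
    "g \<in> hom (groth_group C Mod numerically_trivial K C) H"
    "x \<in> carrier (groth_group C Mod numerically_trivial K C)"
    using f g x by (simp_all add: num_groth_group_def)
  fix f1 g1 assume 1: "f1 \<in> hom (groth_group C) H" "g1 \<in> hom (groth_group C) H"
    "f1 = (\<lambda>x. f (numerically_trivial K C #>\<^bsub>groth_group C\<^esub> x))"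
    "g1 = (\<lambda>x. g (numerically_trivial K C #>\<^bsub>groth_group C\<^esub> x))"
  have eq1: "f1 (groth_class C E) = g1 (groth_class C E)" if "E \<in> Ob C" for E
    using eq[OF that] by (simp add: 1(3,4) num_class_def)
  show "\<forall>x\<in>carrier (groth_group C). f1 x = g1 x"
  proof
    fix y assume y: "y \<in> carrier (groth_group C)"
    show "f1 y = g1 y"
    proof (rule hom_eq_Mod[OF abelian_free_Abelian_group groth_relations_subgroup])
      show "f1 \<in> hom (free_objects Mod groth_relations C) H"
        "g1 \<in> hom (free_objects Mod groth_relations C) H"
        "y \<in> carrier (free_objects Mod groth_relations C)"
        using 1(1,2) y by (simp_all add: groth_group_def)
      fix f2 g2 assume 2: "f2 \<in> hom free_objects H" "g2 \<in> hom free_objects H"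
        "f2 = (\<lambda>x. f1 (groth_relations C #>\<^bsub>free_objects\<^esub> x))"
        "g2 = (\<lambda>x. g1 (groth_relations C #>\<^bsub>free_objects\<^esub> x))"
      have "f2 (frag_of E) = g2 (frag_of E)" if "E \<in> Ob C" for E
        using eq1[OF that] by (simp add: 2(3,4) groth_class_def)
      then show "\<forall>x\<in>carrier free_objects. f2 x = g2 x" using hom_eq_free[OF H 2(1,2)] by blast
    qed
  qed
qed

end

text \<open>Numerically trivial classes are generated by classes of objects, so the difference of
  the two classes has to be realised by an object, which the cone of the zero map provides.\<close>

lemma (in finite_type_category) num_class_eqI:
  assumes A: "A \<in> Ob C" and B: "B \<in> Ob C"
    and eq: "\<And>F. F \<in> Ob C \<Longrightarrow> euler_form K C A F = euler_form K C B F"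
  shows "num_class A = num_class B"
proof -
  obtain Z where Z: "triex B A Z"
    "\<And>F. F \<in> Ob C \<Longrightarrow> euler_form K C Z F = euler_form K C A F - euler_form K C B F"
    using cone_zero[OF A B] by blast
  interpret G: comm_group "groth_group C" by (rule groth_group_comm)
  have ZOb: "Z \<in> Ob C" using triex_Ob[OF Z(1)] by simp
  have "groth_class C Z \<in> numerically_trivial K C"
    unfolding numerically_trivial_def by (rule generate.incl) (use ZOb Z(2) eq in auto)
  moreover have "groth_class C A = groth_class C Z \<otimes>\<^bsub>groth_group C\<^esub> groth_class C B"
    using groth_class_triex[OF Z(1)] G.m_comm groth_class_closed B ZOb by simp
  ultimately show ?thesis
    unfolding num_class_def
    by (rule coset_mult_eqI[OF groth_group_comm numerically_trivial_subgroup
          groth_class_closed[OF A] groth_class_closed[OF B]])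
qed

section \<open>Induced maps on numerical Grothendieck groups\<close>

context triangulated_functor
begin

text \<open>Exactness gives the map on Grothendieck groups, and \<open>triv\<close> its descent to
  the numerical quotient; \<open>triv\<close> will come from a right adjoint for \<open>S\<close>
  and from quasi-inverses for \<open>T\<close> and \<open>W\<close>.\<close>

lemma num_groth_map:
  assumes triv: "\<And>E. \<lbrakk>E \<in> Ob C; \<forall>F' \<in> Ob C. euler_form K C E F' = 0\<rbrakk>
      \<Longrightarrow> \<forall>F' \<in> Ob D. euler_form K D (fob F E) F' = 0"
  shows num_groth_map_hom: "num_groth_map K D F \<in> hom (num_groth_group K C) (num_groth_group K D)"
    and num_groth_map_class: "E \<in> Ob C \<Longrightarrow> num_groth_map K D F (src.num_class E) = tgt.num_class (fob F E)"
proof -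
  let ?h = "frag_extend (\<lambda>E. frag_of (fob F E)) :: ('o \<Rightarrow>\<^sub>0 int) \<Rightarrow> ('p \<Rightarrow>\<^sub>0 int)"
  have h: "?h \<in> hom src.free_objects tgt.free_objects"
    by (rule frag_extend_hom) (use fob_closed in auto)
  have "?h ` groth_relations C \<subseteq> groth_relations D"
    unfolding groth_relations_def[of C]
  proof (rule hom_generate_subset[OF _ _ h _ tgt.groth_relations_subgroup])
    let ?R = "{frag_of E - frag_of F + frag_of G | E F G. \<exists>u v w. (E, F, G, u, v, w) \<in> Tri C}"
    show "?R \<subseteq> carrier src.free_objects"
      using src.groth_relations_subgroup[THEN subgroup.subset] generate.incl[of _ ?R]
      unfolding groth_relations_def by blast
    show "?h ` ?R \<subseteq> groth_relations D"
    proof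
      fix x assume "x \<in> ?h ` ?R"
      then obtain E F' G u v w where t: "(E, F', G, u, v, w) \<in> Tri C"
        and x: "x = frag_of (fob F E) - frag_of (fob F F') + frag_of (fob F G)"
        by (auto simp: frag_extend_add frag_extend_diff frag_extend_of)
      show "x \<in> groth_relations D"
        unfolding x by (rule tgt.groth_relationI[OF triex[OF src.triexI[OF t]]])
    qed
  qed simp_all
  note cm1 = coset_map[OF abelian_free_Abelian_group abelian_free_Abelian_group
      src.groth_relations_subgroup tgt.groth_relations_subgroup h this]
  let ?g = "coset_map tgt.free_objects (groth_relations D) ?h"
  have g: "?g \<in> hom (groth_group C) (groth_group D)"
    unfolding groth_group_def by (rule cm1(1))
  have g_class: "?g (groth_class C E) = groth_class D (fob F E)" if "E \<in> Ob C" for E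
    unfolding groth_class_def using cm1(2)[of "frag_of E"] that by (simp add: frag_extend_of)
  have "?g ` numerically_trivial K C \<subseteq> numerically_trivial K D"
    unfolding numerically_trivial_def[of K C]
  proof (rule hom_generate_subset[OF _ _ g _ tgt.numerically_trivial_subgroup])
    show "?g ` {groth_class C E | E. E \<in> Ob C \<and> (\<forall>F\<in>Ob C. euler_form K C E F = 0)}
        \<subseteq> numerically_trivial K D"
    proof
      fix x assume "x \<in> ?g ` {groth_class C E | E. E \<in> Ob C \<and> (\<forall>F\<in>Ob C. euler_form K C E F = 0)}"
      then obtain E where E: "E \<in> Ob C" "\<forall>F\<in>Ob C. euler_form K C E F = 0" "x = groth_class D (fob F E)"
        using g_class by auto
      then show "x \<in> numerically_trivial K D"
        unfolding numerically_trivial_def using triv[OF E(1,2)] fob_closed[OF E(1)]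
        by (intro generate.incl) blast
    qed
  qed (use src.groth_group_comm tgt.groth_group_comm src.groth_class_closed
      in \<open>auto intro: comm_group.axioms(2)\<close>)
  note cm2 = coset_map[OF src.groth_group_comm tgt.groth_group_comm
      src.numerically_trivial_subgroup tgt.numerically_trivial_subgroup g this]
  show "num_groth_map K D F \<in> hom (num_groth_group K C) (num_groth_group K D)"
    unfolding num_groth_map_def num_groth_group_def by (rule cm2(1))
  show "num_groth_map K D F (src.num_class E) = tgt.num_class (fob F E)" if "E \<in> Ob C"
    unfolding num_groth_map_def src.num_class_def tgt.num_class_def
    using cm2(2)[OF src.groth_class_closed[OF that]] g_class[OF that] by simp
qed

end

text \<open>Supplies the nonzero objects that make entropies real. If all objects were zero, a
  triangle on \<open>E\<close>, \<open>E\<close>, \<open>E\<close> would give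
  \<open>[E] = [E] + [E]\<close>, so all classes and then all pure tensors would vanish.\<close>

lemma num_space_nontrivial:
  assumes C: "triangulated_category K C" and v: "v \<in> carrier (num_space K C)" "v \<noteq> \<zero>\<^bsub>num_space K C\<^esub>"
  shows "\<exists>X \<in> Ob C. \<not> is_zero_object C X"
proof (rule ccontr)
  interpret C: triangulated_category K C by fact
  interpret G: comm_group "groth_group C" by (rule C.groth_group_comm)
  interpret N: comm_group "num_groth_group K C" by (rule C.num_groth_group_comm)
  interpret V: comm_group "tensor_group (num_groth_group K C)" by (rule N.tensor_group_comm)
  assume "\<not> (\<exists>X \<in> Ob C. \<not> is_zero_object C X)"
  then have z: "is_zero_object C X" if "X \<in> Ob C" for X using that by blast
  have "C.num_class E = \<one>\<^bsub>num_groth_group K C\<^esub>" if E: "E \<in> Ob C" for E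
  proof -
    note c = C.groth_class_closed[OF E]
    have "groth_class C E = groth_class C E \<otimes>\<^bsub>groth_group C\<^esub> groth_class C E"
      using C.groth_class_triex[OF C.triex_first_zero[OF z[OF E] E]] .
    then have "groth_class C E = \<one>\<^bsub>groth_group C\<^esub>" using G.l_cancel_one'[OF c c] by metis
    then show ?thesis
      using subgroup.subset[OF C.numerically_trivial_subgroup]
      by (simp add: C.num_class_def num_groth_group_def)
  qed
  then have "x = \<one>\<^bsub>num_groth_group K C\<^esub>" if "x \<in> carrier (num_groth_group K C)" for x
    using C.hom_eq_num_class[OF N.is_group, of "\<lambda>x. x" "\<lambda>_. \<one>\<^bsub>num_groth_group K C\<^esub>" x] that
    by (simp add: hom_def)
  then have "tensor (num_groth_group K C) x a = \<one>\<^bsub>tensor_group (num_groth_group K C)\<^esub>"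
    if "x \<in> carrier (num_groth_group K C)" for x a using that N.tensor_one by metis
  then have "v = \<one>\<^bsub>tensor_group (num_groth_group K C)\<^esub>"
    using N.hom_eq_tensor[OF V.is_group, of "\<lambda>x. x" "\<lambda>_. \<one>\<^bsub>tensor_group (num_groth_group K C)\<^esub>" v] v(1)
    by (simp add: hom_def carrier_complexification)
  then show False using v(2) by (simp add: zero_complexification)
qed

lemma linear_functor_id: "linear_category K C \<Longrightarrow> linear_functor K C C id_functor"
  unfolding linear_functor_def id_functor_def
  by (auto intro!: linear_mapI linear_category.Hom_vectorspace)

lemma linear_functor_comp:
  assumes "linear_functor K B C F" and "linear_functor K C D G"
  shows "linear_functor K B D (G \<circ>\<^sub>F F)"
proof -
  have F: "fob F X \<in> Ob C" "fmor F X Y f \<in> carrier (Hom C (fob F X) (fob F Y))"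
    if "X \<in> Ob B" "Y \<in> Ob B" "f \<in> carrier (Hom B X Y)" for X Y f
  proof -
    interpret linear_map K "Hom B X Y" "Hom C (fob F X) (fob F Y)" "fmor F X Y"
      using assms(1) that by (simp add: linear_functor_def)
    show "fob F X \<in> Ob C" "fmor F X Y f \<in> carrier (Hom C (fob F X) (fob F Y))"
      using assms(1) that by (auto simp: linear_functor_def)
  qed
  have "linear_map K (Hom B X Y) (Hom D (fob G (fob F X)) (fob G (fob F Y))) (fmor (G \<circ>\<^sub>F F) X Y)"
    if "X \<in> Ob B" "Y \<in> Ob B" for X Y
    using assms that linear_map_comp[of K "Hom B X Y" "Hom C (fob F X) (fob F Y)" "fmor F X Y"
        "Hom D (fob G (fob F X)) (fob G (fob F Y))" "fmor G (fob F X) (fob F Y)"]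
    by (simp add: linear_functor_def comp_functor_def)
  with assms F show ?thesis
    unfolding linear_functor_def by simp
qed

lemma elog_mono: "x \<le> y \<Longrightarrow> elog x \<le> elog y"
  by (cases x; cases y) (auto simp: elog_def)

text \<open>The adjunction in each degree, combined with \<open>R (F[i])\<close> being isomorphic to
  \<open>(R F)[i]\<close>.\<close>

lemma euler_form_left_adjoint:
  assumes C: "finite_type_category K C" and D: "finite_type_category K D"
    and R: "exact_functor K D C R" and adj: "adjunction K C D S R unit counit"
    and E: "E \<in> Ob C" and F: "F \<in> Ob D"
  shows "finite_type_category.hdims K D (fob S E) F = finite_type_category.hdims K C E (fob R F)"
proof
  fix i
  interpret C: finite_type_category K C by fact
  interpret D: finite_type_category K D by fact
  interpret R: triangulated_functor K D C R
    using D.triangulated_category_axioms C.triangulated_category_axioms R by (rule triangulated_functorI)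
  have SE: "fob S E \<in> Ob D" using adj E by (auto simp: adjunction_def linear_functor_def)
  have Fi: "shift_ob D i F \<in> Ob D" using F by (rule D.shift_ob_closed)
  show "D.hdims (fob S E) F i = C.hdims E (fob R F) i"
    unfolding D.hdims_def C.hdims_def
    using hdim_adjunction[OF C.linear_category_axioms D.linear_category_axioms adj E Fi D.fin_dim_Hom[OF SE Fi]]
      C.hdim_cong[OF C.iso_objects_refl[OF E] R.fob_shift_ob_iso[OF F]] by simp
qed

context triangulated_autoequivalence
begin

lemma hdims_fob:
  assumes "finite_type K C" and E: "E \<in> Ob C" and X: "X \<in> Ob C"
  shows "finite_type_category.hdims K C (fob F E) (fob F X) = finite_type_category.hdims K C E X"
proof
  fix i
  interpret finite_type_category K C
    using src.triangulated_category_axioms assms(1)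
    by (simp add: finite_type_category_def finite_type_category_axioms_def)
  have Xi: "shift_ob C i X \<in> Ob C" using X by (rule src.shift_ob_closed)
  show "hdims (fob F E) (fob F X) i = hdims E X i"
    unfolding hdims_def
    using hdim_cong[OF src.iso_objects_refl[OF fob_closed[OF E]] fob_shift_ob_iso[OF X]]
      eq.hdim_fob[OF fin_dim_Hom[OF E Xi] E Xi] by simp
qed

text \<open>Every test object is isomorphic to one of the form \<open>F (F' X)\<close>, and an
  equivalence preserves graded dimensions.\<close>

lemma euler_form_trivial:
  assumes ft: "finite_type K C" and E: "E \<in> Ob C" and triv: "\<forall>X \<in> Ob C. euler_form K C E X = 0"
  shows "\<forall>X \<in> Ob C. euler_form K C (fob F E) X = 0"
proof
  interpret finite_type_category K C
    using src.triangulated_category_axioms ft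
    by (simp add: finite_type_category_def finite_type_category_axioms_def)
  fix X assume X: "X \<in> Ob C"
  have X': "fob F' X \<in> Ob C" using X by (rule eq.GF.fob_closed)
  have "hdims (fob F E) X = hdims (fob F E) (fob F (fob F' X))"
    using hdims_cong[OF src.iso_objects_refl[OF fob_closed[OF E]] eq.FG_iso[OF X]] by fastforce
  also have "\<dots> = hdims E (fob F' X)" by (rule hdims_fob[OF ft E X'])
  finally show "euler_form K C (fob F E) X = 0"
    using triv X' by (simp add: euler_form_altsum)
qed

end

theorem proposition1p9:
  fixes K :: "'k ring"
    and C :: "('k, 'o, 'm, 'a, 'b) enh_cat"
    and D :: "('k, 'p, 'n, 'c, 'd) enh_cat"
    and S :: "('o, 'm, 'p, 'n) cfunctor"
    and R L :: "('p, 'n, 'o, 'm) cfunctor"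
    and T :: "('p, 'n, 'p, 'n) cfunctor"
    and W :: "('o, 'm, 'o, 'm) cfunctor"
    and v :: "(('o \<Rightarrow>\<^sub>0 int) set set \<times> complex \<Rightarrow>\<^sub>0 int) set"
    and l :: complex
  assumes "field K"
    and "enhanced_triangulated_category K C"
    and "enhanced_triangulated_category K D"
    and "finite_type K C"
    and "finite_type K D"
    and "has_finite_rank (num_groth_group K C)"
    and "has_finite_rank (num_groth_group K D)"
    and "spherical_functor K C D S R L T W"
    and "\<exists>G. split_generator D G"
    and "\<exists>E G. E \<in> Ob D \<and> iso_objects C (fob R E) G \<and> split_generator C G"
    and "entropy C 0 W \<le> elog (ereal (spectral_radius (num_space K C) (num_map K C W)))"
    and "v \<in> carrier (num_space K C)"
    and "num_map K D S v \<noteq> \<zero>\<^bsub>num_space K D\<^esub>"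
    and "num_map K C W v = l \<odot>\<^bsub>num_space K C\<^esub> v"
    and "cmod l = spectral_radius (num_space K C) (num_map K C W)"
  shows "entropy D 0 T \<le> elog (ereal (spectral_radius (num_space K D) (num_map K D T)))"
proof -
  have triC: "triangulated_category K C" and triD: "triangulated_category K D"
    using assms(2,3) by (simp_all add: enhanced_triangulated_category_def)
  interpret C: finite_type_category K C
    using triC assms(4) by (simp add: finite_type_category_def finite_type_category_axioms_def)
  interpret D: finite_type_category K D
    using triD assms(5) by (simp add: finite_type_category_def finite_type_category_axioms_def)
  obtain unit counit where adj: "adjunction K C D S R unit counit"
    and cone: "is_cone_of K D D (S \<circ>\<^sub>F R) id_functor counit T"
    using assms(8) by (auto simp: spherical_functor_def)
  have S: "exact_functor K C D S" and R: "exact_functor K D C R" and L: "exact_functor K D C L"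
    and T: "exact_equivalence K D D T" and W: "exact_equivalence K C C W"
    and RLT: "iso_functors D C R (ush C \<circ>\<^sub>F L \<circ>\<^sub>F T)" and RWL: "iso_functors D C R (sh C \<circ>\<^sub>F W \<circ>\<^sub>F L)"
    using assms(8) by (auto simp: spherical_functor_def)
  interpret S: triangulated_functor K C D S using triC triD S by (rule triangulated_functorI)
  interpret R: triangulated_functor K D C R using triD triC R by (rule triangulated_functorI)
  interpret L: triangulated_functor K D C L using triD triC L by (rule triangulated_functorI)
  obtain T' W' where T': "quasi_inverse K D D T T'" and W': "quasi_inverse K C C W W'"
    using T W by (auto simp: exact_equivalence_def equivalence_def)
  interpret T: triangulated_autoequivalence K D T T'
    using T T' triangulated_functorI[OF triD triD]
    by (simp add: triangulated_autoequivalence_def triangulated_autoequivalence_axioms_def exact_equivalence_def)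
  interpret W: triangulated_autoequivalence K C W W'
    using W W' triangulated_functorI[OF triC triC]
    by (simp add: triangulated_autoequivalence_def triangulated_autoequivalence_axioms_def exact_equivalence_def)
  interpret NC: comm_group "num_groth_group K C" by (rule C.num_groth_group_comm)
  interpret ND: comm_group "num_groth_group K D" by (rule D.num_groth_group_comm)
  interpret VD: comm_group "tensor_group (num_groth_group K D)" by (rule ND.tensor_group_comm)

  have trivS: "\<forall>F \<in> Ob D. euler_form K D (fob S E) F = 0"
    if "E \<in> Ob C" "\<forall>F \<in> Ob C. euler_form K C E F = 0" for E
    using that euler_form_left_adjoint[OF C.finite_type_category_axioms D.finite_type_category_axioms R adj that(1)]
      R.fob_closed by (simp add: C.euler_form_altsum D.euler_form_altsum)
  have mS: "num_groth_map K D S \<in> hom (num_groth_group K C) (num_groth_group K D)"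
    by (rule S.num_groth_map(1)) (rule trivS)
  have mS_class: "num_groth_map K D S (C.num_class E) = D.num_class (fob S E)"
    if "E \<in> Ob C" for E
    by (rule S.num_groth_map(2)[OF _ that]) (rule trivS)
  have mT: "num_groth_map K D T \<in> hom (num_groth_group K D) (num_groth_group K D)"
    by (rule T.num_groth_map(1)) (rule T.euler_form_trivial[OF assms(5)])
  have mT_class: "num_groth_map K D T (D.num_class E) = D.num_class (fob T E)"
    if "E \<in> Ob D" for E
    by (rule T.num_groth_map(2)[OF _ that]) (rule T.euler_form_trivial[OF assms(5)])
  have mW: "num_groth_map K C W \<in> hom (num_groth_group K C) (num_groth_group K C)"
    by (rule W.num_groth_map(1)) (rule W.euler_form_trivial[OF assms(4)])
  have mW_class: "num_groth_map K C W (C.num_class E) = C.num_class (fob W E)"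
    if "E \<in> Ob C" for E
    by (rule W.num_groth_map(2)[OF _ that]) (rule W.euler_form_trivial[OF assms(4)])
  note cS = NC.complexification_map_tensor[OF ND.comm_group_axioms mS]
  note cT = ND.complexification_map_tensor[OF ND.comm_group_axioms mT]
  note cW = NC.complexification_map_tensor[OF NC.comm_group_axioms mW]

  \<comment> \<open>Both sides are compared with the graded dimensions of
    \<open>Hom(X, L F)\<close>. For \<open>S W X\<close> the isomorphism of \<open>R\<close> with
    \<open>W L[1]\<close> lets \<open>W\<close> cancel; for \<open>T S X\<close> the twist moves to
    the test object, and \<open>R T'\<close> is isomorphic to \<open>L[-1]\<close>.\<close>
  have TS: "D.num_class (fob T (fob S X)) = D.num_class (fob S (fob W X))" if X: "X \<in> Ob C" for X
  proof (rule D.num_class_eqI)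
    have WX: "fob W X \<in> Ob C" and SX: "fob S X \<in> Ob D"
      using X by (auto intro: W.fob_closed S.fob_closed)
    show "fob T (fob S X) \<in> Ob D" "fob S (fob W X) \<in> Ob D"
      using WX SX by (auto intro: T.fob_closed S.fob_closed)
    fix F assume F: "F \<in> Ob D"
    have T'F: "fob T' F \<in> Ob D" and LF: "fob L F \<in> Ob C" and WLF: "fob W (fob L F) \<in> Ob C"
      using F by (auto intro: T.eq.GF.fob_closed L.fob_closed W.fob_closed)
    have "iso_objects C (fob R F) (fob (sh C) (fob W (fob L F)))"
      using iso_functors_objects[OF RWL, of F] F WLF by (simp add: R.fob_closed C.sh_Ob)
    then have "C.hdims (fob W X) (fob R F) i = C.hdims X (fob L F) (i + 1)" for i
      using C.hdims_cong[OF C.iso_objects_refl[OF WX]] C.hdims_sh_right[OF WX WLF]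
        W.hdims_fob[OF assms(4) X LF] by metis
    then have 1: "D.hdims (fob S (fob W X)) F = (\<lambda>i. C.hdims X (fob L F) (i + 1))"
      using euler_form_left_adjoint[OF C.finite_type_category_axioms D.finite_type_category_axioms R adj WX F]
      by auto
    have "iso_objects C (fob R (fob T' F)) (fob (ush C) (fob L (fob T (fob T' F))))"
      using iso_functors_objects[OF RLT, of "fob T' F"] T'F
      by (simp add: R.fob_closed L.fob_closed T.fob_closed C.ush_Ob)
    moreover have "iso_objects C (fob (ush C) (fob L (fob T (fob T' F)))) (fob (ush C) (fob L F))"
      using T.eq.FG_iso[OF F] by (intro C.sh.GF.iso_objects L.iso_objects)
    ultimately have "iso_objects C (fob R (fob T' F)) (fob (ush C) (fob L F))"
      by (rule C.iso_objects_trans)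
    then have "C.hdims X (fob R (fob T' F)) i = C.hdims X (fob L F) (i + (- 1))" for i
      using C.hdims_cong[OF C.iso_objects_refl[OF X]] C.hdims_ush_right[OF X LF, of i] by simp
    moreover have "D.hdims (fob T (fob S X)) F i = D.hdims (fob T (fob S X)) (fob T (fob T' F)) i" for i
      using T.eq.FG_iso[OF F] D.iso_objects_refl[OF T.fob_closed[OF SX]]
      by (intro D.hdims_cong D.iso_objects_sym[OF T.eq.FG_iso[OF F]])
    ultimately have 2: "D.hdims (fob T (fob S X)) F = (\<lambda>i. C.hdims X (fob L F) (i + (- 1)))"
      using T.hdims_fob[OF assms(5) SX T'F]
        euler_form_left_adjoint[OF C.finite_type_category_axioms D.finite_type_category_axioms R adj X T'F]
      by auto
    \<comment> \<open>The shifts by 1 and by -1 are both odd, so each contributes the same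
      sign.\<close>
    show "euler_form K D (fob T (fob S X)) F = euler_form K D (fob S (fob W X)) F"
      using altsum_shift[of "C.hdims X (fob L F)" 1] altsum_shift[of "C.hdims X (fob L F)" "- 1"]
      by (simp only: D.euler_form_altsum 1 2) simp
  qed
  have TSx: "num_groth_map K D T (num_groth_map K D S x) = num_groth_map K D S (num_groth_map K C W x)"
    if x: "x \<in> carrier (num_groth_group K C)" for x
  proof -
    have "(num_groth_map K D T \<circ> num_groth_map K D S) x = (num_groth_map K D S \<circ> num_groth_map K C W) x"
    proof (rule C.hom_eq_num_class[OF ND.is_group Group.hom_compose[OF mS mT]
            Group.hom_compose[OF mW mS] _ x])
      fix E assume E: "E \<in> Ob C"
      show "(num_groth_map K D T \<circ> num_groth_map K D S) (C.num_class E)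
          = (num_groth_map K D S \<circ> num_groth_map K C W) (C.num_class E)"
        unfolding comp_apply mS_class[OF E] mW_class[OF E] mT_class[OF S.fob_closed[OF E]]
          mS_class[OF W.fob_closed[OF E]] by (rule TS[OF E])
    qed
    then show ?thesis by (simp only: comp_apply)
  qed
  have v: "v \<in> carrier (tensor_group (num_groth_group K C))"
    using assms(12) by (simp only: carrier_complexification)
  have "(num_map K D T \<circ> num_map K D S) v = (num_map K D S \<circ> num_map K C W) v"
  proof (rule NC.hom_eq_tensor[OF VD.is_group Group.hom_compose[OF cS(1) cT(1)]
          Group.hom_compose[OF cW(1) cS(1)] _ v])
    fix x a assume x: "x \<in> carrier (num_groth_group K C)"
    show "(num_map K D T \<circ> num_map K D S) (tensor (num_groth_group K C) x a)
        = (num_map K D S \<circ> num_map K C W) (tensor (num_groth_group K C) x a)"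
      unfolding comp_apply cS(2)[OF x] cW(2)[OF x] cT(2)[OF hom_in_carrier[OF mS x]]
        cS(2)[OF hom_in_carrier[OF mW x]] TSx[OF x] ..
  qed
  then have "num_map K D T (num_map K D S v) = num_map K D S (num_map K C W v)"
    by (simp only: comp_apply)
  then have eigen: "num_map K D T (num_map K D S v) = l \<odot>\<^bsub>num_space K D\<^esub> num_map K D S v"
    using NC.complexification_map_smult[OF ND.comm_group_axioms mS v] assms(14) by simp
  have Sv: "num_map K D S v \<in> carrier (num_space K D)"
    using hom_in_carrier[OF cS(1) v] by (simp add: carrier_complexification)
  then have "l \<in> eigenvalues (num_space K D) (num_map K D T)"
    using eigen assms(13) by (auto simp: eigenvalues_def)
  \<comment> \<open>Finiteness of the spectrum is what lets an eigenvalue bound the maximum from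
    below; \<open>Max\<close> of an infinite set is unspecified.\<close>
  then have rho: "cmod l \<le> spectral_radius (num_space K D) (num_map K D T)"
    unfolding spectral_radius_def using ND.finite_eigenvalues[OF assms(7) mT] by (intro Max_ge) auto

  obtain XD where XD: "XD \<in> Ob D" "\<not> is_zero_object D XD"
    using num_space_nontrivial[OF triD Sv assms(13)] by blast
  have "v \<noteq> \<zero>\<^bsub>num_space K C\<^esub>"
    using assms(13) hom_one[OF cS(1) comm_group.axioms(2)[OF NC.tensor_group_comm] VD.is_group]
    by (auto simp: zero_complexification)
  then obtain XC where XC: "XC \<in> Ob C" "\<not> is_zero_object C XC"
    using num_space_nontrivial[OF triC assms(12)] by blast
  have "linear_functor K D D (S \<circ>\<^sub>F R)" "linear_functor K D D id_functor"
    using linear_functor_comp[OF R.linear_functor S.linear_functor]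
      linear_functor_id[OF D.linear_category_axioms] by auto
  then have "D.triex (fob S (fob R X)) X (fob T X)" if "X \<in> Ob D" for X
    using cone_triangle[OF assms(3,3) cone _ _ T.linear_functor that] by simp
  then have "entropy D 0 T \<le> entropy C 0 W"
    using assms(9,10) by (intro entropy_twist_le_cotwist[OF triC triD S R L T W _ RLT RWL _ _ XC XD]) auto
  also have "\<dots> \<le> elog (ereal (cmod l))" using assms(11,15) by simp
  also have "\<dots> \<le> elog (ereal (spectral_radius (num_space K D) (num_map K D T)))"
    using rho by (intro elog_mono) simp
  finally show ?thesis .
qed

end
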